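(* Let $d,h\ge1$, $1/2<\alpha\le1$, and let $\mathbf{x}:[0,1]\to\mathbb{R}^h$ satisfy $|\mathbf{x}(t)-\mathbf{x}(s)|\le C_\alpha|t-s|^\alpha$ for all $s,t\in[0,1]$, for some $C_\alpha\in(0,\infty)$. Let $\mathbf{f}=[f_{ij}]:\mathbb{R}^d\to\mathbb{R}^{d\times h}$ with each $f_{ij}\in C^2(\mathbb{R}^d)$ and $\max\{|\mathbf{f}|,|\nabla\mathbf{f}|,|\nabla^2\mathbf{f}|\}<\infty$. Let $\mathbf{y}$ be the solution of $\mathbf{y}(t)=\mathbf{y}_0+\int_0^t\mathbf{f}(\mathbf{y}(s))\,d\mathbf{x}(s)$, $t\in[0,1]$ (Young integral). For $n\ge0$ let $t^n_k=k/2^n$, $\Delta_n=2^{-n}$, and define the Euler scheme $\mathbf{y}_n(t^n_0)=\mathbf{y}_0$, $\mathbf{y}_n(t^n_{k+1})=\mathbf{y}_n(t^n_k)+\mathbf{f}(\mathbf{y}_n(t^n_k))(\mathbf{x}(t^n_{k+1})-\mathbf{x}(t^n_k))$ for $k=0,\dots,2^n-1$, extended by $\mathbf{y}_n(t)=\mathbf{y}_n(t^n_k)$ for $t\in[t^n_k,t^n_{k+1})$. Then $$\sup_{t\in[0,1]}|\mathbf{y}_n(t)-\mathbf{y}(t)|\le G\cdot\Delta_n^{2\alpha-1},\qquad G:=\Upsilon_{\lceil(4\zeta)^{1/\alpha}\rceil}+G_1^*,$$ with the constants defined in the context.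
   Context: For a vector or matrix, $|\cdot|$ denotes the maximum absolute value of its entries; $|\mathbf{f}|=\max_{ij}\sup|f_{ij}|$, $|\nabla\mathbf{f}|=\max_{ij}\sup|\nabla f_{ij}|$, $|\nabla^2\mathbf{f}|=\max_{ij}\sup|\nabla^2 f_{ij}|$ (entrywise maxima). $K(2\alpha)=1+\sum_{n\ge1}n^{-2\alpha}$. Constants: $G_1^*=2h\lceil(2dhC_\alpha K(2\alpha)|\nabla\mathbf{f}|)^{1/\alpha}\rceil^{1-\alpha}|\mathbf{f}|C_\alpha$; $G_2^*=dhK(2\alpha)|\nabla\mathbf{f}|C_\alpha G_1^*$; $L=\frac{4}{1-2^{1-2\alpha}}(hC_\alpha)^2|\nabla\mathbf{f}||\mathbf{f}|$; $\omega=(h|\mathbf{f}|C_\alpha/L)^{1/\alpha}$; $G_1=(L+h|\mathbf{f}|C_\alpha)(1+\omega^{-1})$; $\zeta=hK(2\alpha)C_\alpha\bigl(d|\nabla\mathbf{f}|+d^2|\nabla^2\mathbf{f}|(G_1^*+G_1)\bigr)$; $\upsilon=C_\alpha\bigl(d^2hK(2\alpha)|\nabla^2\mathbf{f}|(G_1^*+G_1)+d|\nabla\mathbf{f}|\bigr)$; $\Gamma_1=2G_2^*$, $\Upsilon_1=(4\zeta)^{-1}\Gamma_1$, and for $k\ge2$: $\Gamma_k=2(G_2^*+\upsilon\Upsilon_{k-1})$, $\Upsilon_k=(4\zeta)^{-1}\Gamma_k+\Upsilon_{k-1}$. The Young integral $\int_0^1 v\,du$ of continuous paths of finite $p$- and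 $q$-variation with $1/p+1/q>1$ is the limit of Riemann sums $\sum v(t_i)(u(t_{i+1})-u(t_i))$ as the mesh tends to $0$.
   Formalization: The formal theorem additionally assumes |∇f| > 0; when |∇f| = 0 (f constant) one has L = 0 and ζ = 0, so ω, Υ_1 and the index ⌈(4ζ)^{1/α}⌉ of Υ, hence G, are undefined. *)

theory Defs
  imports "HOL-Analysis.Analysis"
begin

definition vabs :: "real^'n \<Rightarrow> real" where
  "vabs v = Max (range (\<lambda>i. \<bar>v $ i\<bar>))"

definition mabs :: "real^'h^'d \<Rightarrow> real" where
  "mabs M = Max {\<bar>M $ i $ j\<bar> | i j. True}"

definition has_pd :: "(real^'n \<Rightarrow> real) \<Rightarrow> 'n \<Rightarrow> real^'n \<Rightarrow> bool" where
  "has_pd g k y \<longleftrightarrow> (\<lambda>t. g (y + t *\<^sub>R axis k 1)) differentiable (at 0)"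

definition pd :: "(real^'n \<Rightarrow> real) \<Rightarrow> 'n \<Rightarrow> real^'n \<Rightarrow> real" where
  "pd g k y = deriv (\<lambda>t. g (y + t *\<^sub>R axis k 1)) 0"

definition C2 :: "(real^'n \<Rightarrow> real) \<Rightarrow> bool" where
  "C2 g \<longleftrightarrow> continuous_on UNIV g
     \<and> (\<forall>k y. has_pd g k y) \<and> (\<forall>k. continuous_on UNIV (pd g k))
     \<and> (\<forall>k l y. has_pd (pd g k) l y) \<and> (\<forall>k l. continuous_on UNIV (pd (pd g k) l))"

definition norm0 :: "(real^'d \<Rightarrow> real^'h^'d) \<Rightarrow> real" where
  "norm0 f = (SUP y. mabs (f y))"

definition norm1 :: "(real^'d \<Rightarrow> real^'h^'d) \<Rightarrow> real" where
  "norm1 f = (SUP y. Max {\<bar>pd (\<lambda>z. f z $ i $ j) k y\<bar> | i j k. True})"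

definition norm2 :: "(real^'d \<Rightarrow> real^'h^'d) \<Rightarrow> real" where
  "norm2 f = (SUP y. Max {\<bar>pd (pd (\<lambda>z. f z $ i $ j) k) l y\<bar> | i j k l. True})"

definition is_partition :: "(nat \<Rightarrow> real) \<Rightarrow> nat \<Rightarrow> real \<Rightarrow> real \<Rightarrow> bool" where
  "is_partition p m a b \<longleftrightarrow> p 0 = a \<and> p m = b \<and> (\<forall>i<m. p i < p (Suc i))"

definition mesh :: "(nat \<Rightarrow> real) \<Rightarrow> nat \<Rightarrow> real" where
  "mesh p m = Max (insert 0 ((\<lambda>i. p (Suc i) - p i) ` {..<m}))"

definition young_sum :: "(real \<Rightarrow> real^'h^'d) \<Rightarrow> (real \<Rightarrow> real^'h) \<Rightarrow> (nat \<Rightarrow> real) \<Rightarrow> nat \<Rightarrow> real^'d" where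
  "young_sum V U p m = (\<Sum>i<m. V (p i) *v (U (p (Suc i)) - U (p i)))"

definition has_young_integral ::
  "(real \<Rightarrow> real^'h^'d) \<Rightarrow> (real \<Rightarrow> real^'h) \<Rightarrow> real \<Rightarrow> real \<Rightarrow> real^'d \<Rightarrow> bool" where
  "has_young_integral V U a b I \<longleftrightarrow>
     (\<forall>e>0. \<exists>\<delta>>0. \<forall>p m. is_partition p m a b \<and> mesh p m < \<delta> \<longrightarrow>
        vabs (young_sum V U p m - I) < e)"

definition finite_pvar :: "real \<Rightarrow> (real \<Rightarrow> real^'n) \<Rightarrow> real \<Rightarrow> real \<Rightarrow> bool" where
  "finite_pvar q v a b \<longleftrightarrow> (\<exists>M. \<forall>p m. is_partition p m a b \<longrightarrow>
      (\<Sum>i<m. vabs (v (p (Suc i)) - v (p i)) powr q) \<le> M)"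

primrec euler_pts :: "(real^'d \<Rightarrow> real^'h^'d) \<Rightarrow> (real \<Rightarrow> real^'h) \<Rightarrow> real^'d \<Rightarrow> nat \<Rightarrow> nat \<Rightarrow> real^'d" where
  "euler_pts f x y0 n 0 = y0"
| "euler_pts f x y0 n (Suc k) = euler_pts f x y0 n k +
     f (euler_pts f x y0 n k) *v (x (real (Suc k) / 2 ^ n) - x (real k / 2 ^ n))"

definition euler :: "(real^'d \<Rightarrow> real^'h^'d) \<Rightarrow> (real \<Rightarrow> real^'h) \<Rightarrow> real^'d \<Rightarrow> nat \<Rightarrow> real \<Rightarrow> real^'d" where
  "euler f x y0 n t = euler_pts f x y0 n (nat \<lfloor>t * 2 ^ n\<rfloor>)"

definition Kc :: "real \<Rightarrow> real" where
  "Kc s = 1 + (\<Sum>n. 1 / real (Suc n) powr s)"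

text \<open>Upsilon_k with Upsilon_0 = 0 (then Upsilon_1 = Gamma_1/(4 zeta), Gamma_1 = 2 G2*).\<close>
primrec Ups :: "real \<Rightarrow> real \<Rightarrow> real \<Rightarrow> nat \<Rightarrow> real" where
  "Ups G2s ups zeta 0 = 0"
| "Ups G2s ups zeta (Suc k) = (2 * (G2s + ups * Ups G2s ups zeta k)) / (4 * zeta) + Ups G2s ups zeta k"

end

theory Submission
  imports Defs
begin

text \<open>Removing the points of a partition one at a time gives the discrete Young estimate with constant
  \<open>zeta (2 * \<alpha>) = K - 1\<close>. The exact solution and the Euler scheme on its grid satisfy the same estimate
  for their increments, so on blocks of length \<open>l\<close> both have Hoelder constant
  \<open>\<phi>0 / (1 - (K - 1) * a * l powr \<alpha>)\<close> with \<open>\<phi>0 = h |f| C\<close> and \<open>a = d h C |\<nabla>f|\<close>. Applied to the error, the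
  estimate bounds it on a block by its value at the left end and the local errors.

  The constant \<open>\<upsilon>\<close> has no factor \<open>h\<close> in front of its gradient term, so the recursion for \<open>\<Upsilon>\<close> does not
  follow the one for the error term by term. Write \<open>q\<close> for the second derivative part of \<open>\<zeta> / K\<close>, so
  that \<open>\<zeta> = K * (a + q)\<close> and \<open>\<upsilon> \<ge> K * q\<close>. If \<open>a \<le> 2/3 * K * q\<close>, then \<open>K * q\<close> alone accounts for the
  growth of the error, on \<open>2 ^ j\<close> blocks with \<open>2 ^ j \<le> M < 2 ^ (j + 1)\<close>, where \<open>M\<close> is the number of
  steps in \<open>\<Upsilon>\<close>. Otherwise Landau's inequality \<open>|\<nabla>f|^2 \<le> 2 |f| |\<nabla>^2 f|\<close> forces \<open>K * a < 1\<close>. Then the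
  supremum of the error over the whole interval can be absorbed using eight blocks, which gives the bound
  \<open>2 G2* \<Delta> powr (2 * \<alpha> - 1)\<close>, and \<open>\<Upsilon> \<ge> 2 G2*\<close>.\<close>

subsection \<open>The discrete Young estimate\<close>

text \<open>The slack in the constants has three sources. Local errors carry the factor
  \<open>z2 = K - 1\<close> where \<open>G2s\<close> carries \<open>K\<close>; hence the weight
  \<open>z2 / K\<close>. On a block the Hoelder constant is \<open>\<phi>0 / D\<close>, whereas
  \<open>G1s \<ge> 2 * \<phi>0\<close>; hence the gain \<open>1 / (2 * D)\<close>. Finally
  \<open>G1s + G1 \<ge> 3 * \<phi>0\<close>, so the second derivative term \<open>Q\<close> met on a
  block is at most \<open>q / 3\<close>. Blocks must be unions of grid intervals, so their number is
  a power of two and can fall short of \<open>M\<close> by a factor below 2. The threshold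
  \<open>2/3\<close> is the largest ratio of \<open>a\<close> to \<open>K * q\<close> for which the
  estimate of the growth factor survives this loss. In the opposite case
  \<open>Q \<le> q / 3\<close> gives \<open>2 * K * Q \<le> a\<close>, which is what Landau's
  inequality, in the form \<open>a^2 \<le> 2 * Q\<close>, needs in order to yield
  \<open>K * a \<le> 1\<close>.\<close>

lemma exists_small_product:
  fixes x y :: "'a \<Rightarrow> real"
  assumes I: "finite I" "I \<noteq> {}" and pos: "\<beta> > 0" "\<gamma> > 0"
    and x: "\<And>i. i \<in> I \<Longrightarrow> x i \<ge> 0" and y: "\<And>i. i \<in> I \<Longrightarrow> y i \<ge> 0"
    and A: "(\<Sum>i\<in>I. x i powr (1/\<beta>)) \<le> A" and B: "(\<Sum>i\<in>I. y i powr (1/\<gamma>)) \<le> B"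
  shows "\<exists>i\<in>I. x i * y i \<le> A powr \<beta> * B powr \<gamma> * (1 / card I powr (\<beta> + \<gamma>))"
proof (cases "\<exists>i\<in>I. x i = 0 \<or> y i = 0")
  case True
  then obtain i where "i \<in> I" "x i * y i = 0" by auto
  then show ?thesis by (intro bexI[of _ i]) auto
next
  case False
  then have xp: "x i > 0" and yp: "y i > 0" if "i \<in> I" for i
    using x y that by (auto simp: less_le)
  have "0 < (\<Sum>i\<in>I. x i powr (1/\<beta>))" "0 < (\<Sum>i\<in>I. y i powr (1/\<gamma>))"
    using xp yp I by (auto intro!: sum_pos simp: less_imp_neq[symmetric])
  then have AB: "A > 0" "B > 0" using A B by linarith+
  define X where "X i = x i powr (1/\<beta>) / A" for i
  define Y where "Y i = y i powr (1/\<gamma>) / B" for i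
  define \<theta> where "\<theta> = \<beta> + \<gamma>"
  have \<theta>: "\<theta> > 0" using pos by (simp add: \<theta>_def)
  have XY: "X i > 0" "Y i > 0" if "i \<in> I" for i
    using AB xp[OF that] yp[OF that] unfolding X_def Y_def by auto
  have n: "card I > 0" using I by (simp add: card_gt_0_iff)
  have "(\<Sum>i\<in>I. \<beta>/\<theta> * X i + \<gamma>/\<theta> * Y i) = \<beta>/\<theta> * (\<Sum>i\<in>I. X i) + \<gamma>/\<theta> * (\<Sum>i\<in>I. Y i)"
    by (simp add: sum.distrib sum_distrib_left)
  also have "\<dots> \<le> \<beta>/\<theta> * 1 + \<gamma>/\<theta> * 1"
    using A B AB pos \<theta>
    by (intro add_mono mult_left_mono) (auto simp: X_def Y_def sum_divide_distrib[symmetric])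
  also have "\<dots> = 1" using \<theta> by (simp add: \<theta>_def add_divide_distrib[symmetric])
  finally have le1: "(\<Sum>i\<in>I. \<beta>/\<theta> * X i + \<gamma>/\<theta> * Y i) \<le> 1" .
  have "\<exists>i\<in>I. \<beta>/\<theta> * X i + \<gamma>/\<theta> * Y i \<le> 1 / card I"
  proof (rule ccontr)
    assume "\<not> ?thesis"
    then have "(\<Sum>i\<in>I. 1 / card I) < (\<Sum>i\<in>I. \<beta>/\<theta> * X i + \<gamma>/\<theta> * Y i)"
      using I by (intro sum_strict_mono) (auto simp: not_le)
    then show False using le1 n by simp
  qed
  then obtain i where i: "i \<in> I" "\<beta>/\<theta> * X i + \<gamma>/\<theta> * Y i \<le> 1 / card I" by blast
  \<comment> \<open>Weighted arithmetic-geometric mean. The weighted sums add up to at most 1 over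
    \<open>I\<close>, so the chosen index is not above their mean; raising to the power
    \<open>\<theta>\<close> turns the weights into \<open>\<beta>\<close> and
    \<open>\<gamma>\<close>.\<close>
  have "X i powr (\<beta>/\<theta>) * Y i powr (\<gamma>/\<theta>) \<le> \<beta>/\<theta> * X i + \<gamma>/\<theta> * Y i"
    using XY[OF i(1)] pos \<theta>
    by (intro Youngs_inequality_0) (auto simp: \<theta>_def add_divide_distrib[symmetric])
  with i have "X i powr (\<beta>/\<theta>) * Y i powr (\<gamma>/\<theta>) \<le> 1 / card I" by linarith
  then have "(X i powr (\<beta>/\<theta>) * Y i powr (\<gamma>/\<theta>)) powr \<theta> \<le> (1 / card I) powr \<theta>"
    using \<theta> by (intro powr_mono2) auto
  then have "X i powr \<beta> * Y i powr \<gamma> \<le> 1 / card I powr \<theta>"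
    using \<theta> by (simp add: powr_mult powr_powr powr_divide)
  moreover have "X i powr \<beta> = x i / A powr \<beta>" "Y i powr \<gamma> = y i / B powr \<gamma>"
    using AB xp[OF i(1)] yp[OF i(1)] pos by (simp_all add: X_def Y_def powr_divide powr_powr)
  ultimately have "x i * y i / (A powr \<beta> * B powr \<gamma>) \<le> 1 / card I powr \<theta>" by simp
  then have "x i * y i \<le> A powr \<beta> * B powr \<gamma> * (1 / card I powr \<theta>)"
    using AB by (simp add: pos_divide_le_eq mult.commute)
  then show ?thesis using i(1) unfolding \<theta>_def by blast
qed

section \<open>Removing a point from a partition\<close>

lemma is_partition_mono:
  assumes "is_partition p m a b" "i \<le> j" "j \<le> m"
  shows "p i \<le> p j"
  using assms(2,3)
proof (induction j rule: dec_induct)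
  case (step j)
  then have "p j < p (Suc j)" using assms(1) by (auto simp: is_partition_def)
  then show ?case using step by auto
qed simp

lemma is_partition_range:
  assumes "is_partition p m a b" "i \<le> m"
  shows "a \<le> p i" "p i \<le> b"
  using is_partition_mono[OF assms(1), of 0 i] is_partition_mono[OF assms(1), of i m] assms
  by (auto simp: is_partition_def)

definition skip :: "nat \<Rightarrow> (nat \<Rightarrow> 'a) \<Rightarrow> nat \<Rightarrow> 'a" where
  "skip i p j = (if j < i then p j else p (Suc j))"

lemma is_partition_skip:
  assumes "is_partition p (Suc m) a b" "1 \<le> i" "i \<le> m"
  shows "is_partition (skip i p) m a b"
proof -
  have "p i < p (Suc i)" "\<And>k. k < Suc m \<Longrightarrow> p k < p (Suc k)"
    using assms by (auto simp: is_partition_def)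
  then have "skip i p k < skip i p (Suc k)" if "k < m" for k
    using that by (auto simp: skip_def) (metis Suc_lessI Suc_mono less_SucI order_less_trans)
  then show ?thesis using assms by (auto simp: is_partition_def skip_def)
qed

lemma sum_skip:
  fixes g :: "'b \<Rightarrow> 'b \<Rightarrow> 'c::ab_group_add"
  assumes "1 \<le> i" "i \<le> m"
  shows "(\<Sum>j<Suc m. g (p j) (p (Suc j))) = (\<Sum>j<m. g (skip i p j) (skip i p (Suc j)))
     + g (p (i-1)) (p i) + g (p i) (p (Suc i)) - g (p (i-1)) (p (Suc i))"
  using assms(2)
proof (induction m rule: dec_induct)
  case base
  obtain i' where i': "i = Suc i'" using assms(1) by (cases i) auto
  have "(\<Sum>j<i'. g (skip i p j) (skip i p (Suc j))) = (\<Sum>j<i'. g (p j) (p (Suc j)))"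
    by (intro sum.cong) (auto simp: skip_def i')
  then show ?case by (simp add: i' skip_def)
next
  case (step m)
  then show ?case by (simp add: skip_def algebra_simps)
qed

definition riemann_sum :: "(real \<Rightarrow> real) \<Rightarrow> (real \<Rightarrow> real) \<Rightarrow> (nat \<Rightarrow> real) \<Rightarrow> nat \<Rightarrow> real" where
  "riemann_sum v u p m = (\<Sum>i<m. v (p i) * (u (p (Suc i)) - u (p i)))"

text \<open>Deleting the interior point \<open>p i\<close> changes the sum by the increment of
  \<open>v\<close> before it times the increment of \<open>u\<close> after it.
  \<open>exists_small_product\<close> finds a point where this product is small, and after all
  deletions \<open>v a * (u b - u a)\<close> remains. The set \<open>T\<close> confines the
  partition points; deletion respects it, so the estimate also serves functions controlled only on a
  grid.\<close>

lemma riemann_sum_le_partial_zeta: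
  fixes v u :: "real \<Rightarrow> real"
  assumes pos: "\<beta> > 0" "\<gamma> > 0"
    and A: "\<And>p m. is_partition p m a b \<Longrightarrow> p ` {..m} \<subseteq> T \<Longrightarrow>
        (\<Sum>i<m. \<bar>v (p (Suc i)) - v (p i)\<bar> powr (1/\<beta>)) \<le> A"
    and B: "\<And>p m. is_partition p m a b \<Longrightarrow> p ` {..m} \<subseteq> T \<Longrightarrow>
        (\<Sum>i<m. \<bar>u (p (Suc i)) - u (p i)\<bar> powr (1/\<gamma>)) \<le> B"
    and p: "is_partition p (Suc m) a b" "p ` {..Suc m} \<subseteq> T"
  shows "\<bar>riemann_sum v u p (Suc m) - v a * (u b - u a)\<bar>
     \<le> A powr \<beta> * B powr \<gamma> * (\<Sum>j<m. 1 / real (Suc j) powr (\<beta> + \<gamma>))"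
  using p
proof (induction m arbitrary: p)
  case 0
  then show ?case by (simp add: riemann_sum_def is_partition_def)
next
  case (Suc m)
  let ?x = "\<lambda>i. \<bar>v (p i) - v (p (i-1))\<bar>" and ?y = "\<lambda>i. \<bar>u (p (Suc i)) - u (p i)\<bar>"
  have "(\<Sum>i\<in>{1..Suc m}. ?x i powr (1/\<beta>)) = (\<Sum>i<Suc m. \<bar>v (p (Suc i)) - v (p i)\<bar> powr (1/\<beta>))"
    by (rule sum.reindex_bij_witness[of _ Suc "\<lambda>i. i - 1"]) auto
  also have "\<dots> \<le> (\<Sum>i<Suc (Suc m). \<bar>v (p (Suc i)) - v (p i)\<bar> powr (1/\<beta>))"
    by (intro sum_mono2) auto
  also have "\<dots> \<le> A" by (rule A[OF Suc.prems])
  finally have xA: "(\<Sum>i\<in>{1..Suc m}. ?x i powr (1/\<beta>)) \<le> A" .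
  have "(\<Sum>i\<in>{1..Suc m}. ?y i powr (1/\<gamma>)) \<le> (\<Sum>i<Suc (Suc m). ?y i powr (1/\<gamma>))"
    by (intro sum_mono2) auto
  also have "\<dots> \<le> B" by (rule B[OF Suc.prems])
  finally have yB: "(\<Sum>i\<in>{1..Suc m}. ?y i powr (1/\<gamma>)) \<le> B" .
  obtain i where i: "i \<in> {1..Suc m}"
    and xy: "?x i * ?y i \<le> A powr \<beta> * B powr \<gamma> * (1 / card {1..Suc m} powr (\<beta> + \<gamma>))"
    using exists_small_product[OF _ _ pos _ _ xA yB] by auto
  let ?q = "skip i p"
  have q: "is_partition ?q (Suc m) a b" using is_partition_skip[OF Suc.prems(1)] i by auto
  have qT: "?q ` {..Suc m} \<subseteq> T" using Suc.prems(2) by (auto simp: skip_def)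
  have "riemann_sum v u p (Suc (Suc m)) = riemann_sum v u ?q (Suc m) + (v (p i) - v (p (i-1))) * (u (p (Suc i)) - u (p i))"
    using sum_skip[of i "Suc m" "\<lambda>s t. v s * (u t - u s)" p] i
    by (simp add: riemann_sum_def algebra_simps)
  then have "\<bar>riemann_sum v u p (Suc (Suc m)) - v a * (u b - u a)\<bar>
     \<le> \<bar>riemann_sum v u ?q (Suc m) - v a * (u b - u a)\<bar> + ?x i * ?y i"
    by (simp add: abs_mult[symmetric])
  also have "\<dots> \<le> A powr \<beta> * B powr \<gamma> * (\<Sum>j<m. 1 / real (Suc j) powr (\<beta> + \<gamma>))
      + A powr \<beta> * B powr \<gamma> * (1 / card {1..Suc m} powr (\<beta> + \<gamma>))"
    by (intro add_mono Suc.IH[OF q qT] xy)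
  finally show ?case by (simp add: distrib_left)
qed

section \<open>The series of \<open>n powr (-s)\<close>\<close>

definition zeta_sum :: "real \<Rightarrow> real" where
  "zeta_sum s = (\<Sum>n. 1 / real (Suc n) powr s)"

lemma zeta_sum_summable:
  assumes "s > 1" shows "summable (\<lambda>n. 1 / real (Suc n) powr s)"
proof -
  have "summable (\<lambda>n. real (Suc n) powr (-s))"
    using assms summable_real_powr_iff[of "-s"] by (subst summable_Suc_iff) auto
  then show ?thesis by (simp add: powr_minus_divide)
qed

lemma Kc_eq: "Kc s = 1 + zeta_sum s" by (simp add: Kc_def zeta_sum_def)

lemma partial_zeta_sum_le:
  assumes "s > 1" shows "(\<Sum>j<m. 1 / real (Suc j) powr s) \<le> zeta_sum s"
  unfolding zeta_sum_def by (intro sum_le_suminf zeta_sum_summable assms) auto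

lemma zeta_sum_ge_1: "s > 1 \<Longrightarrow> zeta_sum s \<ge> 1"
  using partial_zeta_sum_le[of s 1] by simp

text \<open>Comparison with the integral of \<open>z powr (-s)\<close>: by the mean value theorem
  each term, times \<open>s - 1\<close>, dominates a difference of the telescoping sequence
  \<open>n powr (1 - s)\<close>. For \<open>s = 2 * \<alpha>\<close> it makes \<open>K\<close> large
  when \<open>\<alpha>\<close> is close to 1/2, on which the gradient dominant case depends.\<close>

lemma zeta_sum_lower:
  assumes s: "s > 1" shows "zeta_sum s \<ge> 1 / (s - 1)"
proof -
  have step: "real (Suc n) powr (1-s) - real (Suc (Suc n)) powr (1-s) \<le> (s-1) * (1 / real (Suc n) powr s)" for n
  proof -
    have "\<exists>z. real (Suc n) < z \<and> z < real (Suc (Suc n)) \<and>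
       real (Suc (Suc n)) powr (1-s) - real (Suc n) powr (1-s) = (real (Suc (Suc n)) - real (Suc n)) * ((1-s) * z powr (1-s-1))"
      by (intro MVT2) (auto intro!: derivative_eq_intros has_real_derivative_powr)
    then obtain z where z: "real (Suc n) < z" and
      eq: "real (Suc (Suc n)) powr (1-s) - real (Suc n) powr (1-s) = (1-s) * z powr (-s)"
      by auto
    have "z powr (-s) \<le> real (Suc n) powr (-s)" using z s by (intro powr_mono2') auto
    then have "(s-1) * z powr (-s) \<le> (s-1) * (1 / real (Suc n) powr s)"
      using s by (intro mult_left_mono) (auto simp: powr_minus_divide)
    then show ?thesis using eq by (simp add: algebra_simps)
  qed
  have lim: "(\<lambda>n. real (Suc n) powr (1-s)) \<longlonglongrightarrow> 0"
    using s by (intro tendsto_neg_powr filterlim_compose[OF filterlim_real_sequentially filterlim_Suc]) auto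
  have "(\<lambda>n. real (Suc n) powr (1-s) - real (Suc (Suc n)) powr (1-s)) sums (real (Suc 0) powr (1-s) - 0)"
    using telescope_sums'[OF lim] by simp
  then have sm: "summable (\<lambda>n. real (Suc n) powr (1-s) - real (Suc (Suc n)) powr (1-s))"
    and "(\<Sum>n. real (Suc n) powr (1-s) - real (Suc (Suc n)) powr (1-s)) = 1"
    by (auto simp: sums_iff)
  then have "1 \<le> (\<Sum>n. (s-1) * (1 / real (Suc n) powr s))"
    using suminf_le[OF step sm summable_mult[OF zeta_sum_summable[OF s]]] by linarith
  also have "\<dots> = (s-1) * zeta_sum s"
    unfolding zeta_sum_def by (rule suminf_mult[OF zeta_sum_summable[OF s]])
  finally show ?thesis using s by (simp add: field_simps)
qed

lemma sum_increments: 
  fixes p :: "nat \<Rightarrow> 'a::ab_group_add" shows "(\<Sum>i<m. p (Suc i) - p i) = p m - p 0"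
  by (rule sum_lessThan_telescope)

lemma young_estimate:
  fixes v u :: "real \<Rightarrow> real"
  assumes pos: "\<beta> > 0" "\<gamma> > 0" "\<beta> + \<gamma> > 1"
    and A: "\<And>p m. is_partition p m a b \<Longrightarrow> p ` {..m} \<subseteq> T \<Longrightarrow>
        (\<Sum>i<m. \<bar>v (p (Suc i)) - v (p i)\<bar> powr (1/\<beta>)) \<le> A"
    and B: "\<And>p m. is_partition p m a b \<Longrightarrow> p ` {..m} \<subseteq> T \<Longrightarrow>
        (\<Sum>i<m. \<bar>u (p (Suc i)) - u (p i)\<bar> powr (1/\<gamma>)) \<le> B"
    and p: "is_partition p m a b" "p ` {..m} \<subseteq> T"
  shows "\<bar>riemann_sum v u p m - v a * (u b - u a)\<bar> \<le> A powr \<beta> * B powr \<gamma> * zeta_sum (\<beta> + \<gamma>)"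
proof (cases m)
  case 0
  then have "a = b" using p by (simp add: is_partition_def)
  then show ?thesis using zeta_sum_ge_1[OF pos(3)] 0 by (simp add: riemann_sum_def)
next
  case (Suc k)
  have "\<bar>riemann_sum v u p m - v a * (u b - u a)\<bar>
     \<le> A powr \<beta> * B powr \<gamma> * (\<Sum>j<k. 1 / real (Suc j) powr (\<beta> + \<gamma>))"
    unfolding Suc using p Suc by (intro riemann_sum_le_partial_zeta pos A B) auto
  also have "\<dots> \<le> A powr \<beta> * B powr \<gamma> * zeta_sum (\<beta> + \<gamma>)"
    by (intro mult_left_mono partial_zeta_sum_le pos) auto
  finally show ?thesis .
qed

lemma holder_imp_variation:
  fixes v :: "real \<Rightarrow> real"
  assumes "\<alpha> > 0" "c \<ge> 0"
    and v: "\<And>s t. s \<in> T \<Longrightarrow> t \<in> T \<Longrightarrow> a \<le> s \<Longrightarrow> s \<le> t \<Longrightarrow> t \<le> b \<Longrightarrow> \<bar>v t - v s\<bar> \<le> c * (t - s) powr \<alpha>"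
    and p: "is_partition p m a b" "p ` {..m} \<subseteq> T"
  shows "(\<Sum>i<m. \<bar>v (p (Suc i)) - v (p i)\<bar> powr (1/\<alpha>)) \<le> c powr (1/\<alpha>) * (b - a)"
proof -
  have "\<bar>v (p (Suc i)) - v (p i)\<bar> powr (1/\<alpha>) \<le> c powr (1/\<alpha>) * (p (Suc i) - p i)" if i: "i < m" for i
  proof -
    have lt: "p i < p (Suc i)" using p i by (auto simp: is_partition_def)
    have "\<bar>v (p (Suc i)) - v (p i)\<bar> \<le> c * (p (Suc i) - p i) powr \<alpha>"
      using is_partition_range[OF p(1), of i] is_partition_range[OF p(1), of "Suc i"] p(2) i lt
      by (intro v) auto
    then have "\<bar>v (p (Suc i)) - v (p i)\<bar> powr (1/\<alpha>) \<le> (c * (p (Suc i) - p i) powr \<alpha>) powr (1/\<alpha>)"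
      using assms by (intro powr_mono2) auto
    also have "\<dots> = c powr (1/\<alpha>) * (p (Suc i) - p i)"
      using assms lt by (simp add: powr_mult powr_powr)
    finally show ?thesis .
  qed
  then have "(\<Sum>i<m. \<bar>v (p (Suc i)) - v (p i)\<bar> powr (1/\<alpha>)) \<le> (\<Sum>i<m. c powr (1/\<alpha>) * (p (Suc i) - p i))"
    by (intro sum_mono) auto
  also have "\<dots> = c powr (1/\<alpha>) * (b - a)"
    using p(1) by (simp add: sum_distrib_left[symmetric] sum_increments is_partition_def)
  finally show ?thesis .
qed

lemma young_holder:
  fixes v u :: "real \<Rightarrow> real"
  assumes al: "\<alpha> > 1/2" and c: "c \<ge> 0" "d \<ge> 0" and ab: "a \<le> b"
    and v: "\<And>s t. s \<in> T \<Longrightarrow> t \<in> T \<Longrightarrow> a \<le> s \<Longrightarrow> s \<le> t \<Longrightarrow> t \<le> b \<Longrightarrow> \<bar>v t - v s\<bar> \<le> c * (t - s) powr \<alpha>"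
    and u: "\<And>s t. s \<in> T \<Longrightarrow> t \<in> T \<Longrightarrow> a \<le> s \<Longrightarrow> s \<le> t \<Longrightarrow> t \<le> b \<Longrightarrow> \<bar>u t - u s\<bar> \<le> d * (t - s) powr \<alpha>"
    and p: "is_partition p m a b" "p ` {..m} \<subseteq> T"
  shows "\<bar>riemann_sum v u p m - v a * (u b - u a)\<bar> \<le> zeta_sum (2*\<alpha>) * c * d * (b - a) powr (2*\<alpha>)"
proof -
  have pos: "\<alpha> > 0" "\<alpha> + \<alpha> > 1" using al by auto
  have "\<bar>riemann_sum v u p m - v a * (u b - u a)\<bar>
      \<le> (c powr (1/\<alpha>) * (b - a)) powr \<alpha> * (d powr (1/\<alpha>) * (b - a)) powr \<alpha> * zeta_sum (\<alpha> + \<alpha>)"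
  proof (rule young_estimate[OF pos(1,1,2) _ _ p], goal_cases)
    case (1 q l)
    show ?case using holder_imp_variation[of \<alpha> c T a b v q l] pos c v 1 by blast
  next
    case (2 q l)
    show ?case using holder_imp_variation[of \<alpha> d T a b u q l] pos c u 2 by blast
  qed
  also have "\<dots> = zeta_sum (2*\<alpha>) * c * d * ((b - a) powr \<alpha> * (b - a) powr \<alpha>)"
  proof -
    have "(k powr (1/\<alpha>) * (b - a)) powr \<alpha> = k * (b - a) powr \<alpha>" if "k \<ge> 0" for k
      using pos that ab by (simp add: powr_mult powr_powr)
    then show ?thesis using c by (simp only: mult_2) (simp add: mult_ac)
  qed
  also have "(b - a) powr \<alpha> * (b - a) powr \<alpha> = (b - a) powr (2*\<alpha>)"
    by (simp add: powr_add[symmetric])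
  finally show ?thesis .
qed

subsection \<open>Comparison of the constants\<close>

lemma one_plus_mult_le_powr:
  fixes x r :: real
  assumes "x \<ge> 0" "r \<ge> 1"
  shows "1 + r * x \<le> (1 + x) powr r"
proof -
  \<comment> \<open>Bernoulli's inequality for a real exponent, as a weighted mean inequality for
    \<open>1 + r * x\<close> and 1 with weights \<open>1/r\<close> and
    \<open>1 - 1/r\<close>.\<close>
  have "(1 + r * x) powr (1/r) * 1 powr (1 - 1/r) \<le> 1/r * (1 + r * x) + (1 - 1/r) * 1"
    using assms by (intro Youngs_inequality_0) (auto intro: add_pos_nonneg)
  also have "\<dots> = 1 + x" using assms by (simp add: field_simps)
  finally have "(1 + r * x) powr (1/r) \<le> 1 + x" by simp
  then have "((1 + r * x) powr (1/r)) powr r \<le> (1 + x) powr r"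
    using assms by (intro powr_mono2) auto
  then show ?thesis using assms by (simp add: powr_powr)
qed

text \<open>Compound growth: both sides are means of a geometric progression, the right one being
  \<open>((1 + \<kappa>) ^ M - 1) / (\<kappa> * M)\<close>. With the total rate
  \<open>\<kappa> * M\<close> fixed, spreading it over more steps only increases the mean, by
  Bernoulli's inequality.\<close>

lemma average_growth_mono:
  fixes \<kappa> \<kappa>' :: real
  assumes m: "1 \<le> m" "m \<le> M" and k: "0 \<le> \<kappa>'" "\<kappa>' * m \<le> \<kappa> * M"
  shows "(\<Sum>i<m. (1 + \<kappa>') ^ i) / m \<le> (\<Sum>i<M. (1 + \<kappa>) ^ i) / M"
proof -
  have mM: "real m > 0" "real M > 0" using m by auto
  then have k0: "\<kappa> \<ge> 0" using k
    by (meson mult_nonneg_nonneg of_nat_0_le_iff order_trans zero_le_mult_iff not_less)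
  \<comment> \<open>The rate whose total over \<open>m\<close> steps equals that of
    \<open>\<kappa>\<close> over \<open>M\<close> steps.\<close>
  define T where "T = \<kappa> * M / m"
  have T: "\<kappa>' \<le> T" "T \<ge> 0" using k mM k0 by (auto simp: T_def pos_le_divide_eq)
  show ?thesis
  proof (cases "\<kappa> = 0")
    case True
    then have "\<kappa>' = 0" using T k by (simp add: T_def)
    then show ?thesis using True mM by simp
  next
    case False
    then have pos: "\<kappa> > 0" "T > 0" using k0 mM by (auto simp: T_def)
    have "1 + T = 1 + M / m * \<kappa>" by (simp add: T_def)
    also have "\<dots> \<le> (1 + \<kappa>) powr (M / m)" using m mM k0 by (intro one_plus_mult_le_powr) auto
    finally have "(1 + T) ^ m \<le> ((1 + \<kappa>) powr (M / m)) ^ m" using T by (intro power_mono) auto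
    also have "\<dots> = (1 + \<kappa>) ^ M"
      using mM k0 by (simp add: powr_realpow[symmetric] powr_powr)
    finally have le: "(1 + T) ^ m \<le> (1 + \<kappa>) ^ M" .
    have "(\<Sum>i<m. (1 + \<kappa>') ^ i) / m \<le> (\<Sum>i<m. (1 + T) ^ i) / m"
      using T k by (intro divide_right_mono sum_mono power_mono) auto
    also have "\<dots> = ((1 + T) ^ m - 1) / (\<kappa> * M)"
      using geometric_sum[of "1 + T" m] pos mM by (simp add: T_def)
    also have "\<dots> \<le> ((1 + \<kappa>) ^ M - 1) / (\<kappa> * M)" using le pos mM by (intro divide_right_mono) auto
    also have "\<dots> = (\<Sum>i<M. (1 + \<kappa>) ^ i) / M"
      using geometric_sum[of "1 + \<kappa>" M] pos mM by simp
    finally show ?thesis .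
  qed
qed

lemma Ups_eq: "Ups G \<upsilon> z M = 2 * G / (4 * z) * (\<Sum>i<M. (1 + 2 * \<upsilon> / (4 * z)) ^ i)"
proof (induction M)
  case (Suc M)
  define k where "k = 2 * \<upsilon> / (4 * z)"
  define b where "b = 2 * G / (4 * z)"
  define s where "s = (\<Sum>i<M. (1 + k) ^ i)"
  have "Ups G \<upsilon> z (Suc M) = b + (1 + k) * Ups G \<upsilon> z M"
    by (simp add: k_def b_def add_divide_distrib algebra_simps)
  also have "Ups G \<upsilon> z M = b * s" using Suc by (simp only: k_def b_def s_def)
  also have "b + (1 + k) * (b * s) = b * (1 + (1 + k) * s)" by (simp add: algebra_simps)
  also have "1 + (1 + k) * s = (\<Sum>i<Suc M. (1 + k) ^ i)"
    by (simp add: s_def sum.lessThan_Suc_shift sum_distrib_left del: sum.lessThan_Suc)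
  finally show ?case unfolding k_def b_def .
qed simp

lemma linear_recursion_bound:
  fixes e :: "nat \<Rightarrow> real"
  assumes "e 0 \<le> 0" "\<kappa> \<ge> 0" and step: "\<And>r. r < m \<Longrightarrow> e (Suc r) \<le> (1 + \<kappa>) * e r + b"
  shows "r \<le> m \<Longrightarrow> e r \<le> b * (\<Sum>i<r. (1 + \<kappa>) ^ i)"
proof (induction r)
  case (Suc r)
  have "e (Suc r) \<le> (1 + \<kappa>) * e r + b" using Suc by (intro step) auto
  also have "\<dots> \<le> (1 + \<kappa>) * (b * (\<Sum>i<r. (1 + \<kappa>) ^ i)) + b"
    using Suc assms by (intro add_right_mono mult_left_mono) auto
  also have "\<dots> = b * (\<Sum>i<Suc r. (1 + \<kappa>) ^ i)"
    by (simp add: sum.lessThan_Suc_shift sum_distrib_left algebra_simps del: sum.lessThan_Suc)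
  finally show ?case .
qed (use assms in simp)

text \<open>Transfers a Gronwall bound with \<open>m\<close> steps of rate \<open>\<kappa>'\<close>
  to \<open>\<Upsilon>\<close>. The choice of \<open>M\<close> gives
  \<open>4 * z \<le> M powr \<alpha> \<le> M\<close>, so the summand \<open>2 * G / (4 * z)\<close>
  of \<open>\<Upsilon>\<close> is at least \<open>2 * G / M\<close>, and the comparison of means
  does the rest. For \<open>m = 1\<close> the left side is \<open>2 * G\<close>, whatever the
  rate.\<close>

lemma Ups_ge_recursion:
  assumes z: "z > 0" and G: "G \<ge> 0" and M: "(4 * z) powr (1/\<alpha>) \<le> M" and al: "0 < \<alpha>" "\<alpha> \<le> 1"
    and m: "1 \<le> m" "m \<le> M" and k: "0 \<le> \<kappa>'" "m = 1 \<or> \<kappa>' * m \<le> 2 * \<upsilon> / (4 * z) * M"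
    and u: "\<upsilon> \<ge> 0"
  shows "2 * G / m * (\<Sum>i<m. (1 + \<kappa>') ^ i) \<le> Ups G \<upsilon> z M"
proof -
  have M1: "real M \<ge> 1" using m by auto
  have "4 * z \<le> real M powr \<alpha>"
    using powr_mono2[OF _ _ M, of \<alpha>] al z by (simp add: powr_powr)
  also have "\<dots> \<le> real M powr 1" using M1 al by (intro powr_mono) auto
  finally have Mz: "4 * z \<le> M" using M1 by simp
  define \<kappa> where "\<kappa> = 2 * \<upsilon> / (4 * z)"
  have kap: "\<kappa> \<ge> 0" using u z by (simp add: \<kappa>_def)
  have av: "(\<Sum>i<m. (1 + \<kappa>') ^ i) / m \<le> (\<Sum>i<M. (1 + \<kappa>) ^ i) / M"
  proof (cases "m = 1")
    case True
    have "(\<Sum>i<M. 1) \<le> (\<Sum>i<M. (1 + \<kappa>) ^ i)" using kap by (intro sum_mono one_le_power) auto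
    then show ?thesis using True M1 by (simp add: pos_le_divide_eq)
  qed (use k m in \<open>auto intro!: average_growth_mono simp: \<kappa>_def\<close>)
  have "2 * G / m * (\<Sum>i<m. (1 + \<kappa>') ^ i) = 2 * G * ((\<Sum>i<m. (1 + \<kappa>') ^ i) / m)" by simp
  also have "\<dots> \<le> 2 * G * ((\<Sum>i<M. (1 + \<kappa>) ^ i) / M)" using G by (intro mult_left_mono av) auto
  also have "\<dots> = 2 * G / M * (\<Sum>i<M. (1 + \<kappa>) ^ i)" by simp
  also have "\<dots> \<le> 2 * G / (4 * z) * (\<Sum>i<M. (1 + \<kappa>) ^ i)"
    using G z Mz kap M1 by (intro mult_right_mono divide_left_mono sum_nonneg) auto
  also have "\<dots> = Ups G \<upsilon> z M" unfolding Ups_eq \<kappa>_def ..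
  finally show ?thesis .
qed

text \<open>The rate on a block of length \<open>1 / m\<close> scales as
  \<open>m powr (-\<alpha>)\<close>, so its total over \<open>m\<close> blocks scales as
  \<open>m powr (1 - \<alpha>)\<close>. This increases with \<open>m\<close>, and at
  \<open>M\<close> it is at most \<open>M / (4 * z)\<close>.\<close>

lemma rate_bound:
  fixes M m :: nat
  assumes z: "z > 0" and M: "(4 * z) powr (1/\<alpha>) \<le> M" and al: "0 < \<alpha>" "\<alpha> \<le> 1"
    and m: "1 \<le> m" "m \<le> M" and b: "b \<ge> 0" "b \<le> \<upsilon>"
  shows "2 * b * real m powr (-\<alpha>) * m \<le> 2 * \<upsilon> / (4 * z) * M"
proof -
  have M1: "real M \<ge> 1" "real m \<ge> 1" using m by auto
  have Mz: "4 * z \<le> real M powr \<alpha>"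
    using powr_mono2[OF _ _ M, of \<alpha>] al z by (simp add: powr_powr)
  have "real m powr (-\<alpha>) * m = real m powr (1 - \<alpha>)"
    using M1 powr_add[of "real m" "-\<alpha>" 1] by simp
  also have "\<dots> \<le> real M powr (1 - \<alpha>)" using m al by (intro powr_mono2) auto
  also have "\<dots> = M / M powr \<alpha>" using M1 by (simp add: powr_diff)
  also have "\<dots> \<le> M / (4 * z)" using z Mz M1 by (intro divide_left_mono) auto
  finally have "2 * b * (real m powr (-\<alpha>) * m) \<le> 2 * \<upsilon> * (M / (4 * z))"
    using b by (intro mult_mono) auto
  then show ?thesis by (simp add: mult.assoc)
qed

section \<open>Inequalities for the blocks\<close>

lemma growth_condition:
  fixes s r w D u K :: real
  assumes s: "0 \<le> s" "0 \<le> r" "s + r \<le> w / 4" and w: "1 \<le> w" "w \<le> 2" and K: "K \<ge> 1"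
    and D: "D \<ge> 1 - s" and u: "0 \<le> u" "u * w \<le> 1" and sK: "s / K \<le> 2/3 * r"
  shows "s / K + r * u / (3 * D) \<le> 2 * r * (1 - s - r * u / (3 * D))"
proof -
  have sl: "1 - s \<ge> 1 - w/4 + r" using s by linarith
  have D2: "D \<ge> 1/2 + r" using s w D by linarith
  have "u \<le> 1 / w" using u w by (simp add: pos_le_divide_eq)
  moreover have "(1 + 2*r) / (3 * D) \<le> 2/3" using D2 s by (simp add: pos_divide_le_eq)
  ultimately have "u * ((1 + 2*r) / (3 * D)) \<le> (1/w) * (2/3)"
    using u D2 s by (intro mult_mono) auto
  \<comment> \<open>This is \<open>(3 * w - 2) * (w - 2) \<le> 0\<close>, with equality at
    \<open>w = 2\<close>; it fixes the ratio \<open>2/3\<close> in the last hypothesis.\<close>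
  also have "\<dots> \<le> 2 * (1 - w/4) - 2/3"
  proof -
    have "(3*w - 2) * (w - 2) \<le> 0" using w by (intro mult_nonneg_nonpos) auto
    then have "4 + 4*w \<le> w * (12 - 3*w)" by (simp add: algebra_simps)
    then show ?thesis using w by (simp add: field_simps)
  qed
  finally have *: "u * ((1 + 2*r) / (3 * D)) \<le> 2 * (1 - w/4) - 2/3" .
  have "2/3 + u * ((1 + 2*r) / (3 * D)) \<le> 2/3 + (2 * (1 - w/4) - 2/3)" using * by (rule add_left_mono)
  also have "\<dots> \<le> 2 * (1 - s)" using sl s by argo
  \<comment> \<open>The claim divided by \<open>r\<close>, with \<open>s / K\<close> replaced by its
    bound \<open>2/3 * r\<close>.\<close>
  finally have "2/3 + u * ((1 + 2*r) / (3 * D)) \<le> 2 * (1 - s)" .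
  then have "r * (2/3 + u * ((1 + 2*r) / (3 * D))) \<le> r * (2 * (1 - s))" using s by (intro mult_left_mono)
  moreover define E where "E = u / (3 * D)"
  moreover have "u * ((1 + 2*r) / (3 * D)) = (1 + 2 * r) * E" by (simp add: E_def)
  ultimately have "r * (2/3 + (1 + 2 * r) * E) \<le> r * (2 * (1 - s))" by metis
  then have "2/3 * r + r * E \<le> 2 * r * (1 - s - r * E)" by (simp add: algebra_simps)
  moreover have rE: "r * u / (3 * D) = r * E" by (simp add: E_def)
  ultimately show ?thesis using sK unfolding rE by linarith
qed

text \<open>The arithmetic behind the choice of eight blocks: with \<open>t = 2 * \<alpha> - 1\<close>, the bounds
  \<open>K \<ge> 1 + 1 / t\<close> and \<open>8 powr (t / 2) \<ge> 1 + t + t^2 / 2\<close> reduce it to a polynomial in \<open>t\<close>.\<close>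
lemma eight_blocks_polynomial:
  fixes t :: real
  assumes t: "0 \<le> t" and U: "U = 3536 / 10000" and g: "g = 1 + t + t\<^sup>2 / 2"
  shows "((1 + t) * g - U)\<^sup>2 - 8 * U * t * ((1 + t) * g - U / 2) - (1 + t) * g\<^sup>2 / 4 \<ge> 0"
proof -
  have "((1 + t) * g - U)\<^sup>2 - 8 * U * t * ((1 + t) * g - U / 2) - (1 + t) * g\<^sup>2 / 4
    = 16783296/100000000 - 49306816/100000000 * t - 7184/10000 * t^2 + 16532/10000 * t^3
      + 25231/10000 * t^4 + 14375/10000 * t^5 + t^6 / 4"
    unfolding U g by (simp add: power2_eq_square eval_nat_numeral field_simps)
  \<comment> \<open>On \<open>t \<ge> 0\<close> the polynomial has its minimum near
    \<open>t = 33/100\<close>; higher powers are traded for lower ones through squares that vanish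
    at or near that point.\<close>
  moreover have "t^3 \<ge> 66/100 * t^2 - 1089/10000 * t"
  proof -
    have "0 \<le> t * (t - 33/100)\<^sup>2" using t by simp
    then show ?thesis by (simp add: eval_nat_numeral algebra_simps)
  qed
  moreover have t4: "t^4 \<ge> 2178/10000 * t^2 - 1185921/100000000"
  proof -
    have "0 \<le> (t\<^sup>2 - 1089/10000)\<^sup>2" by simp
    then show ?thesis by (simp add: eval_nat_numeral algebra_simps)
  qed
  moreover have "t^5 \<ge> 2178/10000 * t^3 - 1185921/100000000 * t"
    using mult_left_mono[OF t4 t] by (simp add: eval_nat_numeral algebra_simps)
  moreover have "t^2 \<ge> 65/100 * t - 4225/40000"
  proof -
    have "0 \<le> (t - 65/200)\<^sup>2" by simp
    then show ?thesis by (simp add: eval_nat_numeral algebra_simps)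
  qed
  moreover have "t^6 \<ge> 0" by simp
  ultimately show ?thesis using t by linarith
qed

text \<open>If \<open>S\<close> is the supremum of the error on a block entered with error
  \<open>e\<close>, then \<open>S \<le> e + (X * S + R) / D\<close>, so the error grows by the
  factor \<open>D / (D - X) = 1 + X / (D - X)\<close>. The last claim compares this rate with the
  one available in \<open>\<Upsilon>\<close>. In the proof, \<open>s\<close> and \<open>r\<close>
  are the gradient and curvature parts of \<open>K * (a + q) * u\<close>, and \<open>w\<close>
  measures how far \<open>m\<close> falls short of \<open>M\<close>.\<close>

lemma curvature_dominant_block:
  fixes M m :: nat
  assumes al: "0 < \<alpha>" "\<alpha> \<le> 1" and a: "a > 0" and Q: "Q \<ge> 0" "q \<ge> 3 * Q" and z2: "z2 \<ge> 0" "K = 1 + z2"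
    and M: "(4 * (K * (a + q))) powr (1/\<alpha>) \<le> M" and m: "1 \<le> m" "m \<le> M" "M < 2 * m"
    and u: "u = real m powr (-\<alpha>)" and D: "D = 1 - z2 * a * u" and X: "X = u * (a + z2 * (Q / D) * u)"
  shows "D \<ge> 1/2" "D - X \<ge> 1/2" "0 \<le> X" "a \<le> 2/3 * (K * q) \<Longrightarrow> X / (D - X) \<le> 2 * (K * q) * u"
proof -
  define w where "w = (real M / m) powr \<alpha>"
  define s where "s = K * a * u"
  define r where "r = K * q * u"
  have m0: "real m > 0" "real M > 0" using m by auto
  have K: "K \<ge> 1" using z2 by simp
  have u01: "u > 0" "u \<le> 1" using m m0 al by (auto simp: u powr_minus_divide ge_one_powr_ge_zero)
  have q: "q \<ge> 0" using Q by linarith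
  have w1: "w \<ge> 1" using m m0 al by (auto simp: w_def intro!: ge_one_powr_ge_zero)
  have "w \<le> (real M / m) powr 1" unfolding w_def using m m0 al by (intro powr_mono) auto
  moreover have "real M / m \<le> 2" using m m0 by (simp add: pos_divide_le_eq)
  ultimately have w2: "w \<le> 2" using m0 by simp
  \<comment> \<open>From \<open>M < 2 * m\<close>: either \<open>m = 1\<close> and then
    \<open>M = 1\<close>, or \<open>2 * m \<le> m * m\<close>. It yields
    \<open>u * w \<le> 1\<close>, so that \<open>u\<close> is small whenever the shortfall
    \<open>w\<close> is large.\<close>
  have "M \<le> m * m" using m by (cases "m = 1") (auto intro: order_trans[of _ "2 * m"])
  then have Mm: "real M \<le> real m * real m" by (metis of_nat_le_iff of_nat_mult)
  have "u * w = (real M / (real m * real m)) powr \<alpha>"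
    unfolding u w_def using m0 by (simp add: powr_divide powr_mult powr_minus_divide)
  also have "\<dots> \<le> 1 powr \<alpha>" using Mm m0 al by (intro powr_mono2) auto
  finally have uw: "u * w \<le> 1" by simp
  have "4 * (K * (a + q)) \<le> real M powr \<alpha>"
    using powr_mono2[OF _ _ M, of \<alpha>] al K a q by (simp add: powr_powr)
  then have "4 * (K * (a + q)) * u \<le> real M powr \<alpha> * u" using u01 by (intro mult_right_mono) auto
  also have "\<dots> = w" unfolding u w_def using m0 by (simp add: powr_divide powr_minus_divide)
  finally have sr: "s + r \<le> w / 4" by (simp add: s_def r_def algebra_simps)
  have s0: "s \<ge> 0" "r \<ge> 0" using K a q u01 by (auto simp: s_def r_def)
  have aus: "a * u = s / K" using K by (simp add: s_def)
  have "z2 * a * u = s - a * u" by (simp add: s_def z2 algebra_simps)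
  then have zs: "z2 * a * u = s - s / K" using aus by simp
  have sK0: "s / K \<ge> 0" using s0 K by simp
  have Ds: "D \<ge> 1 - s" unfolding D zs using sK0 by linarith
  then show D2: "D \<ge> 1/2" using s0 sr w2 by linarith
  have "z2 * Q * u \<le> K * (q / 3) * u" using z2 Q u01 by (intro mult_mono) auto
  then have zq: "z2 * Q * u \<le> r / 3" by (simp add: r_def)
  have "u * (z2 * (Q / D) * u) = (z2 * Q * u) * (u / D)" by simp
  also have "\<dots> \<le> (r / 3) * (u / D)" using zq u01 D2 by (intro mult_right_mono) auto
  finally have XX: "X \<le> s / K + r * u / (3 * D)" unfolding X distrib_left using aus by (simp add: mult.commute)
  show "0 \<le> X" using u01 a z2 Q D2 unfolding X by (intro mult_nonneg_nonneg add_nonneg_nonneg) auto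
  have DX: "D - X \<ge> 1 - s - r * u / (3 * D)" using XX zs by (simp add: D)
  have "r * u / (3 * D) \<le> r * 1 / (3 * (1/2))" using s0 u01 D2 by (intro frac_le mult_left_mono mult_nonneg_nonneg) auto
  then have "r * u / (3 * D) \<le> r" using s0 by simp
  then show DX2: "D - X \<ge> 1/2" using DX sr w2 by linarith
  assume "a \<le> 2/3 * (K * q)"
  then have "a * u \<le> 2/3 * (K * q) * u" using u01 by (intro mult_right_mono) auto
  then have "s / K \<le> 2/3 * r" by (simp add: aus r_def)
  then have "s / K + r * u / (3 * D) \<le> 2 * r * (1 - s - r * u / (3 * D))"
    using s0 sr w1 w2 K Ds uw u01 by (intro growth_condition[of _ _ w]) auto
  also have "\<dots> \<le> 2 * r * (D - X)" using DX s0 by (intro mult_left_mono) auto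
  finally have "X \<le> 2 * r * (D - X)" using XX by linarith
  then show "X / (D - X) \<le> 2 * (K * q) * u" using DX2 by (simp add: pos_divide_le_eq r_def mult.assoc)
qed

lemma eight_powr_le:
  fixes \<alpha> :: real
  assumes al: "\<alpha> \<ge> 1/2" and t: "t = 2 * \<alpha> - 1"
  shows "8 powr (-\<alpha>) \<le> (3536/10000) / (1 + t + t\<^sup>2 / 2)"
proof -
  have t0: "t \<ge> 0" using al t by simp
  \<comment> \<open>Since \<open>ln 8 \<ge> 2\<close>, \<open>8 powr (t / 2)\<close> dominates
    \<open>exp t\<close>; the remaining factor, the inverse square root of 8, is rounded up to
    \<open>3536/10000\<close>.\<close>
  have "ln (8::real) = 3 * ln 2" using ln_realpow[of 2 3] by simp
  then have "t \<le> t / 2 * ln 8" using mult_left_mono[OF ln2_ge_two_thirds t0] by simp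
  then have "exp t \<le> 8 powr (t/2)" by (simp add: powr_def)
  then have "1 + t + t\<^sup>2 / 2 \<le> 8 powr (t/2)" using exp_lower_Taylor_quadratic[OF t0] by linarith
  moreover have "1 \<le> (3536/10000) * 8 powr (1/2::real)"
  proof -
    have "10000/3536 \<le> sqrt (8::real)" by (rule real_le_rsqrt) (simp add: power2_eq_square)
    then show ?thesis by (simp add: powr_half_sqrt)
  qed
  ultimately have "1 * (1 + t + t\<^sup>2 / 2) \<le> (3536/10000) * 8 powr (1/2) * 8 powr (t/2)"
    using t0 by (intro mult_mono) auto
  also have "\<dots> = (3536/10000) * 8 powr (1/2 + t/2)" by (simp only: mult.assoc powr_add)
  also have "1/2 + t/2 = \<alpha>" by (simp add: t field_simps)
  finally show ?thesis using t0
    by (simp add: powr_minus_divide field_simps add_pos_nonneg)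
qed

text \<open>On the given ranges the left side decreases in \<open>u\<close> and in \<open>p\<close>,
  so the worst case is the corner where both upper bounds are attained. There it is the polynomial
  of \<open>eight_blocks_polynomial\<close> divided by \<open>((1 + t) * g)^2\<close>. The variable
  \<open>p\<close> stands for \<open>1 / K\<close> and \<open>u\<close> for
  \<open>8 powr (-\<alpha>)\<close>.\<close>

lemma eight_blocks_margin:
  fixes p u t :: real
  assumes t: "0 \<le> t" "t \<le> 1" and p: "0 \<le> p" "p \<le> t / (1 + t)" and u: "1/8 \<le> u"
    "u \<le> (3536/10000) / (1 + t + t\<^sup>2 / 2)"
  shows "(1 - (1 - p) * u)\<^sup>2 - 8 * u * p * (1 - (1 - p) * u / 2) - (1 - p) / 4 \<ge> 0"
proof -
  define F where "F p u = (1 - (1 - p) * u)\<^sup>2 - 8 * u * p * (1 - (1 - p) * u / 2) - (1 - p) / 4" for p u :: real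
  define g where "g = 1 + t + t\<^sup>2 / 2"
  define P where "P = t / (1 + t)"
  define V where "V = (3536/10000) / g"
  have g1: "g \<ge> 1" using t by (simp add: g_def)
  have V: "u \<le> V" "V \<le> 3536/10000" using u g1 by (auto simp: V_def g_def[symmetric] pos_divide_le_eq)
  have P: "p \<le> P" "P \<le> 1/2" using p t by (auto simp: P_def field_simps)
  have "F P V = ((1 + t)\<^sup>2 * g\<^sup>2 * F P V) / ((1 + t)\<^sup>2 * g\<^sup>2)" using g1 t by simp
  also have "(1 + t)\<^sup>2 * g\<^sup>2 * F P V = ((1 + t) * g - 3536/10000)\<^sup>2 - 8 * (3536/10000) * t * ((1 + t) * g - (3536/10000) / 2)
      - (1 + t) * g\<^sup>2 / 4"
  proof -
    have P': "1 - P = 1 / (1 + t)" using t by (simp add: P_def field_simps)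
    have PV: "(1 + t) * g * ((1 - P) * V) = 3536/10000"
      unfolding P' using g1 t by (simp add: V_def)
    then have "(1 + t) * g * (1 - (1 - P) * V) = (1 + t) * g - 3536/10000"
      by (simp add: right_diff_distrib)
    then have 1: "(1 + t)\<^sup>2 * g\<^sup>2 * (1 - (1 - P) * V)\<^sup>2 = ((1 + t) * g - 3536/10000)\<^sup>2"
      by (metis power_mult_distrib)
    have "(1 + t) * g * (1 - (1 - P) * V / 2) = (1 + t) * g - ((1 + t) * g * ((1 - P) * V)) / 2"
      by (simp add: right_diff_distrib)
    then have 2: "(1 + t) * g * (1 - (1 - P) * V / 2) = (1 + t) * g - (3536/10000) / 2"
      unfolding PV .
    have 3: "(1 + t) * g * (8 * V * P) = 8 * (3536/10000) * t"
      using g1 t by (simp add: V_def P_def)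
    have 4: "(1 + t)\<^sup>2 * g\<^sup>2 * ((1 - P) / 4) = (1 + t) * g\<^sup>2 / 4"
    proof -
      have "(1 + t) * (1 - P) = 1" unfolding P' using t by simp
      moreover have "(1 + t)\<^sup>2 * g\<^sup>2 * ((1 - P) / 4) = ((1 + t) * (1 - P)) * ((1 + t) * g\<^sup>2 / 4)"
        by (simp add: power2_eq_square)
      ultimately show ?thesis by simp
    qed
    have "(1 + t)\<^sup>2 * g\<^sup>2 * F P V = (1 + t)\<^sup>2 * g\<^sup>2 * (1 - (1 - P) * V)\<^sup>2
       - ((1 + t) * g * (8 * V * P)) * ((1 + t) * g * (1 - (1 - P) * V / 2)) - (1 + t)\<^sup>2 * g\<^sup>2 * ((1 - P) / 4)"
    proof -
      have "(1 + t)\<^sup>2 * g\<^sup>2 * (W1\<^sup>2 - 8 * V * P * W2 - W3) = (1 + t)\<^sup>2 * g\<^sup>2 * W1\<^sup>2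
         - ((1 + t) * g * (8 * V * P)) * ((1 + t) * g * W2) - (1 + t)\<^sup>2 * g\<^sup>2 * W3" for W1 W2 W3
        by (simp add: power2_eq_square algebra_simps)
      then show ?thesis unfolding F_def .
    qed
    then show ?thesis unfolding 1 2 3 4 .
  qed
  also have "\<dots> / ((1 + t)\<^sup>2 * g\<^sup>2) \<ge> 0"
    using eight_blocks_polynomial[OF t(1) refl g_def] by (intro divide_nonneg_nonneg) auto
  finally have FPV: "F P V \<ge> 0" .
  have u0: "u \<ge> 0" "V \<ge> 0" using u V by auto
  have "F P u - F P V = (V - u) * (2 * (1-P) + 8 * P - (1-P)\<^sup>2 * (u + V) - 4 * P * (1-P) * (u + V))"
    unfolding F_def by (simp add: power2_eq_square field_simps)
  also have "\<dots> \<ge> 0"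
  proof (intro mult_nonneg_nonneg)
    have uV: "u + V \<le> 1" using V by linarith
    have P0: "P \<ge> 0" using P p by linarith
    have "(1-P)\<^sup>2 * (u + V) \<le> (1-P)\<^sup>2 * 1" using uV by (intro mult_left_mono) auto
    moreover have "(1-P)\<^sup>2 \<le> 1 - P" using P P0 by (simp add: power2_eq_square mult_left_le)
    moreover have "4 * P * (1-P) * (u + V) \<le> 4 * P * 1 * 1" using uV P P0 u0 by (intro mult_mono) auto
    moreover define A B C where "A = (1-P)\<^sup>2 * (u + V)" and "B = 4 * P * (1-P) * (u + V)" and "C = (1-P)\<^sup>2"
    ultimately have "A \<le> C" "C \<le> 1 - P" "B \<le> 4 * P" by simp_all
    then have "2 * (1-P) + 8 * P - A - B \<ge> 0" using P0 by argo
    then show "2 * (1-P) + 8 * P - (1-P)\<^sup>2 * (u + V) - 4 * P * (1-P) * (u + V) \<ge> 0"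
      by (simp only: A_def B_def)
  qed (use V in auto)
  finally have "F P u \<ge> 0" using FPV by linarith
  have "F p u - F P u = (P - p) * (6 * u - 1/4 - 2 * u\<^sup>2 + 3 * u\<^sup>2 * (p + P))"
    unfolding F_def by (simp add: power2_eq_square field_simps)
  also have "\<dots> \<ge> 0"
  proof (intro mult_nonneg_nonneg)
    have "u\<^sup>2 \<le> u * 1" unfolding power2_eq_square using u0 V by (intro mult_left_mono) auto
    moreover have "0 \<le> 3 * u\<^sup>2 * (p + P)" using p P by simp
    ultimately show "0 \<le> 6 * u - 1/4 - 2 * u\<^sup>2 + 3 * u\<^sup>2 * (p + P)" using u by linarith
  qed (use P in auto)
  finally have "F p u \<ge> 0" using \<open>F P u \<ge> 0\<close> by linarith
  then show ?thesis unfolding F_def .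
qed

text \<open>With eight blocks the supremum \<open>S\<close> of the error satisfies
  \<open>S * (D - 8 * X) \<le> z2 / K * G * D' / (2 * D)\<close>; the second claim is what turns
  this into \<open>S \<le> 2 * G * D'\<close>. It is reduced to the case \<open>K * a = 1\<close>,
  where \<open>eight_blocks_margin\<close> applies.\<close>

lemma gradient_dominant_block:
  fixes \<alpha> :: real
  assumes al: "1/2 < \<alpha>" "\<alpha> \<le> 1" and a: "a > 0" and Q: "Q \<ge> 0" "a\<^sup>2 \<le> 2 * Q" "2 * (K * Q) \<le> a"
    and z2: "z2 \<ge> 0" "K = 1 + z2" "z2 \<ge> 1 / (2 * \<alpha> - 1)"
    and u: "u = 8 powr (-\<alpha>)" and D: "D = 1 - z2 * a * u" and X: "X = u * (a + z2 * (Q / D) * u)"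
  shows "D \<ge> 1/2" "z2 / K \<le> 4 * D * (D - 8 * X)"
proof -
  define t where "t = 2 * \<alpha> - 1"
  define p where "p = 1 / K"
  define k where "k = z2 / K"
  define z where "z = K * a"
  have t: "0 < t" "t \<le> 1" using al by (auto simp: t_def)
  have K: "K \<ge> 1" using z2 by simp
  \<comment> \<open>Landau's inequality, in the form \<open>a\<^sup>2 \<le> 2 * Q\<close>, against
    \<open>2 * (K * Q) \<le> a\<close>.\<close>
  have "K * a\<^sup>2 \<le> K * (2 * Q)" using Q K by (intro mult_left_mono) auto
  then have "(K * a) * a \<le> 1 * a" using Q by (simp add: power2_eq_square)
  then have z1: "z \<le> 1" using a by (simp add: z_def)
  have z0: "z > 0" using a K by (simp add: z_def)
  have "u \<le> (3536/10000) / (1 + t + t\<^sup>2 / 2)" unfolding u using al t_def by (intro eight_powr_le) auto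
  moreover have "8 powr (-1) \<le> u" unfolding u using al by (intro powr_mono) auto
  then have u8: "u \<ge> 1/8" by (simp add: powr_minus_divide)
  moreover have "p \<le> t / (1 + t)"
  proof -
    have "1 / t \<le> K - 1" using z2 by (simp add: t_def)
    then have "1 + t \<le> K * t" using t by (simp add: field_simps)
    then show ?thesis using t K by (simp add: p_def field_simps)
  qed
  moreover have p0: "p \<ge> 0" using K by (simp add: p_def)
  ultimately have margin: "(1 - (1 - p) * u)\<^sup>2 - 8 * u * p * (1 - (1 - p) * u / 2) - (1 - p) / 4 \<ge> 0"
    using t by (intro eight_blocks_margin) auto
  have "k + p = 1" unfolding k_def p_def add_divide_distrib[symmetric] using z2 by simp
  then have k: "k = 1 - p" by simp
  have k01: "0 \<le> k" "k \<le> 1"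
  proof -
    show "0 \<le> k" unfolding k_def using z2(1) K by (intro divide_nonneg_nonneg) auto
    show "k \<le> 1" using k p0 by simp
  qed
  have "u \<le> 8 powr (-(1/2))" unfolding u using al by (intro powr_mono) auto
  also have "\<dots> \<le> 1/2"
  proof -
    have "2 \<le> sqrt (8::real)" by (rule real_le_rsqrt) (simp add: power2_eq_square)
    then show ?thesis by (simp add: powr_minus_divide powr_half_sqrt)
  qed
  finally have u1: "u \<le> 1/2" .
  have ku: "k * u \<le> 1 * (1/2)" "0 \<le> k * u" using k01 u1 u8 by (intro mult_mono, auto)
  have za: "z2 * a = k * z" "a = z * p" using K by (auto simp: k_def z_def p_def)
  have Dk: "D = 1 - k * u * z" unfolding D za(1) by (simp add: mult_ac)
  have "k * u * z \<le> 1/2 * 1" using ku z1 z0 by (intro mult_mono) auto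
  then show D2: "D \<ge> 1/2" using Dk by linarith
  have "z2 * Q = k * (2 * (K * Q)) / 2" using K by (simp add: k_def)
  also have "\<dots> \<le> k * a / 2" using Q k01 by (intro divide_right_mono mult_left_mono) auto
  finally have zQ: "z2 * Q \<le> k * a / 2" .
  have "D * X = u * (a * D + z2 * Q * u)" using D2 unfolding X by (simp add: field_simps)
  also have "\<dots> \<le> u * (a * D + (k * a / 2) * u)" using zQ u8 by (intro mult_left_mono add_left_mono mult_right_mono) auto
  also have "\<dots> = u * z * p * (1 - k * u * z + k * u / 2)" by (simp add: Dk za(2) algebra_simps)
  finally have DX: "D * X \<le> u * z * p * (1 - k * u * z + k * u / 2)" .
  have "k / 4 \<le> (1 - k * u)\<^sup>2 - 8 * (u * p * (1 - k * u / 2))" using margin k by simp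
  \<comment> \<open>The bound decreases in \<open>z = K * a\<close>, so \<open>z = 1\<close> is the
    worst case; both differences below contain the factor \<open>1 - z\<close>.\<close>
  also have "\<dots> \<le> (1 - k * u * z)\<^sup>2 - 8 * (u * z * p * (1 - k * u * z + k * u / 2))"
  proof -
    have "(1 - k * u * z)\<^sup>2 - (1 - k * u)\<^sup>2 = k * u * (1 - z) * (2 - k * u * (1 + z))"
      by (simp add: power2_eq_square algebra_simps)
    also have "\<dots> \<ge> 0" 
    proof (intro mult_nonneg_nonneg ku)
      have "k * u * (1 + z) \<le> 1/2 * 2" using ku z1 z0 by (intro mult_mono) auto
      then show "2 - k * u * (1 + z) \<ge> 0" by simp
    qed (use z1 k01 u8 in auto)
    finally have 1: "(1 - k * u * z)\<^sup>2 \<ge> (1 - k * u)\<^sup>2" by simp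
    have "u * p * (1 - k * u / 2) - u * z * p * (1 - k * u * z + k * u / 2)
      = u * p * (1 - z) * (1 - k * u * (1/2 + z))"
      by (simp add: field_simps)
    also have "\<dots> \<ge> 0" 
    proof (intro mult_nonneg_nonneg p0)
      have "k * u * (1/2 + z) \<le> 1/2 * 2" using ku z1 z0 by (intro mult_mono) auto
      then show "1 - k * u * (1/2 + z) \<ge> 0" by simp
    qed (use z1 u8 in auto)
    finally show ?thesis using 1 by linarith
  qed
  also have "\<dots> \<le> D\<^sup>2 - 8 * (D * X)" using DX by (simp add: Dk)
  finally show "z2 / K \<le> 4 * D * (D - 8 * X)" by (simp add: k_def power2_eq_square algebra_simps)
qed

text \<open>For grids of at most four intervals. Single steps give
  \<open>S \<le> m powr (1 - \<alpha>) * a * S + z2 / K * G * D'\<close> with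
  \<open>m \<le> 4\<close>, and the claim leaves \<open>z2 / K * S / 2\<close> on the left after
  absorption. With \<open>E = 2 powr (2 * \<alpha> - 1)\<close> and \<open>p = 1 / K\<close> it
  reads \<open>2 / E * a \<le> (1 + p) / 2\<close>, where
  \<open>a \<le> p \<le> t / (1 + t)\<close>.\<close>

lemma gradient_dominant_coarse:
  fixes \<alpha> :: real
  assumes al: "1/2 < \<alpha>" "\<alpha> \<le> 1" and a: "K * a \<le> 1" "a \<ge> 0"
    and z2: "z2 \<ge> 0" "K = 1 + z2" "z2 \<ge> 1 / (2 * \<alpha> - 1)"
  shows "4 powr (1 - \<alpha>) * a \<le> 1 - z2 / K / 2"
proof -
  define t where "t = 2 * \<alpha> - 1"
  define p where "p = 1 / K"
  have t: "0 < t" "t \<le> 1" using al by (auto simp: t_def)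
  have K: "K \<ge> 1" using z2 by simp
  have p: "p \<le> t / (1 + t)"
  proof -
    have "1 / t \<le> K - 1" using z2 by (simp add: t_def)
    then have "1 + t \<le> K * t" using t by (simp add: field_simps)
    then show ?thesis using t K by (simp add: p_def field_simps)
  qed
  have p0: "p \<ge> 0" using K by (simp add: p_def)
  have ap: "a \<le> p" using a K by (simp add: p_def pos_le_divide_eq mult.commute)
  define E where "E = 2 powr t"
  have "2/3 * t \<le> t * ln 2" using mult_left_mono[OF ln2_ge_two_thirds, of t] t by simp
  then have "exp (2/3 * t) \<le> E" by (simp add: E_def powr_def)
  moreover have "1 + 2/3 * t + (2/3 * t)\<^sup>2 / 2 \<le> exp (2/3 * t)" using t by (intro exp_lower_Taylor_quadratic) auto
  ultimately have E: "E \<ge> 1 + 2/3 * t + (2/3 * t)\<^sup>2 / 2" by linarith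
  have E2: "E \<le> 2" unfolding E_def using powr_mono[of t 1 2] t by simp
  have E0: "E > 0" by (simp add: E_def)
  have "(4::real) powr (1 - \<alpha>) = (2 powr 2) powr (1 - \<alpha>)" by simp
  also have "\<dots> = 2 powr (1 - t)" unfolding powr_powr by (simp add: t_def)
  also have "\<dots> = 2 / E" by (simp add: powr_diff E_def)
  finally have B: "4 powr (1 - \<alpha>) = 2 / E" .
  \<comment> \<open>The worst case \<open>p = t / (1 + t)\<close> of
    \<open>p * (4 / E - 1) \<le> 1\<close>, with \<open>E\<close> replaced by its quadratic lower
    bound.\<close>
  have "4 * t \<le> (1 + 2/3 * t + (2/3 * t)\<^sup>2 / 2) * (1 + 2 * t)"
  proof -
    have "0 \<le> (t - 1/2)\<^sup>2" by simp
    then have "t\<^sup>2 \<ge> t - 1/4" by (simp add: power2_eq_square algebra_simps)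
    moreover have "0 \<le> t ^ 3" using t by simp
    moreover have "(1 + 2/3 * t + (2/3 * t)\<^sup>2 / 2) * (1 + 2 * t) = 1 + 8/3 * t + 14/9 * t\<^sup>2 + 4/9 * t ^ 3"
      by (simp add: power2_eq_square power3_eq_cube field_simps)
    ultimately show ?thesis using t by linarith
  qed
  also have "\<dots> \<le> E * (1 + 2 * t)" using E t by (intro mult_right_mono) auto
  finally have "4 * t / E \<le> 1 + 2 * t" using E0 by (simp add: pos_divide_le_eq mult.commute)
  then have "t * (4 / E - 1) \<le> 1 + t" by (simp add: algebra_simps)
  then have "t / (1 + t) * (4 / E - 1) \<le> 1" using t by (simp add: pos_divide_le_eq)
  moreover have "4 / E \<ge> 1" using E2 E0 by (simp add: pos_le_divide_eq)
  then have "p * (4 / E - 1) \<le> t / (1 + t) * (4 / E - 1)" using p by (intro mult_right_mono) auto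
  ultimately have "p * (4 / E - 1) \<le> 1" by linarith
  then have "p * (4 / E) \<le> 1 + p" by (simp only: right_diff_distrib)
  then have "p * (4 / E) / 2 \<le> (1 + p) / 2" by (rule divide_right_mono) simp
  then have "2 / E * p \<le> 1/2 + p/2" by (simp add: add_divide_distrib mult.commute)
  moreover have "2 / E * a \<le> 2 / E * p" using ap E0 by (intro mult_left_mono) auto
  moreover have "z2 / K + p = 1" unfolding p_def add_divide_distrib[symmetric] using z2 by simp
  ultimately have "2 / E * a \<le> 1/2 + p/2" "p = 1 - z2 / K" by (blast intro: order_trans, simp)
  then show ?thesis unfolding B by (simp add: diff_divide_distrib)
qed

text \<open>\<open>\<epsilon> k\<close> stands for the error at \<open>k / 2 ^ n\<close>. In \<open>block\<close> the unit interval is cut into \<open>2 ^ j\<close> blocks;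
  \<open>D\<close> is the factor left over when the Hoelder seminorm on a block is absorbed, and \<open>1 / (2 * D)\<close>
  is the gain from using the Hoelder constant on the block instead of the global one.\<close>
locale error_recursion =
  fixes \<alpha> a Q q z2 K \<upsilon> z G D' :: real and n M :: nat and \<epsilon> :: "nat \<Rightarrow> real"
  assumes al: "1/2 < \<alpha>" "\<alpha> \<le> 1" and a: "a > 0" and Q: "Q \<ge> 0" "a\<^sup>2 \<le> 2 * Q" "q \<ge> 3 * Q"
    and z2: "z2 \<ge> 1" "K = 1 + z2" "z2 \<ge> 1 / (2 * \<alpha> - 1)"
    and z: "z = K * (a + q)" and ups: "\<upsilon> \<ge> K * q" and M: "M = nat \<lceil>(4 * z) powr (1/\<alpha>)\<rceil>"
    and G: "G \<ge> 0" "D' \<ge> 0" and e0: "\<epsilon> 0 \<le> 0"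
    and single: "\<And>k. k < 2 ^ n \<Longrightarrow> \<epsilon> (Suc k) \<le> (1 + a * real (2 ^ n) powr (-\<alpha>)) * \<epsilon> k + z2 / K * G * D' / 2 ^ n"
    and block: "\<And>j r k S D u. j \<le> n \<Longrightarrow> u = real (2 ^ j) powr (-\<alpha>) \<Longrightarrow> D = 1 - z2 * a * u \<Longrightarrow> D \<ge> 1/2 \<Longrightarrow> r < 2 ^ j
      \<Longrightarrow> (\<And>k. r * 2 ^ (n - j) \<le> k \<Longrightarrow> k \<le> (r + 1) * 2 ^ (n - j) \<Longrightarrow> \<epsilon> k \<le> S)
      \<Longrightarrow> r * 2 ^ (n - j) \<le> k \<Longrightarrow> k \<le> (r + 1) * 2 ^ (n - j)
      \<Longrightarrow> \<epsilon> k \<le> \<epsilon> (r * 2 ^ (n - j)) + (u * (a + z2 * (Q / D) * u) * S + z2 / K * G / (2 * D) * D' / 2 ^ j) / D"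
begin

lemma q0: "q \<ge> 0" using Q by linarith
lemma K2: "K \<ge> 2" using z2 by simp
lemma z_pos: "z > 0" unfolding z using K2 a q0 by (intro mult_pos_pos) auto
lemma k01: "0 \<le> z2 / K" "z2 / K \<le> 1" using z2 by auto
lemma kG: "0 \<le> z2 / K * G * D'" "z2 / K * G * D' \<le> G * D'"
  using mult_right_mono[OF mult_right_mono[OF k01(2) G(1)] G(2)]
    mult_nonneg_nonneg[OF mult_nonneg_nonneg[OF k01(1) G(1)] G(2)] by simp_all

lemma Kq: "K * q \<ge> 0" "\<upsilon> \<ge> 0"
proof -
  show "K * q \<ge> 0" using K2 q0 by (intro mult_nonneg_nonneg) auto
  then show "\<upsilon> \<ge> 0" using ups by linarith
qed

lemma M_ge: "(4 * z) powr (1/\<alpha>) \<le> M" unfolding M by (rule real_nat_ceiling_ge)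

lemma M1: "M \<ge> 1"
proof -
  have "(4 * z) powr (1/\<alpha>) > 0" using z_pos by simp
  then have "real M > 0" using M_ge by linarith
  then show ?thesis by simp
qed

lemma Ups_ge_2G: "2 * G \<le> Ups G \<upsilon> z M"
  using Ups_ge_recursion[OF z_pos G(1) M_ge _ _ _ M1, of 0 \<upsilon>] al Kq by simp

text \<open>Each block multiplies the error by at most \<open>1 + \<kappa>\<close> and adds
  \<open>b \<le> 2 * G * D' / m\<close>, while \<open>\<kappa> * m\<close> stays below the total
  rate of \<open>\<Upsilon>\<close>; \<open>Ups_ge_recursion\<close> compares the sums. If the grid
  is coarser than \<open>2 ^ j\<close> blocks, its own intervals take their place.\<close>

lemma error_bound_curvature_dominant:
  assumes aq: "a \<le> 2/3 * (K * q)" and k: "k \<le> 2 ^ n"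
  shows "\<epsilon> k \<le> Ups G \<upsilon> z M * D'"
proof -
  obtain j where "2 ^ j \<le> M \<and> M < 2 ^ (j + 1)" using ex_power_ivl1[of 2 M] M1 by auto
  then have j: "2 ^ j \<le> M" "M < 2 * 2 ^ j" by auto
  show ?thesis
  proof (cases "j \<le> n")
    case False
    define m :: nat where "m = 2 ^ n"
    have "(2::nat) ^ n \<le> 2 ^ j" using False by (intro power_increasing) auto
    then have "m \<le> M" using j(1) unfolding m_def by (rule order_trans)
    then have m: "1 \<le> m" "m \<le> M" by (auto simp: m_def)
    define \<kappa> where "\<kappa> = a * real m powr (-\<alpha>)"
    define b where "b = z2 / K * G * D' / m"
    have kap: "\<kappa> \<ge> 0" using a by (simp add: \<kappa>_def)
    have "b \<ge> 0" unfolding b_def using kG(1) by (rule divide_nonneg_nonneg) simp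
    have "\<epsilon> k \<le> b * (\<Sum>i<k. (1 + \<kappa>) ^ i)"
      using single k by (intro linear_recursion_bound[of \<epsilon>, OF e0 kap, of m]) (auto simp: m_def \<kappa>_def b_def)
    also have "\<dots> \<le> b * (\<Sum>i<m. (1 + \<kappa>) ^ i)"
      using k kap \<open>b \<ge> 0\<close> by (intro mult_left_mono sum_mono2) (auto simp: m_def)
    also have "\<dots> \<le> (2 * G * D' / m) * (\<Sum>i<m. (1 + \<kappa>) ^ i)"
    proof (rule mult_right_mono)
      have "G * D' \<le> 2 * G * D'" using G by simp
      with kG(2) have "z2 / K * G * D' \<le> 2 * G * D'" by (rule order_trans)
      then show "b \<le> 2 * G * D' / m" unfolding b_def by (rule divide_right_mono) simp
    qed (use kap in \<open>auto intro!: sum_nonneg\<close>)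
    also have "\<dots> = (2 * G / m * (\<Sum>i<m. (1 + \<kappa>) ^ i)) * D'" by simp
    also have "\<dots> \<le> Ups G \<upsilon> z M * D'"
    proof (intro mult_right_mono Ups_ge_recursion[OF z_pos G(1) M_ge _ _ m kap] disjI2)
      have "\<kappa> * m \<le> 2 * (K * q) * real m powr (-\<alpha>) * m"
        unfolding \<kappa>_def using aq Kq by (intro mult_right_mono) auto
      also have "\<dots> \<le> 2 * \<upsilon> / (4 * z) * M"
        using al Kq ups by (intro rate_bound[OF z_pos M_ge _ _ m]) auto
      finally show "\<kappa> * m \<le> 2 * \<upsilon> / (4 * z) * M" .
    qed (use al G Kq in auto)
    finally show ?thesis .
  next
    case True
    define m :: nat where "m = 2 ^ j"
    define L :: nat where "L = 2 ^ (n - j)"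
    have L: "L > 0" "m * L = 2 ^ n" using True by (auto simp: L_def m_def power_add[symmetric])
    have m: "1 \<le> m" "m \<le> M" "M < 2 * m" using j by (auto simp: m_def)
    define u where "u = real m powr (-\<alpha>)"
    define D where "D = 1 - z2 * a * u"
    define X where "X = u * (a + z2 * (Q / D) * u)"
    define R where "R = z2 / K * G / (2 * D) * D' / 2 ^ j"
    have al': "0 < \<alpha>" using al by simp
    have "z2 \<ge> 0" using z2 by simp
    note gb = curvature_dominant_block[OF al' al(2) a Q(1,3) this z2(2) M_ge[unfolded z] m u_def D_def X_def]
    define \<kappa> where "\<kappa> = X / (D - X)"
    define b where "b = R / (D - X)"
    have kap: "\<kappa> \<ge> 0" using gb(2,3) by (simp add: \<kappa>_def)
    have "R = z2 / K * G * D' / (2 * D * 2 ^ j)" by (simp add: R_def)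
    also have "\<dots> \<ge> 0" using gb(1) by (intro divide_nonneg_nonneg[OF kG(1)]) auto
    finally have R0: "R \<ge> 0" .
    \<comment> \<open>Here \<open>2 * D \<ge> 1\<close> and \<open>z2 / K \<le> 1\<close> are used;
      \<open>D - X \<ge> 1/2\<close> then costs the factor 2 in \<open>b2\<close>.\<close>
    have "R \<le> G * D' / m"
    proof -
      have "z2 / K * G * D' / (2 * D) \<le> G * D' / 1" using gb(1) kG G by (intro frac_le) auto
      then have "z2 / K * G * D' / (2 * D) / m \<le> G * D' / 1 / m" by (rule divide_right_mono) simp
      moreover have "R = z2 / K * G * D' / (2 * D) / m" by (simp add: R_def m_def)
      ultimately show ?thesis by simp
    qed
    then have b2: "b \<le> 2 * G * D' / m" unfolding b_def using R0 gb(2) frac_le[of "G * D' / m" R "1/2" "D - X"] G by (simp add: mult_ac)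
    have b0: "b \<ge> 0" using R0 gb(2) by (simp add: b_def)
    have blk: "\<epsilon> k \<le> (1 + \<kappa>) * \<epsilon> (r * L) + b" if r: "r < m" and k: "r * L \<le> k" "k \<le> (r + 1) * L" for r k
    proof -
      define S where "S = Max (\<epsilon> ` {r * L..(r + 1) * L})"
      have S: "\<epsilon> i \<le> S" if "r * L \<le> i" "i \<le> (r + 1) * L" for i
        unfolding S_def using that by (intro Max_ge) auto
      have "\<epsilon> i \<le> \<epsilon> (r * L) + (X * S + R) / D" if "r * L \<le> i" "i \<le> (r + 1) * L" for i
        unfolding X_def R_def L_def using that S gb(1) r unfolding m_def L_def
        by (intro block[OF True _ D_def]) (auto simp: u_def m_def)
      then have "S \<le> \<epsilon> (r * L) + (X * S + R) / D" unfolding S_def by (intro Max.boundedI) auto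
      then have "S * D \<le> \<epsilon> (r * L) * D + (X * S + R)" using gb(1) by (simp add: field_simps)
      then have "S * (D - X) \<le> \<epsilon> (r * L) * D + R" by (simp add: algebra_simps)
      then have "S \<le> (\<epsilon> (r * L) * D + R) / (D - X)" using gb(2) by (simp add: pos_le_divide_eq)
      also have "\<dots> = (1 + \<kappa>) * \<epsilon> (r * L) + b"
      proof -
        have "1 + \<kappa> = D / (D - X)" using gb(2) by (simp add: \<kappa>_def field_simps)
        then show ?thesis by (simp add: b_def add_divide_distrib mult.commute)
      qed
      finally show ?thesis using S[OF k] by linarith
    qed
    have rec: "\<epsilon> (r * L) \<le> b * (\<Sum>i<r. (1 + \<kappa>) ^ i)" if "r \<le> m" for r
      using blk e0 that by (intro linear_recursion_bound[of "\<lambda>r. \<epsilon> (r * L)", OF _ kap, of m]) (auto simp: add.commute)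
    have "\<epsilon> k \<le> b * (\<Sum>i<m. (1 + \<kappa>) ^ i)"
    proof (cases "k = 2 ^ n")
      case True
      then show ?thesis using rec[of m] L by simp
    next
      case False
      define r where "r = k div L"
      have "k < m * L" using False k L by simp
      then have r: "r < m" unfolding r_def by (simp add: less_mult_imp_div_less)
      have "r * L \<le> k" "k \<le> (r + 1) * L"
        unfolding r_def using L(1) dividend_less_div_times[of L k] by auto
      then have "\<epsilon> k \<le> (1 + \<kappa>) * \<epsilon> (r * L) + b" by (rule blk[OF r])
      also have "\<dots> \<le> (1 + \<kappa>) * (b * (\<Sum>i<r. (1 + \<kappa>) ^ i)) + b"
        using rec[of r] r kap by (intro add_right_mono mult_left_mono) auto
      also have "\<dots> = b * (\<Sum>i<Suc r. (1 + \<kappa>) ^ i)"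
        by (simp add: sum.lessThan_Suc_shift sum_distrib_left algebra_simps del: sum.lessThan_Suc)
      also have "\<dots> \<le> b * (\<Sum>i<m. (1 + \<kappa>) ^ i)"
        using r kap b0 by (intro mult_left_mono sum_mono2) auto
      finally show ?thesis .
    qed
    also have "\<dots> \<le> (2 * G * D' / m) * (\<Sum>i<m. (1 + \<kappa>) ^ i)"
      using b2 kap by (intro mult_right_mono sum_nonneg) auto
    also have "\<dots> = (2 * G / m * (\<Sum>i<m. (1 + \<kappa>) ^ i)) * D'" by simp
    also have "\<dots> \<le> Ups G \<upsilon> z M * D'"
    proof (intro mult_right_mono Ups_ge_recursion[OF z_pos G(1) M_ge _ _ m(1,2) kap] disjI2)
      have "\<kappa> * m \<le> 2 * (K * q) * real m powr (-\<alpha>) * m"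
        using gb(4)[OF aq] unfolding \<kappa>_def u_def by (intro mult_right_mono) auto
      also have "\<dots> \<le> 2 * \<upsilon> / (4 * z) * M"
        using al Kq ups by (intro rate_bound[OF z_pos M_ge _ _ m(1,2)]) auto
      finally show "\<kappa> * m \<le> 2 * \<upsilon> / (4 * z) * M" .
    qed (use al G Kq in auto)
    finally show ?thesis .
  qed
qed

text \<open>The error is not compounded from block to block: every block adds at most the same
  \<open>b\<close>, which contains the supremum \<open>S\<close> over the whole grid, and the sum
  over eight blocks still leaves a positive multiple of \<open>S\<close> on the left.\<close>

lemma error_bound_gradient_dominant:
  assumes aq: "2/3 * (K * q) < a" and k: "k \<le> 2 ^ n"
  shows "\<epsilon> k \<le> 2 * G * D'"
proof -
  define S where "S = Max (\<epsilon> ` {..2 ^ n})"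
  have S: "\<epsilon> i \<le> S" if "i \<le> 2 ^ n" for i unfolding S_def using that by (intro Max_ge) auto
  have Sle: "S \<le> B" if "\<And>i. i \<le> 2 ^ n \<Longrightarrow> \<epsilon> i \<le> B" for B
    unfolding S_def using that by (intro Max.boundedI) auto
  have z20: "z2 \<ge> 0" using z2 by simp
  have kpos: "z2 / K > 0" using z2 by simp
  have "K * (3 * Q) \<le> K * q" using Q K2 by (intro mult_left_mono) auto
  then have KQ: "2 * (K * Q) \<le> a" using aq by linarith
  have "S \<le> 2 * G * D'"
  proof (cases "S \<le> 0")
    case True
    then show ?thesis using G mult_nonneg_nonneg[of G D'] by linarith
  next
    case S0: False
    show ?thesis
    \<comment> \<open>For \<open>n \<le> 2\<close> the grid cannot be cut into eight blocks, but
      then it has at most four steps.\<close>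
    proof (cases "n \<le> 2")
      case True
      have "K * a\<^sup>2 \<le> K * (2 * Q)" using Q K2 by (intro mult_left_mono) auto
      then have "(K * a) * a \<le> 1 * a" using KQ by (simp add: power2_eq_square)
      then have Ka: "K * a \<le> 1" using a by simp
      define m :: real where "m = 2 ^ n"
      have m: "m \<ge> 1" "m \<le> 4" unfolding m_def using True power_increasing[of n 2 "2::real"] by auto
      define b where "b = a * m powr (-\<alpha>) * S + z2 / K * G * D' / m"
      have b: "b \<ge> 0" unfolding b_def
        using S0 a m z20 K2 G by (intro add_nonneg_nonneg mult_nonneg_nonneg divide_nonneg_nonneg) auto
      have step: "\<epsilon> i \<le> i * b" if "i \<le> 2 ^ n" for i
        using that
      proof (induction i)
        case (Suc i)
        have "\<epsilon> (Suc i) \<le> \<epsilon> i + (a * m powr (-\<alpha>) * \<epsilon> i + z2 / K * G * D' / m)"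
          using single[of i] Suc by (simp add: m_def algebra_simps)
        also have "a * m powr (-\<alpha>) * \<epsilon> i \<le> a * m powr (-\<alpha>) * S"
          using S[of i] Suc a by (intro mult_left_mono) auto
        finally have "\<epsilon> (Suc i) \<le> \<epsilon> i + b" by (simp add: b_def)
        moreover have "\<epsilon> i \<le> i * b" using Suc by simp
        ultimately show ?case by (simp add: distrib_right)
      qed (use e0 in simp)
      have "S \<le> m * b"
      proof (rule Sle)
        fix i :: nat assume i: "i \<le> 2 ^ n"
        then have "real i \<le> m" unfolding m_def by (metis of_nat_le_iff of_nat_numeral of_nat_power)
        then have "i * b \<le> m * b" using b by (intro mult_right_mono)
        then show "\<epsilon> i \<le> m * b" using step[OF i] by linarith
      qed
      also have "m * b = (m powr (1 - \<alpha>) * a) * S + z2 / K * G * D'"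
        using m by (simp add: b_def field_simps powr_diff powr_minus_divide)
      also have "m powr (1 - \<alpha>) * a \<le> 4 powr (1 - \<alpha>) * a"
        using m al a by (intro mult_right_mono powr_mono2) auto
      also have "\<dots> \<le> 1 - z2 / K / 2" using a by (intro gradient_dominant_coarse[OF al Ka _ z20 z2(2,3)]) auto
      finally have "S \<le> (1 - z2 / K / 2) * S + z2 / K * G * D'" using S0 by simp
      then have "z2 / K * S / 2 \<le> z2 / K * G * D'" by (simp only: left_diff_distrib)
      then have "z2 / K * S / 2 * 2 \<le> z2 / K * G * D' * 2" by (rule mult_right_mono) simp
      then have "z2 / K * S \<le> z2 / K * (2 * G * D')" by (simp add: mult_ac)
      then show ?thesis using kpos by (metis mult_le_cancel_left_pos)
    next
      case False
      define L :: nat where "L = 2 ^ (n - 3)"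
      have L: "L > 0" "8 * L = 2 ^ n" using False power_add[of "2::nat" 3 "n - 3"] by (auto simp: L_def)
      define u :: real where "u = 8 powr (-\<alpha>)"
      define D where "D = 1 - z2 * a * u"
      define X where "X = u * (a + z2 * (Q / D) * u)"
      define R where "R = z2 / K * G / (2 * D) * D'"
      note bb = gradient_dominant_block[OF al a Q(1,2) KQ z20 z2(2,3) u_def D_def X_def]
      define b where "b = (X * S + R / 8) / D"
      have X0: "X \<ge> 0" using z20 a Q bb(1) by (auto simp: X_def u_def)
      have "R = z2 / K * G * D' / (2 * D)" by (simp add: R_def)
      also have "\<dots> \<ge> 0" using bb(1) by (intro divide_nonneg_nonneg[OF kG(1)]) auto
      finally have R0: "R \<ge> 0" .
      have b0: "b \<ge> 0" using X0 R0 S0 bb(1) by (simp add: b_def)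
      have blk: "\<epsilon> i \<le> \<epsilon> (r * L) + b" if r: "r < 8" and i: "r * L \<le> i" "i \<le> (r + 1) * L" for r i
      proof -
        have "(r + 1) * L \<le> 2 ^ n" unfolding L(2)[symmetric] using r by (intro mult_right_mono) auto
        then have "\<epsilon> i \<le> \<epsilon> (r * 2 ^ (n - 3)) + (u * (a + z2 * (Q / D) * u) * S + z2 / K * G / (2 * D) * D' / 2 ^ 3) / D"
          using False bb(1) r i S unfolding L_def by (intro block[of 3]) (auto simp: u_def D_def)
        then show ?thesis by (simp add: b_def X_def R_def L_def)
      qed
      have rec: "\<epsilon> (r * L) \<le> r * b" if "r \<le> 8" for r
        using that
      proof (induction r)
        case (Suc r)
        then have "\<epsilon> (Suc r * L) \<le> \<epsilon> (r * L) + b" by (intro blk) auto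
        then show ?case using Suc by (simp add: algebra_simps)
      qed (use e0 in simp)
      have "S \<le> 8 * b"
      proof (rule Sle)
        fix i :: nat assume i: "i \<le> 2 ^ n"
        show "\<epsilon> i \<le> 8 * b"
        proof (cases "i = 2 ^ n")
          case True
          then show ?thesis using rec[of 8] L by simp
        next
          case False
          define r where "r = i div L"
          have "i < 8 * L" using False i L by simp
          then have r: "r < 8" unfolding r_def by (simp add: less_mult_imp_div_less)
          have "r * L \<le> i" "i \<le> (r + 1) * L"
            unfolding r_def using L(1) dividend_less_div_times[of L i] by auto
          then have "\<epsilon> i \<le> real r * b + b" using blk[OF r] rec[of r] r by fastforce
          also have "\<dots> \<le> 7 * b + b" using r b0 by (intro add_right_mono mult_right_mono) auto
          finally show ?thesis by simp
        qed
      qed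
      then have "S * D \<le> 8 * (X * S + R / 8)" using bb(1) by (simp add: b_def pos_le_divide_eq)
      then have "S * (D - 8 * X) \<le> R" by (simp add: algebra_simps)
      also have "R = z2 / K * (G * D') / (2 * D)" by (simp add: R_def)
      also have "\<dots> \<le> 4 * D * (D - 8 * X) * (G * D') / (2 * D)"
        using bb G by (intro divide_right_mono mult_right_mono) auto
      also have "\<dots> = (2 * G * D') * (D - 8 * X)" using bb(1) by simp
      finally have le: "S * (D - 8 * X) \<le> (2 * G * D') * (D - 8 * X)" .
      have "0 < 4 * D * (D - 8 * X)" using bb(2) kpos by linarith
      then have "D - 8 * X > 0" using bb(1) by (simp add: zero_less_mult_iff)
      then show ?thesis using le by simp
    qed
  qed
  then show ?thesis using S[OF k] by linarith
qed

lemma error_bound: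
  assumes "k \<le> 2 ^ n" shows "\<epsilon> k \<le> Ups G \<upsilon> z M * D'"
proof (cases "a \<le> 2/3 * (K * q)")
  case False
  then have "\<epsilon> k \<le> 2 * G * D'" using assms by (intro error_bound_gradient_dominant) auto
  also have "\<dots> \<le> Ups G \<upsilon> z M * D'" using Ups_ge_2G G by (intro mult_right_mono)
  finally show ?thesis .
qed (use error_bound_curvature_dominant assms in blast)

end

subsection \<open>Functions with bounded partial derivatives\<close>

lemma component_le_vabs: "\<bar>v $ i\<bar> \<le> vabs v"
  unfolding vabs_def by (rule Max_ge) auto

lemma vabs_leI: "(\<And>i. \<bar>v $ i\<bar> \<le> c) \<Longrightarrow> vabs v \<le> c"
  unfolding vabs_def by (subst Max_le_iff) auto

lemma vabs_nonneg [simp]: "vabs v \<ge> 0"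
  using component_le_vabs[of v undefined] by linarith

lemma vabs_zero [simp]: "vabs 0 = 0"
  by (rule antisym) (auto intro: vabs_leI)

lemma vabs_triangle: "vabs (v + w) \<le> vabs v + vabs w"
proof (rule vabs_leI)
  fix i show "\<bar>(v + w) $ i\<bar> \<le> vabs v + vabs w"
    using component_le_vabs[of v i] component_le_vabs[of w i] by simp
qed

lemma vabs_minus: "vabs (- v) = vabs v"
  by (simp add: vabs_def)

lemma vabs_minus_commute: "vabs (v - w) = vabs (w - v)"
  by (metis vabs_minus minus_diff_eq)

lemma vabs_triangle_sub: "vabs (v - w) \<le> vabs v + vabs w"
  using vabs_triangle[of v "- w"] by (simp add: vabs_minus)

lemma vabs_sum: "vabs (\<Sum>i\<in>I. g i) \<le> (\<Sum>i\<in>I. vabs (g i))"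
  by (induction I rule: infinite_finite_induct) (auto intro: order_trans[OF vabs_triangle])

lemma sum_abs_prod_le:
  fixes c v :: "'n::finite \<Rightarrow> real" and B V :: real
  assumes "\<And>k. \<bar>c k\<bar> \<le> B" "\<And>k. \<bar>v k\<bar> \<le> V"
  shows "\<bar>\<Sum>k\<in>UNIV. c k * v k\<bar> \<le> CARD('n) * (B * V)"
proof -
  have B: "B \<ge> 0" using assms(1)[of undefined] by linarith
  have "\<bar>\<Sum>k\<in>UNIV. c k * v k\<bar> \<le> (\<Sum>k\<in>UNIV. \<bar>c k\<bar> * \<bar>v k\<bar>)"
    by (rule order_trans[OF sum_abs]) (simp add: abs_mult)
  also have "\<dots> \<le> (\<Sum>k\<in>(UNIV::'n set). B * V)"
    using assms B by (intro sum_mono mult_mono) auto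
  finally show ?thesis by simp
qed

lemma vabs_matrix_vector_mult:
  fixes A :: "real^'h^'d" and B :: real
  assumes "\<And>i j. \<bar>A $ i $ j\<bar> \<le> B"
  shows "vabs (A *v v) \<le> CARD('h) * (B * vabs v)"
proof (rule vabs_leI)
  fix i
  show "\<bar>(A *v v) $ i\<bar> \<le> CARD('h) * (B * vabs v)"
    unfolding matrix_vector_mult_def
    by (simp, intro sum_abs_prod_le assms component_le_vabs)
qed

section \<open>Total derivatives and mean value estimates\<close>

lemma DERIV_line:
  assumes "\<And>y. has_pd g k y"
  shows "((\<lambda>s. g (z + s *\<^sub>R axis k 1)) has_real_derivative pd g k (z + t *\<^sub>R axis k 1)) (at t)"
proof -
  have "((\<lambda>s. g ((z + t *\<^sub>R axis k 1) + s *\<^sub>R axis k 1)) has_real_derivative pd g k (z + t *\<^sub>R axis k 1)) (at 0)"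
    using assms[of "z + t *\<^sub>R axis k 1"] unfolding has_pd_def pd_def
    by (simp add: DERIV_deriv_iff_real_differentiable)
  then have "((\<lambda>s. g (z + (s + t) *\<^sub>R axis k 1)) has_real_derivative pd g k (z + t *\<^sub>R axis k 1)) (at 0)"
    by (simp add: scaleR_add_left add_ac)
  then show ?thesis using DERIV_shift[of "\<lambda>s. g (z + s *\<^sub>R axis k 1)" _ 0 t] by simp
qed

lemma real_MVT_bound:
  fixes h :: "real \<Rightarrow> real"
  assumes "\<And>t. t \<in> closed_segment a b \<Longrightarrow> (h has_real_derivative h' t) (at t)"
    and "\<And>t. t \<in> closed_segment a b \<Longrightarrow> \<bar>h' t\<bar> \<le> B"
  shows "\<bar>h b - h a\<bar> \<le> B * \<bar>b - a\<bar>"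
  using field_differentiable_bound[of "closed_segment a b" h h' B b a] assms
  by (auto simp: real_norm_def intro: has_field_derivative_at_within)

text \<open>The coordinates are changed one at a time: \<open>w S\<close> agrees with
  \<open>v\<close> on \<open>S\<close> and vanishes elsewhere, and passing to
  \<open>insert k S\<close> moves along axis \<open>k\<close>, where the mean value theorem applies.
  All intermediate points stay within \<open>norm v\<close> of \<open>y\<close>, so continuity of
  the partial derivatives at \<open>y\<close> controls the error.\<close>

lemma has_derivative_of_partials:
  fixes g :: "real^'n \<Rightarrow> real" and B B' :: real
  assumes pd: "\<And>k y. has_pd g k y" and cont: "\<And>k. continuous_on UNIV (pd g k)"
  shows "(g has_derivative (\<lambda>v. \<Sum>k\<in>UNIV. pd g k y * v $ k)) (at y)"
  unfolding has_derivative_at_alt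
proof (intro conjI allI impI)
  show "bounded_linear (\<lambda>v. \<Sum>k\<in>UNIV. pd g k y * v $ k)"
    by (intro bounded_linear_sum bounded_linear_mult_right[THEN bounded_linear_compose] bounded_linear_vec_nth)
  fix e :: real assume e: "e > 0"
  define \<epsilon> where "\<epsilon> = e / CARD('n)"
  have ep: "\<epsilon> > 0" using e by (simp add: \<epsilon>_def)
  have "\<exists>d>0. \<forall>z. norm (z - y) < d \<longrightarrow> \<bar>pd g k z - pd g k y\<bar> < \<epsilon>" for k
  proof -
    have "continuous (at y) (pd g k)" using cont by (simp add: continuous_on_eq_continuous_at)
    then show ?thesis using ep unfolding continuous_at_eps_delta by (auto simp: dist_norm real_norm_def)
  qed
  then obtain d where d: "\<And>k. d k > 0" "\<And>k z. norm (z - y) < d k \<Longrightarrow> \<bar>pd g k z - pd g k y\<bar> < \<epsilon>"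
    by metis
  define d0 where "d0 = Min (range d)"
  have d0: "d0 > 0" "\<And>k. d0 \<le> d k" using d by (auto simp: d0_def)
  show "\<exists>d>0. \<forall>z. norm (z - y) < d \<longrightarrow>
      norm (g z - g y - (\<Sum>k\<in>UNIV. pd g k y * (z - y) $ k)) \<le> e * norm (z - y)"
  proof (intro exI[of _ d0] conjI allI impI d0(1))
    fix z assume z: "norm (z - y) < d0"
    define v where "v = z - y"
    define w where "w S = (\<chi> i. if i \<in> S then v $ i else 0)" for S
    have w0: "w {} = 0" by (simp add: w_def vec_eq_iff)
    have step: "\<bar>g (y + w S) - g y - (\<Sum>k\<in>S. pd g k y * v $ k)\<bar> \<le> (\<Sum>k\<in>S. \<epsilon> * \<bar>v $ k\<bar>)" for S
    proof (induction S rule: infinite_finite_induct)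
      case (insert k S)
      have w: "w (insert k S) = w S + v $ k *\<^sub>R axis k 1"
        using insert(2) by (auto simp: vec_eq_iff w_def axis_def)
      let ?h = "\<lambda>s. g ((y + w S) + s *\<^sub>R axis k 1) - pd g k y * s"
      have "\<bar>?h (v $ k) - ?h 0\<bar> \<le> \<epsilon> * \<bar>v $ k - 0\<bar>"
      proof (rule real_MVT_bound)
        fix s assume s: "s \<in> closed_segment 0 (v $ k)"
        show "(?h has_real_derivative (pd g k ((y + w S) + s *\<^sub>R axis k 1) - pd g k y)) (at s)"
          by (auto intro!: derivative_eq_intros DERIV_line pd)
        have "norm (w S + s *\<^sub>R axis k 1) \<le> norm v"
        proof (rule norm_le_componentwise_cart)
          fix i show "norm ((w S + s *\<^sub>R axis k 1) $ i) \<le> norm (v $ i)"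
            using insert(2) s by (auto simp: w_def axis_def closed_segment_eq_real_ivl split: if_splits)
        qed
        then have "norm ((y + w S + s *\<^sub>R axis k 1) - y) < d k"
          using z d0(2)[of k] by (simp add: v_def)
        then show "\<bar>pd g k ((y + w S) + s *\<^sub>R axis k 1) - pd g k y\<bar> \<le> \<epsilon>"
          using d(2)[of _ k] by (meson less_imp_le)
      qed
      then have "\<bar>g (y + w (insert k S)) - g (y + w S) - pd g k y * v $ k\<bar> \<le> \<epsilon> * \<bar>v $ k\<bar>"
        by (simp add: w add.assoc)
      then show ?case using insert by simp
    qed (simp_all add: w0)
    have "w UNIV = v" by (simp add: w_def vec_eq_iff)
    then have "\<bar>g z - g y - (\<Sum>k\<in>UNIV. pd g k y * v $ k)\<bar> \<le> (\<Sum>k\<in>UNIV. \<epsilon> * \<bar>v $ k\<bar>)"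
      using step[of UNIV] by (simp add: v_def)
    also have "\<dots> \<le> (\<Sum>k\<in>(UNIV::'n set). \<epsilon> * norm v)"
      using ep component_le_norm_cart[of v] by (intro sum_mono mult_left_mono) auto
    also have "\<dots> = e * norm v" by (simp add: \<epsilon>_def)
    finally show "norm (g z - g y - (\<Sum>k\<in>UNIV. pd g k y * (z - y) $ k)) \<le> e * norm (z - y)"
      by (simp add: v_def)
  qed
qed

lemma DERIV_segment:
  fixes g :: "real^'n \<Rightarrow> real" and B B' :: real
  assumes "\<And>k y. has_pd g k y" "\<And>k. continuous_on UNIV (pd g k)"
  shows "((\<lambda>t. g (z + t *\<^sub>R v)) has_real_derivative (\<Sum>k\<in>UNIV. pd g k (z + t *\<^sub>R v) * v $ k)) (at t)"
proof -
  have "((\<lambda>t. z + t *\<^sub>R v) has_derivative (\<lambda>s. s *\<^sub>R v)) (at t)"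
    by (auto intro!: derivative_eq_intros)
  from diff_chain_at[OF this has_derivative_of_partials[OF assms]]
  have "((\<lambda>t. g (z + t *\<^sub>R v)) has_derivative (\<lambda>s. \<Sum>k\<in>UNIV. pd g k (z + t *\<^sub>R v) * (s *\<^sub>R v) $ k)) (at t)"
    by (simp add: o_def)
  then show ?thesis
    unfolding has_field_derivative_def
    by (rule has_derivative_eq_rhs) (auto simp: sum_distrib_left mult_ac)
qed

lemma lipschitz_of_partials:
  fixes g :: "real^'n \<Rightarrow> real" and B B' :: real
  assumes "\<And>k y. has_pd g k y" "\<And>k. continuous_on UNIV (pd g k)" and B: "\<And>k y. \<bar>pd g k y\<bar> \<le> B"
  shows "\<bar>g z' - g z\<bar> \<le> CARD('n) * (B * vabs (z' - z))"
proof -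
  let ?h = "\<lambda>t. g (z + t *\<^sub>R (z' - z))"
  have "\<bar>?h 1 - ?h 0\<bar> \<le> CARD('n) * (B * vabs (z' - z)) * \<bar>1 - 0\<bar>"
    by (intro real_MVT_bound[OF DERIV_segment[OF assms(1,2)]] sum_abs_prod_le B component_le_vabs)
  then show ?thesis by simp
qed

text \<open>Mean value theorem for the difference of \<open>g\<close> along two segments. Its
  derivative splits into a gradient times the difference of the directions and a difference of
  gradients times \<open>x' - x\<close>; the points compared are at distance at most
  \<open>w\<close> by convexity. In the error estimate \<open>x\<close> and \<open>y\<close> are
  values of the solution at two times and \<open>x'\<close> and \<open>y'\<close> those of the
  scheme, so \<open>w\<close> is a Hoelder increment and \<open>x' - x\<close> an error.\<close>

lemma second_difference_bound:
  fixes g :: "real^'n \<Rightarrow> real" and B B' :: real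
  assumes 1: "\<And>k y. has_pd g k y" "\<And>k. continuous_on UNIV (pd g k)" "\<And>k y. \<bar>pd g k y\<bar> \<le> B"
    and 2: "\<And>k l y. has_pd (pd g k) l y" "\<And>k l. continuous_on UNIV (pd (pd g k) l)" "\<And>k l y. \<bar>pd (pd g k) l y\<bar> \<le> B'"
    and w: "vabs (y - x) \<le> w" "vabs (y' - x') \<le> w"
  shows "\<bar>(g y' - g y) - (g x' - g x)\<bar>
    \<le> CARD('n) * (B * vabs ((y' - y) - (x' - x))) + CARD('n) * (CARD('n) * (B' * w) * vabs (x' - x))"
proof -
  let ?h = "\<lambda>t. g (y + t *\<^sub>R (y' - y)) - g (x + t *\<^sub>R (x' - x))"
  let ?h' = "\<lambda>t. (\<Sum>k\<in>UNIV. pd g k (y + t *\<^sub>R (y' - y)) * (y' - y) $ k) - (\<Sum>k\<in>UNIV. pd g k (x + t *\<^sub>R (x' - x)) * (x' - x) $ k)"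
  let ?B = "CARD('n) * (B * vabs ((y' - y) - (x' - x))) + CARD('n) * (CARD('n) * (B' * w) * vabs (x' - x))"
  have B': "B' \<ge> 0" using 2(3)[of undefined undefined undefined] by linarith
  have "\<bar>?h 1 - ?h 0\<bar> \<le> ?B * \<bar>1 - 0\<bar>"
  proof (rule real_MVT_bound)
    fix t :: real assume "t \<in> closed_segment 0 1"
    then have t: "0 \<le> t" "t \<le> 1" by (auto simp: closed_segment_eq_real_ivl)
    show "(?h has_real_derivative ?h' t) (at t)"
      by (intro DERIV_diff DERIV_segment 1)
    have "(y + t *\<^sub>R (y' - y)) - (x + t *\<^sub>R (x' - x)) = (1 - t) *\<^sub>R (y - x) + t *\<^sub>R (y' - x')"
      by (simp add: algebra_simps)
    moreover have "vabs ((1 - t) *\<^sub>R (y - x) + t *\<^sub>R (y' - x')) \<le> w"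
    proof (rule vabs_leI)
      fix i
      have "\<bar>((1 - t) *\<^sub>R (y - x) + t *\<^sub>R (y' - x')) $ i\<bar> \<le> (1 - t) * \<bar>(y - x) $ i\<bar> + t * \<bar>(y' - x') $ i\<bar>"
        using t abs_triangle_ineq[of "(1 - t) * (y - x) $ i" "t * (y' - x') $ i"] by (simp add: abs_mult)
      also have "\<dots> \<le> (1 - t) * w + t * w"
        using t w component_le_vabs[of "y - x" i] component_le_vabs[of "y' - x'" i]
        by (intro add_mono mult_left_mono) linarith+
      finally show "\<bar>((1 - t) *\<^sub>R (y - x) + t *\<^sub>R (y' - x')) $ i\<bar> \<le> w" by (simp add: algebra_simps)
    qed
    ultimately have "vabs ((y + t *\<^sub>R (y' - y)) - (x + t *\<^sub>R (x' - x))) \<le> w" by simp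
    then have *: "\<bar>pd g k (y + t *\<^sub>R (y' - y)) - pd g k (x + t *\<^sub>R (x' - x))\<bar> \<le> CARD('n) * (B' * w)" for k
      using B' by (intro order_trans[OF lipschitz_of_partials[OF 2]] mult_left_mono) auto
    have "?h' t = (\<Sum>k\<in>UNIV. pd g k (y + t *\<^sub>R (y' - y)) * ((y' - y) - (x' - x)) $ k)
       + (\<Sum>k\<in>UNIV. (pd g k (y + t *\<^sub>R (y' - y)) - pd g k (x + t *\<^sub>R (x' - x))) * (x' - x) $ k)"
      unfolding sum_subtractf[symmetric] sum.distrib[symmetric] by (intro sum.cong) (auto simp: algebra_simps)
    also have "\<bar>\<dots>\<bar> \<le> ?B"
      by (intro order_trans[OF abs_triangle_ineq] add_mono sum_abs_prod_le 1 * component_le_vabs)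
    finally show "\<bar>?h' t\<bar> \<le> ?B" .
  qed
  then show ?thesis by simp
qed

section \<open>Landau's inequality\<close>

lemma landau_partial:
  fixes g :: "real^'n \<Rightarrow> real" and B B' :: real
  assumes 1: "\<And>y. has_pd g k y" and 2: "\<And>y. has_pd (pd g k) k y"
    and b: "\<And>y. \<bar>g y\<bar> \<le> A" "\<And>y. \<bar>pd (pd g k) k y\<bar> \<le> B" and h: "h > 0"
  shows "\<bar>pd g k z\<bar> \<le> A / h + h * B / 2"
proof -
  define \<phi> where "\<phi> s = g (z + s *\<^sub>R axis k 1)" for s
  define \<phi>1 where "\<phi>1 s = pd g k (z + s *\<^sub>R axis k 1)" for s
  define \<phi>2 where "\<phi>2 s = pd (pd g k) k (z + s *\<^sub>R axis k 1)" for s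
  have d1: "(\<phi> has_real_derivative \<phi>1 s) (at s)" for s unfolding \<phi>_def \<phi>1_def by (rule DERIV_line[OF 1])
  have d2: "(\<phi>1 has_real_derivative \<phi>2 s) (at s)" for s unfolding \<phi>1_def \<phi>2_def by (rule DERIV_line[OF 2])
  have b2: "\<bar>\<phi>2 s\<bar> \<le> B" for s unfolding \<phi>2_def by (rule b)
  have taylor: "\<bar>\<phi> c - \<phi> 0 - \<phi>1 0 * c\<bar> \<le> B * c\<^sup>2 / 2" if c: "c \<noteq> 0" for c
  proof -
    have "\<exists>t. (if c < 0 then c < t \<and> t < 0 else 0 < t \<and> t < c) \<and>
      \<phi> c = (\<Sum>m<2. (if m = 0 then \<phi> else if m = 1 then \<phi>1 else \<phi>2) 0 / fact m * (c - 0) ^ m)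
        + (if (2::nat) = 0 then \<phi> else if 2 = (1::nat) then \<phi>1 else \<phi>2) t / fact 2 * (c - 0) ^ 2"
      using c d1 d2 by (intro Taylor[of 2 "\<lambda>m. if m = 0 then \<phi> else if m = 1 then \<phi>1 else \<phi>2" \<phi> "- \<bar>c\<bar>" "\<bar>c\<bar>"])
         (auto simp: less_2_cases_iff)
    then obtain t where "\<phi> c = \<phi> 0 + \<phi>1 0 * c + \<phi>2 t / 2 * c\<^sup>2"
      by (auto simp: numeral_2_eq_2)
    then have "\<bar>\<phi> c - \<phi> 0 - \<phi>1 0 * c\<bar> = \<bar>\<phi>2 t\<bar> * c\<^sup>2 / 2" by (simp add: abs_mult)
    also have "\<dots> \<le> B * c\<^sup>2 / 2" using b2 by (intro divide_right_mono mult_right_mono) auto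
    finally show ?thesis .
  qed
  have "\<bar>\<phi> h\<bar> \<le> A" "\<bar>\<phi> (-h)\<bar> \<le> A" unfolding \<phi>_def by (auto intro: b)
  \<comment> \<open>Subtracting the expansions at \<open>h\<close> and \<open>-h\<close> cancels
    \<open>\<phi> 0\<close> and leaves twice the first derivative.\<close>
  moreover have "\<bar>\<phi> h - \<phi> 0 - \<phi>1 0 * h\<bar> \<le> B * h\<^sup>2 / 2" "\<bar>\<phi> (-h) - \<phi> 0 + \<phi>1 0 * h\<bar> \<le> B * h\<^sup>2 / 2"
    using taylor[of h] taylor[of "-h"] h by simp_all
  ultimately have "\<bar>2 * (\<phi>1 0 * h)\<bar> \<le> 2 * A + B * h\<^sup>2" by linarith
  then have "\<bar>\<phi>1 0\<bar> * (2 * h) \<le> 2 * A + B * h\<^sup>2" using h by (simp add: abs_mult)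
  then have "\<bar>\<phi>1 0\<bar> \<le> (2 * A + B * h\<^sup>2) / (2 * h)" using h by (simp add: pos_le_divide_eq)
  also have "\<dots> = A / h + h * B / 2" using h by (simp add: field_simps power2_eq_square)
  finally show ?thesis by (simp add: \<phi>1_def)
qed

text \<open>The choice \<open>h = 2 * F0 / F1\<close> makes the first term half of
  \<open>F1\<close>. It is no positive step when \<open>F0 = 0\<close>; there
  \<open>h = F1 / (F2 + 1)\<close> contradicts \<open>F1 > 0\<close>.\<close>

lemma landau_of_interpolation:
  fixes F0 F1 F2 :: real
  assumes "F1 > 0" "F0 \<ge> 0" "F2 \<ge> 0" and h: "\<And>h. h > 0 \<Longrightarrow> F1 \<le> F0 / h + h * F2 / 2"
  shows "F1\<^sup>2 \<le> 2 * (F0 * F2)"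
proof (cases "F0 = 0")
  case True
  have "F1 \<le> F1 / (F2 + 1) * F2 / 2" using h[of "F1 / (F2 + 1)"] assms True by simp
  also have "\<dots> = F1 * (F2 / (F2 + 1)) / 2" by simp
  also have "\<dots> \<le> F1 * 1 / 2" using assms by (intro divide_right_mono mult_left_mono) auto
  finally show ?thesis using assms by simp
next
  case False
  have "F1 \<le> F1 / 2 + F0 * F2 / F1" using h[of "2 * F0 / F1"] assms False by simp
  then have "F1 * F1 \<le> (F1 / 2 + F0 * F2 / F1) * F1" using assms by (intro mult_right_mono) auto
  also have "\<dots> = F1 * F1 / 2 + F0 * F2" using assms by (simp add: distrib_right)
  finally show ?thesis by (simp add: power2_eq_square)
qed

section \<open>Suprema of \<open>f\<close> and of its derivatives\<close>

lemma bounded_rangeE: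
  assumes "bounded (range g)" obtains B where "\<And>y. norm (g y) \<le> B"
  using assms unfolding bounded_iff by auto

lemma abs_le_norm0:
  fixes f :: "real^'d \<Rightarrow> real^'h^'d"
  assumes "bounded (range f)"
  shows "\<bar>f y $ i $ j\<bar> \<le> norm0 f"
proof -
  obtain B where B: "\<And>y. norm (f y) \<le> B" using bounded_rangeE[OF assms] by blast
  have fin: "finite {\<bar>f y $ i $ j\<bar> | i j. True}" for y
    by (rule finite_subset[of _ "(\<lambda>(i,j). \<bar>f y $ i $ j\<bar>) ` UNIV"]) auto
  have "\<bar>f y $ i $ j\<bar> \<le> B" for y i j
    using B[of y] component_le_norm_cart[of "f y $ i" j] Finite_Cartesian_Product.norm_nth_le[of "f y" i] by linarith
  then have "mabs (f y) \<le> B" for y unfolding mabs_def using fin by (subst Max_le_iff) auto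
  then have "bdd_above (range (\<lambda>y. mabs (f y)))" by (intro bdd_aboveI2[of _ _ B])
  then have "mabs (f y) \<le> norm0 f" unfolding norm0_def by (rule cSUP_upper2) auto
  moreover have "\<bar>f y $ i $ j\<bar> \<le> mabs (f y)" unfolding mabs_def using fin by (intro Max_ge) auto
  ultimately show ?thesis by linarith
qed

lemma
  fixes f :: "real^'d \<Rightarrow> real^'h^'d"
  assumes "\<And>i j k. bounded (range (pd (\<lambda>z. f z $ i $ j) k))"
  shows abs_le_norm1: "\<bar>pd (\<lambda>z. f z $ i $ j) k y\<bar> \<le> norm1 f"
    and norm1_leI: "(\<And>i j k y. \<bar>pd (\<lambda>z. f z $ i $ j) k y\<bar> \<le> c) \<Longrightarrow> norm1 f \<le> c"
proof -
  let ?A = "\<lambda>y. {\<bar>pd (\<lambda>z. f z $ i $ j) k y\<bar> | i j k. True}"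
  have fin: "finite (?A y)" for y
    by (rule finite_subset[of _ "(\<lambda>(i,j,k). \<bar>pd (\<lambda>z. f z $ i $ j) k y\<bar>) ` UNIV"]) (auto simp: image_iff, blast)
  have ne: "?A y \<noteq> {}" for y by blast
  obtain B where B: "\<And>i j k y. \<bar>pd (\<lambda>z. f z $ i $ j) k y\<bar> \<le> B i j k"
    using assms unfolding bounded_iff by (simp add: real_norm_def) metis
  define B0 where "B0 = Max (range (\<lambda>(i,j,k). B i j k))"
  have "B i j k \<le> B0" for i j k unfolding B0_def by (rule Max_ge) (auto intro!: range_eqI[of _ _ "(i,j,k)"])
  then have B0: "\<bar>pd (\<lambda>z. f z $ i $ j) k y\<bar> \<le> B0" for i j k y using B order_trans by blast
  have "Max (?A y) \<le> B0" for y using B0 by (subst Max_le_iff[OF fin ne]) auto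
  then have "bdd_above (range (\<lambda>y. Max (?A y)))" by (intro bdd_aboveI2[of _ _ B0])
  then have "Max (?A y) \<le> norm1 f" unfolding norm1_def by (rule cSUP_upper2) auto
  moreover have "\<bar>pd (\<lambda>z. f z $ i $ j) k y\<bar> \<le> Max (?A y)" using fin by (intro Max_ge) auto
  ultimately show "\<bar>pd (\<lambda>z. f z $ i $ j) k y\<bar> \<le> norm1 f" by linarith
  assume c: "\<And>i j k y. \<bar>pd (\<lambda>z. f z $ i $ j) k y\<bar> \<le> c"
  have "Max (?A y) \<le> c" for y using c by (subst Max_le_iff[OF fin ne]) auto
  then show "norm1 f \<le> c" unfolding norm1_def by (intro cSUP_least) auto
qed

lemma abs_le_norm2:
  fixes f :: "real^'d \<Rightarrow> real^'h^'d"
  assumes "\<And>i j k l. bounded (range (pd (pd (\<lambda>z. f z $ i $ j) k) l))"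
  shows "\<bar>pd (pd (\<lambda>z. f z $ i $ j) k) l y\<bar> \<le> norm2 f"
proof -
  let ?A = "\<lambda>y. {\<bar>pd (pd (\<lambda>z. f z $ i $ j) k) l y\<bar> | i j k l. True}"
  have fin: "finite (?A y)" for y
    by (rule finite_subset[of _ "(\<lambda>(i,j,k,l). \<bar>pd (pd (\<lambda>z. f z $ i $ j) k) l y\<bar>) ` UNIV"]) (auto simp: image_iff, blast)
  have ne: "?A y \<noteq> {}" for y by blast
  obtain B where B: "\<And>i j k l y. \<bar>pd (pd (\<lambda>z. f z $ i $ j) k) l y\<bar> \<le> B i j k l"
    using assms unfolding bounded_iff by (simp add: real_norm_def) metis
  define B0 where "B0 = Max (range (\<lambda>(i,j,k,l). B i j k l))"
  have "B i j k l \<le> B0" for i j k l unfolding B0_def by (rule Max_ge) (auto intro!: range_eqI[of _ _ "(i,j,k,l)"])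
  then have B0: "\<bar>pd (pd (\<lambda>z. f z $ i $ j) k) l y\<bar> \<le> B0" for i j k l y using B order_trans by blast
  have "Max (?A y) \<le> B0" for y using B0 by (subst Max_le_iff[OF fin ne]) auto
  then have "bdd_above (range (\<lambda>y. Max (?A y)))" by (intro bdd_aboveI2[of _ _ B0])
  then have "Max (?A y) \<le> norm2 f" unfolding norm2_def by (rule cSUP_upper2) auto
  moreover have "\<bar>pd (pd (\<lambda>z. f z $ i $ j) k) l y\<bar> \<le> Max (?A y)" using fin by (intro Max_ge) auto
  ultimately show ?thesis by linarith
qed

lemma norm1_square_le:
  fixes f :: "real^'d \<Rightarrow> real^'h^'d"
  assumes C2: "\<And>i j. C2 (\<lambda>z. f z $ i $ j)" and b0: "bounded (range f)"
    and b1: "\<And>i j k. bounded (range (pd (\<lambda>z. f z $ i $ j) k))"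
    and b2: "\<And>i j k l. bounded (range (pd (pd (\<lambda>z. f z $ i $ j) k) l))"
    and pos: "norm1 f > 0"
  shows "(norm1 f)\<^sup>2 \<le> 2 * (norm0 f * norm2 f)"
proof (rule landau_of_interpolation[OF pos])
  show "norm0 f \<ge> 0" using abs_le_norm0[OF b0, of undefined undefined undefined] by linarith
  show "norm2 f \<ge> 0" using abs_le_norm2[OF b2, of undefined undefined undefined undefined undefined] by linarith
  fix h :: real assume "h > 0"
  then show "norm1 f \<le> norm0 f / h + h * norm2 f / 2"
    using C2 by (intro norm1_leI[OF b1] landau_partial abs_le_norm0[OF b0] abs_le_norm2[OF b2]) (auto simp: C2_def)
qed

subsection \<open>Young integral equations\<close>

text \<open>Iterating \<open>c \<mapsto> A + \<rho> * c\<close> from the a priori constant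
  \<open>cs\<close> converges to the fixed point \<open>A / (1 - \<rho>)\<close>, so
  \<open>cs\<close> leaves no trace in the result. In every application the index is a pair of
  times.\<close>

lemma absorb_holder:
  fixes \<phi> \<psi> :: "'i \<Rightarrow> real"
  assumes \<rho>: "0 \<le> \<rho>" "\<rho> < 1" and A: "A \<ge> 0" and cs: "cs \<ge> 0" "\<And>i. i \<in> I \<Longrightarrow> \<phi> i \<le> cs * \<psi> i"
    and psi: "\<And>i. i \<in> I \<Longrightarrow> \<psi> i \<ge> 0"
    and step: "\<And>c i. c \<ge> 0 \<Longrightarrow> (\<And>i. i \<in> I \<Longrightarrow> \<phi> i \<le> c * \<psi> i) \<Longrightarrow> i \<in> I \<Longrightarrow> \<phi> i \<le> (A + \<rho> * c) * \<psi> i"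
    and i: "i \<in> I"
  shows "\<phi> i \<le> A / (1 - \<rho>) * \<psi> i"
proof -
  define c where "c n = A / (1 - \<rho>) + \<rho> ^ n * cs" for n
  have c: "c n \<ge> 0" for n using \<rho> A cs by (simp add: c_def)
  have *: "i \<in> I \<Longrightarrow> \<phi> i \<le> c n * \<psi> i" for n i
  proof (induction n arbitrary: i)
    case 0
    have "cs * \<psi> i \<le> c 0 * \<psi> i" using psi[OF 0] A \<rho> by (intro mult_right_mono) (auto simp: c_def)
    then show ?case using cs(2)[OF 0] by linarith
  next
    case (Suc n)
    have "A + \<rho> * c n = c (Suc n)" using \<rho> by (simp add: c_def field_simps)
    then show ?case using step[OF c Suc.IH Suc.prems] by simp
  qed
  have "(\<lambda>n. c n * \<psi> i) \<longlonglongrightarrow> (A / (1 - \<rho>) + 0 * cs) * \<psi> i"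
    unfolding c_def using \<rho> by (intro tendsto_intros LIMSEQ_power_zero) auto
  then show ?thesis using *[OF i] by (intro LIMSEQ_le_const[of "\<lambda>n. c n * \<psi> i"]) auto
qed

section \<open>Fine partitions and their concatenation\<close>

lemma exists_fine_partition:
  assumes "a \<le> b" "\<delta> > 0"
  shows "\<exists>p m. is_partition p m a b \<and> mesh p m < \<delta>"
proof (cases "a = b")
  case True
  then have "is_partition (\<lambda>_. a) 0 a b \<and> mesh (\<lambda>_. a) 0 < \<delta>"
    using assms by (simp add: is_partition_def mesh_def)
  then show ?thesis by blast
next
  case False
  then have ab: "a < b" using assms by simp
  obtain m :: nat where m: "(b - a) / \<delta> < m" using reals_Archimedean2 by blast
  have m0: "real m > 0" using m ab assms by (smt (verit) divide_pos_pos)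
  define p where "p i = a + real i * ((b - a) / m)" for i :: nat
  have d: "p (Suc i) - p i = (b - a) / m" for i unfolding p_def by (simp add: distrib_right add_divide_distrib)
  have pos: "(b - a) / m > 0" using ab m0 by simp
  have "is_partition p m a b" unfolding is_partition_def
  proof (intro conjI allI impI)
    fix i show "p i < p (Suc i)" using d[of i] pos by linarith
  qed (use m0 in \<open>auto simp: p_def\<close>)
  moreover have "(b - a) / m < \<delta>" using m m0 assms by (simp add: field_simps)
  then have "mesh p m < \<delta>" unfolding mesh_def d using assms pos by (subst Max_less_iff) auto
  ultimately show ?thesis by blast
qed

definition append_partition :: "(nat \<Rightarrow> real) \<Rightarrow> nat \<Rightarrow> (nat \<Rightarrow> real) \<Rightarrow> nat \<Rightarrow> real" where
  "append_partition p m q i = (if i \<le> m then p i else q (i - m))"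

lemma append_partition_shift:
  assumes "p m = q 0" shows "append_partition p m q (m + i) = q i"
  using assms by (cases i) (auto simp: append_partition_def)

lemma sum_append_partition:
  assumes "p m = q 0"
  shows "(\<Sum>i<m+l. g (append_partition p m q i) (append_partition p m q (Suc i)))
    = (\<Sum>i<m. g (p i) (p (Suc i))) + (\<Sum>i<l. g (q i) (q (Suc i)))"
proof -
  let ?r = "append_partition p m q"
  have "(\<Sum>i<m+l. g (?r i) (?r (Suc i))) = (\<Sum>i<m. g (?r i) (?r (Suc i))) + (\<Sum>i<l. g (?r (m + i)) (?r (m + Suc i)))"
    by (induction l) (simp_all add: add.assoc)
  also have "(\<Sum>i<m. g (?r i) (?r (Suc i))) = (\<Sum>i<m. g (p i) (p (Suc i)))"
    by (intro sum.cong) (auto simp: append_partition_def)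
  finally show ?thesis by (simp only: append_partition_shift[of p m q, OF assms])
qed

lemma append_partition_step:
  assumes "p m = q 0" "i < m + l"
  obtains j where "j < m" "append_partition p m q i = p j" "append_partition p m q (Suc i) = p (Suc j)"
   | j where "j < l" "append_partition p m q i = q j" "append_partition p m q (Suc i) = q (Suc j)"
proof (cases "i < m")
  case True
  then show ?thesis using that(1)[of i] by (simp add: append_partition_def)
next
  case False
  then show ?thesis
    using that(2)[of "i - m"] append_partition_shift[of p m q, OF assms(1), of "i - m"]
      append_partition_shift[of p m q, OF assms(1), of "Suc (i - m)"] assms(2) by (simp add: Suc_diff_le)
qed

lemma is_partition_append:
  assumes p: "is_partition p m a b" and q: "is_partition q l b c"
  shows "is_partition (append_partition p m q) (m + l) a c"
proof -
  have pq: "p m = q 0" using p q by (simp add: is_partition_def)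
  have "append_partition p m q i < append_partition p m q (Suc i)" if "i < m + l" for i
    using pq that by (rule append_partition_step) (use p q in \<open>auto simp: is_partition_def\<close>)
  then show ?thesis using append_partition_shift[of p m q, OF pq, of l] p q
    by (auto simp: is_partition_def append_partition_def)
qed

lemma mesh_less_iff: "\<delta> > 0 \<Longrightarrow> mesh p m < \<delta> \<longleftrightarrow> (\<forall>i<m. p (Suc i) - p i < \<delta>)"
  unfolding mesh_def by (subst Max_less_iff) auto

lemma mesh_append:
  assumes p: "is_partition p m a b" "mesh p m < \<delta>" and q: "is_partition q l b c" "mesh q l < \<delta>" and d: "\<delta> > 0"
  shows "mesh (append_partition p m q) (m + l) < \<delta>"
  unfolding mesh_less_iff[OF d]
proof (intro allI impI)
  have pq: "p m = q 0" using p q by (simp add: is_partition_def)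
  fix i assume "i < m + l"
  with pq show "append_partition p m q (Suc i) - append_partition p m q i < \<delta>"
    by (rule append_partition_step) (use p(2) q(2) in \<open>auto simp: mesh_less_iff[OF d]\<close>)
qed

text \<open>Any partition of \<open>{s..t}\<close> extends to one of \<open>{a..b}\<close>, and the
  added terms are nonnegative.\<close>

lemma subinterval_variation:
  fixes g :: "real \<Rightarrow> real \<Rightarrow> real"
  assumes M: "\<And>p m. is_partition p m a b \<Longrightarrow> (\<Sum>i<m. g (p i) (p (Suc i))) \<le> M"
    and g: "\<And>s t. g s t \<ge> 0" and st: "a \<le> s" "t \<le> b" and p: "is_partition p m s t"
  shows "(\<Sum>i<m. g (p i) (p (Suc i))) \<le> M"
proof -
  obtain p1 m1 where p1: "is_partition p1 m1 a s" using exists_fine_partition[OF st(1), of 1] by auto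
  obtain p2 m2 where p2: "is_partition p2 m2 t b" using exists_fine_partition[OF st(2), of 1] by auto
  let ?q = "append_partition p1 m1 p"
  have q: "is_partition ?q (m1 + m) a t" by (rule is_partition_append[OF p1 p])
  have "(\<Sum>i<m. g (p i) (p (Suc i))) \<le> (\<Sum>i<m1 + m. g (?q i) (?q (Suc i)))"
    using p1 p g by (subst sum_append_partition) (auto simp: is_partition_def intro!: sum_nonneg)
  also have "\<dots> \<le> (\<Sum>i<m1 + m + m2. g (append_partition ?q (m1 + m) p2 i) (append_partition ?q (m1 + m) p2 (Suc i)))"
    using q p2 g by (subst sum_append_partition) (auto simp: is_partition_def intro!: sum_nonneg)
  also have "\<dots> \<le> M" by (rule M[OF is_partition_append[OF q p2]])
  finally show ?thesis .
qed

lemma young_sum_component: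
  "(young_sum V U p m - V s *v (U t - U s)) $ i
    = (\<Sum>j\<in>UNIV. riemann_sum (\<lambda>t. V t $ i $ j) (\<lambda>t. U t $ j) p m - V s $ i $ j * (U t $ j - U s $ j))"
proof -
  have "(young_sum V U p m - V s *v (U t - U s)) $ i
     = (\<Sum>k<m. \<Sum>j\<in>UNIV. V (p k) $ i $ j * (U (p (Suc k)) $ j - U (p k) $ j)) - (\<Sum>j\<in>UNIV. V s $ i $ j * (U t $ j - U s $ j))"
    by (simp add: young_sum_def matrix_vector_mult_def)
  also have "\<dots> = (\<Sum>j\<in>UNIV. riemann_sum (\<lambda>t. V t $ i $ j) (\<lambda>t. U t $ j) p m - V s $ i $ j * (U t $ j - U s $ j))"
    by (subst sum.swap) (simp add: riemann_sum_def sum_subtractf)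
  finally show ?thesis .
qed

text \<open>Condenses the regularity of \<open>f\<close> into \<open>f0\<close>, \<open>f1\<close>
  and \<open>f2\<close>, so that derivatives no longer occur. \<open>F0\<close>, \<open>F1\<close>
  and \<open>F2\<close> will be the suprema of \<open>f\<close> and of its first and second
  derivatives.\<close>

locale young_ode =
  fixes f :: "real^'d \<Rightarrow> real^'h^'d" and x :: "real \<Rightarrow> real^'h" and \<alpha> C F0 F1 F2 :: real
  assumes al: "1/2 < \<alpha>" "\<alpha> \<le> 1" and C: "C > 0" and F: "F0 \<ge> 0" "F1 > 0" "F2 \<ge> 0"
    and hoelder: "\<And>s t. s \<in> {0..1} \<Longrightarrow> t \<in> {0..1} \<Longrightarrow> s \<le> t \<Longrightarrow> vabs (x t - x s) \<le> C * (t - s) powr \<alpha>"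
    and f0: "\<And>z i j. \<bar>f z $ i $ j\<bar> \<le> F0"
    and f1: "\<And>z z' i j. \<bar>f z' $ i $ j - f z $ i $ j\<bar> \<le> CARD('d) * (F1 * vabs (z' - z))"
    and f2: "\<And>u u' v v' w i j. vabs (v - u) \<le> w \<Longrightarrow> vabs (v' - u') \<le> w \<Longrightarrow>
      \<bar>(f v' $ i $ j - f v $ i $ j) - (f u' $ i $ j - f u $ i $ j)\<bar>
       \<le> CARD('d) * (F1 * vabs ((v' - v) - (u' - u))) + CARD('d) * (CARD('d) * (F2 * w) * vabs (u' - u))"
begin

definition "z2 = zeta_sum (2 * \<alpha>)"
definition "a = CARD('h) * C * CARD('d) * F1"
definition "\<phi>0 = CARD('h) * F0 * C"
text \<open>Coefficient of the second derivative term when solution and scheme have Hoelder constant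
  \<open>\<phi>0\<close>; a block with constant \<open>\<phi>0 / D\<close> gets
  \<open>Q / D\<close>.\<close>

definition "Q = CARD('h) * C * (CARD('d) * (CARD('d) * (F2 * \<phi>0)))"

lemma z2_ge: "z2 \<ge> 1" "z2 \<ge> 1 / (2 * \<alpha> - 1)"
  unfolding z2_def using al zeta_sum_ge_1[of "2 * \<alpha>"] zeta_sum_lower[of "2 * \<alpha>"] by auto

lemma a_pos: "a > 0" unfolding a_def using C F by simp

lemma \<phi>0_nonneg: "\<phi>0 \<ge> 0" unfolding \<phi>0_def using C F by simp

lemma young_sum_bound:
  assumes T: "T \<subseteq> {0..1}" and c: "c \<ge> 0" and st: "s \<le> t"
    and V: "\<And>s' t' i j. s' \<in> T \<Longrightarrow> t' \<in> T \<Longrightarrow> s \<le> s' \<Longrightarrow> s' \<le> t' \<Longrightarrow> t' \<le> t \<Longrightarrow>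
      \<bar>V t' $ i $ j - V s' $ i $ j\<bar> \<le> c * (t' - s') powr \<alpha>"
    and p: "is_partition p m s t" "p ` {..m} \<subseteq> T"
  shows "vabs (young_sum V x p m - V s *v (x t - x s)) \<le> CARD('h) * (z2 * c * C * (t - s) powr (2 * \<alpha>))"
proof (rule vabs_leI)
  fix i
  have "(young_sum V x p m - V s *v (x t - x s)) $ i
           = (\<Sum>j\<in>UNIV. riemann_sum (\<lambda>t. V t $ i $ j) (\<lambda>t. x t $ j) p m - V s $ i $ j * (x t $ j - x s $ j))"
          by (rule young_sum_component)
        also have "\<bar>\<dots>\<bar> \<le> (\<Sum>j\<in>(UNIV::'h set). z2 * c * C * (t - s) powr (2 * \<alpha>))"
  proof (intro order_trans[OF sum_abs] sum_mono)
    fix j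
    have "\<bar>x t' $ j - x s' $ j\<bar> \<le> C * (t' - s') powr \<alpha>" if "s' \<in> T" "t' \<in> T" "s' \<le> t'" for s' t'
      using hoelder[of s' t'] component_le_vabs[of "x t' - x s'" j] that T by (auto simp: subset_iff)
    then show "\<bar>riemann_sum (\<lambda>t. V t $ i $ j) (\<lambda>t. x t $ j) p m - V s $ i $ j * (x t $ j - x s $ j)\<bar> \<le> z2 * c * C * (t - s) powr (2 * \<alpha>)"
      unfolding z2_def using al c C st V p by (intro young_holder[where T = T]) auto
  qed
  finally show "\<bar>(young_sum V x p m - V s *v (x t - x s)) $ i\<bar> \<le> CARD('h) * (z2 * c * C * (t - s) powr (2 * \<alpha>))"
    by simp
qed

definition holder_on :: "(real \<Rightarrow> real^'d) \<Rightarrow> real set \<Rightarrow> real \<Rightarrow> bool" where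
  "holder_on y T c \<longleftrightarrow> (\<forall>s\<in>T. \<forall>t\<in>T. s \<le> t \<longrightarrow> vabs (y t - y s) \<le> c * (t - s) powr \<alpha>)"

text \<open>All that the regularity of the exact solution and of the Euler scheme depends on. The a priori
  finite Hoelder constant is qualitative; it only makes the absorption possible.\<close>
definition young_solution :: "(real \<Rightarrow> real^'d) \<Rightarrow> real set \<Rightarrow> bool" where
  "young_solution y T \<longleftrightarrow> T \<subseteq> {0..1} \<and> (\<exists>c\<ge>0. holder_on y T c) \<and>
    (\<forall>s\<in>T. \<forall>t\<in>T. \<forall>c\<ge>0. s \<le> t \<longrightarrow> holder_on y (T \<inter> {s..t}) c \<longrightarrow>
      vabs (y t - y s - f (y s) *v (x t - x s)) \<le> z2 * a * c * (t - s) powr (2 * \<alpha>))"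

lemma matrix_increment:
  assumes "s \<in> {0..1}" "t \<in> {0..1}" "s \<le> t" "\<And>i j. \<bar>A $ i $ j\<bar> \<le> B"
  shows "vabs ((A::real^'h^'d) *v (x t - x s)) \<le> CARD('h) * C * B * (t - s) powr \<alpha>"
proof -
  have "B \<ge> 0" using assms(4)[of undefined undefined] by linarith
  then have "vabs (A *v (x t - x s)) \<le> CARD('h) * (B * (C * (t - s) powr \<alpha>))"
    using hoelder assms by (intro order_trans[OF vabs_matrix_vector_mult[OF assms(4)]] mult_left_mono) auto
  then show ?thesis by (simp add: mult_ac)
qed

lemma powr_double_le:
  assumes "0 \<le> d" "d \<le> l" shows "d powr (2 * \<alpha>) \<le> l powr \<alpha> * d powr \<alpha>"
proof -
  have "d powr (2 * \<alpha>) = d powr \<alpha> * d powr \<alpha>" by (simp add: powr_add[symmetric])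
  also have "\<dots> \<le> l powr \<alpha> * d powr \<alpha>" using assms al by (intro mult_right_mono powr_mono2) auto
  finally show ?thesis .
qed

lemma local_holder:
  assumes y: "young_solution y T" and diam: "\<And>s t. s \<in> T \<Longrightarrow> t \<in> T \<Longrightarrow> t - s \<le> l"
    and D: "z2 * a * l powr \<alpha> < 1"
  shows "holder_on y T (\<phi>0 / (1 - z2 * a * l powr \<alpha>))"
proof -
  have T: "T \<subseteq> {0..1}" using y by (simp add: young_solution_def)
  obtain cs where cs: "cs \<ge> 0" "holder_on y T cs" using y by (auto simp: young_solution_def)
  define I where "I = {(s, t). s \<in> T \<and> t \<in> T \<and> s \<le> t}"
  have "vabs (y t - y s) \<le> \<phi>0 / (1 - z2 * a * l powr \<alpha>) * (t - s) powr \<alpha>" if st: "s \<in> T" "t \<in> T" "s \<le> t" for s t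
  proof -
    have "(\<lambda>(s, t). vabs (y t - y s)) (s, t) \<le> \<phi>0 / (1 - z2 * a * l powr \<alpha>) * (\<lambda>(s, t). (t - s) powr \<alpha>) (s, t)"
    proof (rule absorb_holder[where I = I and cs = cs, OF _ D \<phi>0_nonneg cs(1)])
      show "z2 * a * l powr \<alpha> \<ge> 0" using z2_ge a_pos by simp
      show "(s, t) \<in> I" using st by (simp add: I_def)
      fix c :: real and i
      assume c: "c \<ge> 0" and H: "\<And>i. i \<in> I \<Longrightarrow> (case i of (s, t) \<Rightarrow> vabs (y t - y s)) \<le> c * (case i of (s, t) \<Rightarrow> (t - s) powr \<alpha>)"
        and "i \<in> I"
      then obtain s t where i: "i = (s, t)" "s \<in> T" "t \<in> T" "s \<le> t" by (auto simp: I_def)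
      have "holder_on y (T \<inter> {s..t}) c" using H unfolding holder_on_def I_def by auto
      then have "vabs (y t - y s - f (y s) *v (x t - x s)) \<le> z2 * a * c * (t - s) powr (2 * \<alpha>)"
        using y i c by (simp add: young_solution_def)
      also have "\<dots> \<le> z2 * a * c * (l powr \<alpha> * (t - s) powr \<alpha>)"
        using c z2_ge a_pos i diam by (intro mult_left_mono powr_double_le) auto
      finally have 1: "vabs (y t - y s - f (y s) *v (x t - x s)) \<le> z2 * a * c * (l powr \<alpha> * (t - s) powr \<alpha>)" .
      have 2: "vabs (f (y s) *v (x t - x s)) \<le> \<phi>0 * (t - s) powr \<alpha>"
        using matrix_increment[of s t "f (y s)" F0] f0 i T by (auto simp: \<phi>0_def mult_ac subset_iff)
      have "vabs (y t - y s) \<le> vabs (y t - y s - f (y s) *v (x t - x s)) + vabs (f (y s) *v (x t - x s))"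
        using vabs_triangle[of "y t - y s - f (y s) *v (x t - x s)" "f (y s) *v (x t - x s)"] by simp
      also have "\<dots> \<le> (\<phi>0 + z2 * a * l powr \<alpha> * c) * (t - s) powr \<alpha>" using 1 2 by (simp add: algebra_simps)
      finally show "(case i of (s, t) \<Rightarrow> vabs (y t - y s)) \<le> (\<phi>0 + z2 * a * l powr \<alpha> * c) * (case i of (s, t) \<Rightarrow> (t - s) powr \<alpha>)"
        by (simp add: i)
    qed (use cs(2) in \<open>auto simp: I_def holder_on_def\<close>)
    then show ?thesis by simp
  qed
  then show ?thesis by (simp add: holder_on_def)
qed

section \<open>Passage from Riemann sums to the solution\<close>

lemma riemann_sums_converge:
  assumes sol: "\<And>t. t \<in> {0..1} \<Longrightarrow> has_young_integral (\<lambda>s. f (y s)) x 0 t (y t - y0)"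
    and st: "0 \<le> s" "s \<le> t" "t \<le> 1" and e: "e > 0"
  shows "\<exists>p m. is_partition p m s t \<and> vabs (young_sum (\<lambda>s. f (y s)) x p m - (y t - y s)) < e"
proof -
  let ?Y = "young_sum (\<lambda>s. f (y s)) x"
  have h1: "has_young_integral (\<lambda>s. f (y s)) x 0 t (y t - y0)" and h2: "has_young_integral (\<lambda>s. f (y s)) x 0 s (y s - y0)"
    using sol st by auto
  from h1[unfolded has_young_integral_def, THEN spec, THEN mp, OF half_gt_zero[OF e]]
  obtain \<delta>1 where d1: "\<delta>1 > 0"
    "\<And>p m. is_partition p m 0 t \<Longrightarrow> mesh p m < \<delta>1 \<Longrightarrow> vabs (?Y p m - (y t - y0)) < e/2"
    by auto
  from h2[unfolded has_young_integral_def, THEN spec, THEN mp, OF half_gt_zero[OF e]]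
  obtain \<delta>2 where d2: "\<delta>2 > 0"
    "\<And>p m. is_partition p m 0 s \<Longrightarrow> mesh p m < \<delta>2 \<Longrightarrow> vabs (?Y p m - (y s - y0)) < e/2"
    by auto
  define \<delta> where "\<delta> = min \<delta>1 \<delta>2"
  have d: "\<delta> > 0" using d1 d2 by (simp add: \<delta>_def)
  \<comment> \<open>Only integrals starting at 0 are given; additivity at \<open>s\<close> comes
    from concatenating fine partitions of \<open>{0..s}\<close> and \<open>{s..t}\<close>.\<close>
  obtain p m where p: "is_partition p m 0 s" "mesh p m < \<delta>" using exists_fine_partition[OF st(1) d] by blast
  obtain q l where q: "is_partition q l s t" "mesh q l < \<delta>" using exists_fine_partition[OF st(2) d] by blast
  have "p m = q 0" using p q by (simp add: is_partition_def)
  then have Y: "?Y (append_partition p m q) (m + l) = ?Y p m + ?Y q l"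
    unfolding young_sum_def by (rule sum_append_partition)
  have "vabs (?Y (append_partition p m q) (m + l) - (y t - y0)) < e/2"
    using mesh_append[OF p q d] by (intro d1 is_partition_append[OF p(1) q(1)]) (simp add: \<delta>_def)
  moreover have "vabs (?Y p m - (y s - y0)) < e/2" using p by (intro d2) (auto simp: \<delta>_def)
  moreover have "?Y q l - (y t - y s) = (?Y (append_partition p m q) (m + l) - (y t - y0)) - (?Y p m - (y s - y0))"
    unfolding Y by simp
  then have "vabs (?Y q l - (y t - y s)) \<le> vabs (?Y (append_partition p m q) (m + l) - (y t - y0)) + vabs (?Y p m - (y s - y0))"
    by (metis vabs_triangle_sub)
  ultimately have "vabs (?Y q l - (y t - y s)) < e" by linarith
  then show ?thesis using q by blast
qed

lemma increment_le_of_riemann_sums: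
  assumes sol: "\<And>t. t \<in> {0..1} \<Longrightarrow> has_young_integral (\<lambda>s. f (y s)) x 0 t (y t - y0)"
    and st: "0 \<le> s" "s \<le> t" "t \<le> 1"
    and B: "\<And>p m. is_partition p m s t \<Longrightarrow> vabs (young_sum (\<lambda>s. f (y s)) x p m - w) \<le> B"
  shows "vabs (y t - y s - w) \<le> B"
proof (rule field_le_epsilon)
  fix e :: real assume "e > 0"
  then obtain p m where p: "is_partition p m s t" "vabs (young_sum (\<lambda>s. f (y s)) x p m - (y t - y s)) < e"
    using riemann_sums_converge[OF sol st] by blast
  have "y t - y s - w = (young_sum (\<lambda>s. f (y s)) x p m - w) - (young_sum (\<lambda>s. f (y s)) x p m - (y t - y s))" by simp
  then have "vabs (y t - y s - w) \<le> vabs (young_sum (\<lambda>s. f (y s)) x p m - w) + vabs (young_sum (\<lambda>s. f (y s)) x p m - (y t - y s))"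
    by (metis vabs_triangle_sub)
  then show "vabs (y t - y s - w) \<le> B + e" using B[OF p(1)] p(2) by linarith
qed

lemma partition_subset:
  assumes "is_partition p m s t" shows "p ` {..m} \<subseteq> {s..t}"
  using is_partition_range[OF assms] by auto

text \<open>\<open>f (y s)\<close> inherits finite \<open>q\<close>-variation, and \<open>x\<close>
  has \<open>1/\<alpha>\<close>-variation of order \<open>t - s\<close> on \<open>{s..t}\<close>.
  The Young estimate with exponents \<open>1/q\<close> and \<open>\<alpha>\<close> therefore retains
  the factor \<open>(t - s) powr \<alpha>\<close>, a Hoelder bound for \<open>y\<close> whose
  constant disappears on absorption.\<close>

lemma solution_apriori:
  assumes sol: "\<And>t. t \<in> {0..1} \<Longrightarrow> has_young_integral (\<lambda>s. f (y s)) x 0 t (y t - y0)"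
    and q: "q \<ge> 1" "1 / q + \<alpha> > 1" "finite_pvar q y 0 1"
  shows "\<exists>c\<ge>0. holder_on y {0..1} c"
proof -
  obtain M where M: "\<And>p m. is_partition p m 0 1 \<Longrightarrow> (\<Sum>i<m. vabs (y (p (Suc i)) - y (p i)) powr q) \<le> M"
    using q(3) unfolding finite_pvar_def by blast
  define A where "A = (CARD('d) * F1) powr q * M"
  define k where "k = A powr (1/q) * C * zeta_sum (1/q + \<alpha>)"
  have "M \<ge> 0"
  proof -
    obtain p m where "is_partition p m 0 1" using exists_fine_partition[of 0 1 1] by auto
    from M[OF this] show ?thesis by (rule order_trans[rotated]) (simp add: sum_nonneg)
  qed
  then have k0: "k \<ge> 0" unfolding k_def A_def using C zeta_sum_ge_1[OF q(2)] by simp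
  have "vabs (y t - y s) \<le> (\<phi>0 + CARD('h) * k) * (t - s) powr \<alpha>" if st: "0 \<le> s" "s \<le> t" "t \<le> 1" for s t
  proof -
    have "vabs (y t - y s - f (y s) *v (x t - x s)) \<le> CARD('h) * (k * (t - s) powr \<alpha>)"
    proof (rule increment_le_of_riemann_sums[OF sol st], assumption)
      fix p m assume p: "is_partition p m s t"
      show "vabs (young_sum (\<lambda>s. f (y s)) x p m - f (y s) *v (x t - x s)) \<le> CARD('h) * (k * (t - s) powr \<alpha>)"
      proof (rule vabs_leI)
        fix i
        have "(young_sum (\<lambda>s. f (y s)) x p m - f (y s) *v (x t - x s)) $ i
           = (\<Sum>j\<in>UNIV. riemann_sum (\<lambda>t. f (y t) $ i $ j) (\<lambda>t. x t $ j) p m - f (y s) $ i $ j * (x t $ j - x s $ j))"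
          by (rule young_sum_component)
        also have "\<bar>\<dots>\<bar> \<le> (\<Sum>j\<in>(UNIV::'h set). k * (t - s) powr \<alpha>)"
        proof (intro order_trans[OF sum_abs] sum_mono)
          fix j
          have bx: "\<bar>x t' $ j - x s' $ j\<bar> \<le> C * (t' - s') powr \<alpha>" if "s \<le> s'" "s' \<le> t'" "t' \<le> t" for s' t'
            using hoelder[of s' t'] component_le_vabs[of "x t' - x s'" j] that st by auto
          have "\<bar>riemann_sum (\<lambda>t. f (y t) $ i $ j) (\<lambda>t. x t $ j) p m - f (y s) $ i $ j * (x t $ j - x s $ j)\<bar>
            \<le> A powr (1/q) * (C powr (1/\<alpha>) * (t - s)) powr \<alpha> * zeta_sum (1/q + \<alpha>)"
          proof (rule young_estimate[where T = UNIV])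
            fix p m assume p: "is_partition p m s t"
            have "(\<Sum>k<m. \<bar>f (y (p (Suc k))) $ i $ j - f (y (p k)) $ i $ j\<bar> powr (1 / (1/q)))
               \<le> (\<Sum>k<m. (CARD('d) * F1) powr q * vabs (y (p (Suc k)) - y (p k)) powr q)"
            proof (rule sum_mono)
              fix k
              have "\<bar>f (y (p (Suc k))) $ i $ j - f (y (p k)) $ i $ j\<bar> powr q \<le> (CARD('d) * (F1 * vabs (y (p (Suc k)) - y (p k)))) powr q"
                using f1 q by (intro powr_mono2) auto
              also have "\<dots> = (CARD('d) * F1) powr q * vabs (y (p (Suc k)) - y (p k)) powr q"
                using F by (simp add: powr_mult)
              finally show "\<bar>f (y (p (Suc k))) $ i $ j - f (y (p k)) $ i $ j\<bar> powr (1 / (1/q)) \<le> (CARD('d) * F1) powr q * vabs (y (p (Suc k)) - y (p k)) powr q"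
                by simp
            qed
            also have "\<dots> = (CARD('d) * F1) powr q * (\<Sum>k<m. vabs (y (p (Suc k)) - y (p k)) powr q)"
              by (simp add: sum_distrib_left)
            \<comment> \<open>The variation over \<open>{s..t}\<close> is bounded by that over
              \<open>{0..1}\<close>, uniformly in \<open>s\<close> and \<open>t\<close>.\<close>
            also have "\<dots> \<le> A" unfolding A_def
              using subinterval_variation[of 0 1 "\<lambda>s t. vabs (y t - y s) powr q" M s t p m] M st p
              by (intro mult_left_mono) auto
            finally show "(\<Sum>k<m. \<bar>f (y (p (Suc k))) $ i $ j - f (y (p k)) $ i $ j\<bar> powr (1 / (1/q))) \<le> A" .
            show "(\<Sum>k<m. \<bar>x (p (Suc k)) $ j - x (p k) $ j\<bar> powr (1/\<alpha>)) \<le> C powr (1/\<alpha>) * (t - s)"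
              using holder_imp_variation[of \<alpha> C UNIV s t "\<lambda>t. x t $ j" p m] al C bx p by auto
          qed (use al q p in auto)
          also have "\<dots> = k * (t - s) powr \<alpha>" unfolding k_def using al C st by (simp add: powr_mult powr_powr)
          finally show "\<bar>riemann_sum (\<lambda>t. f (y t) $ i $ j) (\<lambda>t. x t $ j) p m - f (y s) $ i $ j * (x t $ j - x s $ j)\<bar> \<le> k * (t - s) powr \<alpha>" .
        qed
        finally show "\<bar>(young_sum (\<lambda>s. f (y s)) x p m - f (y s) *v (x t - x s)) $ i\<bar> \<le> CARD('h) * (k * (t - s) powr \<alpha>)" by simp
      qed
    qed
    moreover have "vabs (f (y s) *v (x t - x s)) \<le> \<phi>0 * (t - s) powr \<alpha>"
      using matrix_increment[of s t "f (y s)" F0] f0 st by (simp add: \<phi>0_def mult_ac)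
    moreover have "vabs (y t - y s) \<le> vabs (y t - y s - f (y s) *v (x t - x s)) + vabs (f (y s) *v (x t - x s))"
      using vabs_triangle[of "y t - y s - f (y s) *v (x t - x s)" "f (y s) *v (x t - x s)"] by simp
    ultimately show ?thesis by (simp add: algebra_simps)
  qed
  then have "holder_on y {0..1} (\<phi>0 + CARD('h) * k)" by (simp add: holder_on_def)
  moreover have "\<phi>0 + CARD('h) * k \<ge> 0" using k0 \<phi>0_nonneg by simp
  ultimately show ?thesis by blast
qed

lemma young_constant_eq: "CARD('h) * (z2 * (CARD('d) * F1 * c) * C * r) = z2 * a * c * r"
  by (simp add: a_def)

lemma exact_young_solution:
  assumes sol: "\<And>t. t \<in> {0..1} \<Longrightarrow> has_young_integral (\<lambda>s. f (y s)) x 0 t (y t - y0)"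
    and q: "q \<ge> 1" "1 / q + \<alpha> > 1" "finite_pvar q y 0 1" and ab: "0 \<le> l" "r \<le> 1"
  shows "young_solution y {l..r}"
  unfolding young_solution_def
proof (intro conjI ballI allI impI)
  show "\<exists>c\<ge>0. holder_on y {l..r} c"
    using solution_apriori[OF sol q] ab unfolding holder_on_def by (meson atLeastAtMost_iff order_trans)
  fix s t c assume st: "s \<in> {l..r}" "t \<in> {l..r}" "0 \<le> c" "s \<le> t" and H: "holder_on y ({l..r} \<inter> {s..t}) c"
  show "vabs (y t - y s - f (y s) *v (x t - x s)) \<le> z2 * a * c * (t - s) powr (2 * \<alpha>)"
  proof (rule increment_le_of_riemann_sums[OF sol], assumption)
    fix p m assume p: "is_partition p m s t"
    show "vabs (young_sum (\<lambda>s. f (y s)) x p m - f (y s) *v (x t - x s)) \<le> z2 * a * c * (t - s) powr (2 * \<alpha>)"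
      unfolding young_constant_eq[symmetric]
    proof (rule young_sum_bound[where T = "{s..t}", OF _ _ st(4) _ p partition_subset[OF p]])
      fix s' t' i j assume *: "s' \<in> {s..t}" "t' \<in> {s..t}" "s' \<le> t'"
      then have "vabs (y t' - y s') \<le> c * (t' - s') powr \<alpha>" using H st by (auto simp: holder_on_def)
      then have "CARD('d) * (F1 * vabs (y t' - y s')) \<le> CARD('d) * (F1 * (c * (t' - s') powr \<alpha>))"
        using F by (intro mult_left_mono) auto
      with f1[of "y t'" i j "y s'"] show "\<bar>f (y t') $ i $ j - f (y s') $ i $ j\<bar> \<le> CARD('d) * F1 * c * (t' - s') powr \<alpha>"
        by (simp add: mult_ac)
    qed (use st ab F in auto)
  qed (use st ab in auto)
qed (use ab in auto)

end

subsection \<open>The Euler scheme\<close>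

definition grid :: "nat \<Rightarrow> nat \<Rightarrow> nat \<Rightarrow> real set" where
  "grid n k l = (\<lambda>i. real i / 2 ^ n) ` {k..l}"

lemma euler_at_grid: "euler f x y0 n (real k / 2 ^ n) = euler_pts f x y0 n k"
  by (simp add: euler_def)

lemma grid_partition:
  assumes "k \<le> l"
  shows "is_partition (\<lambda>i. real (k + i) / 2 ^ n) (l - k) (real k / 2 ^ n) (real l / 2 ^ n)"
  using assms by (auto simp: is_partition_def divide_strict_right_mono)

lemma euler_increment:
  assumes "k \<le> l"
  shows "euler f x y0 n (real l / 2 ^ n) - euler f x y0 n (real k / 2 ^ n)
    = young_sum (\<lambda>t. f (euler f x y0 n t)) x (\<lambda>i. real (k + i) / 2 ^ n) (l - k)"
  unfolding euler_at_grid young_sum_def using assms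
proof (induction l rule: dec_induct)
  case (step l)
  then have "Suc l - k = Suc (l - k)" "k + (l - k) = l" by auto
  then show ?case using step.IH by (simp add: algebra_simps euler_at_grid del: of_nat_add)
qed simp

lemma vabs_three: "z = u + v - w \<Longrightarrow> vabs z \<le> vabs u + vabs v + vabs w"
  using vabs_triangle_sub[of "u + v" w] vabs_triangle[of u v] by simp

context young_ode
begin

section \<open>Regularity of the solution and of the scheme\<close>

abbreviation K :: real where "K \<equiv> 1 + z2"

text \<open>\<open>N\<close> is chosen so that \<open>z2 * a * l powr \<alpha> \<le> 1/2\<close> for
  \<open>l = 1 / N\<close>, which gives the Hoelder constant \<open>2 * \<phi>0\<close> on intervals
  of that length. A longer increment is cut into \<open>N\<close> equal pieces, and \<open>N * (d /
  N) powr \<alpha> = N powr (1 - \<alpha>) * d powr \<alpha>\<close> is the origin of the power of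
  \<open>N\<close> in \<open>G1s\<close>.\<close>

lemma global_holder:
  assumes y: "\<And>l r. 0 \<le> l \<Longrightarrow> r \<le> 1 \<Longrightarrow> young_solution y {l..r}"
    and N: "N = \<lceil>(2 * (K * a)) powr (1/\<alpha>)\<rceil>"
  shows "holder_on y {0..1} (2 * \<phi>0 * real_of_int N powr (1 - \<alpha>))" "N \<ge> 1"
proof -
  have K: "K \<ge> 1" using z2_ge by simp
  have pos: "(2 * (K * a)) powr (1/\<alpha>) > 0" using K a_pos by simp
  then show N1: "N \<ge> 1" unfolding N by (simp add: one_le_ceiling)
  define n where "n = nat N"
  have n: "real n = of_int N" "n > 0" using N1 by (auto simp: n_def)
  have "(2 * (K * a)) powr (1/\<alpha>) \<le> real n" unfolding n N by (rule le_of_int_ceiling)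
  then have "((2 * (K * a)) powr (1/\<alpha>)) powr \<alpha> \<le> real n powr \<alpha>" using al by (intro powr_mono2) auto
  then have nK: "2 * (K * a) \<le> real n powr \<alpha>" using K a_pos al by (simp add: powr_powr)
  define l where "l = 1 / real n"
  have "l powr \<alpha> = 1 / real n powr \<alpha>" unfolding l_def by (simp add: powr_divide)
  moreover have "2 * (z2 * a) \<le> real n powr \<alpha>" using nK a_pos by (simp add: algebra_simps)
  ultimately have half: "z2 * a * l powr \<alpha> \<le> 1/2" using n by (simp add: pos_divide_le_eq mult.commute)
  have loc: "vabs (y t - y s) \<le> 2 * \<phi>0 * (t - s) powr \<alpha>" if st: "0 \<le> s" "s \<le> t" "t \<le> 1" "t - s \<le> l" for s t
  proof -
    have "holder_on y {s..t} (\<phi>0 / (1 - z2 * a * l powr \<alpha>))"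
      using st half by (intro local_holder y) auto
    then have "vabs (y t - y s) \<le> \<phi>0 / (1 - z2 * a * l powr \<alpha>) * (t - s) powr \<alpha>"
      using st by (simp add: holder_on_def)
    also have "\<dots> \<le> \<phi>0 / (1/2) * (t - s) powr \<alpha>"
      using \<phi>0_nonneg half by (intro mult_right_mono divide_left_mono) auto
    finally show ?thesis by simp
  qed
  have "vabs (y t - y s) \<le> 2 * \<phi>0 * real_of_int N powr (1 - \<alpha>) * (t - s) powr \<alpha>" if st: "0 \<le> s" "s \<le> t" "t \<le> 1" for s t
  proof -
    define p where "p i = s + real i * ((t - s) / n)" for i :: nat
    have d: "p (Suc i) - p i = (t - s) / n" for i unfolding p_def by (simp add: distrib_right add_divide_distrib)
    have p0: "p 0 = s" "p n = t" using n by (auto simp: p_def)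
    have pr: "s \<le> p i" "p i \<le> t" if "i \<le> n" for i
    proof -
      show "s \<le> p i" unfolding p_def using st by simp
      have "real i * ((t - s) / n) \<le> real n * ((t - s) / n)" using st that by (intro mult_right_mono) auto
      then show "p i \<le> t" unfolding p_def using n by simp
    qed
    have dl: "0 \<le> (t - s) / n" "(t - s) / n \<le> l" unfolding l_def using st n by (auto simp: divide_right_mono)
    have "y t - y s = (\<Sum>i<n. y (p (Suc i)) - y (p i))"
      using sum_increments[of "\<lambda>i. y (p i)" n] p0 by simp
    then have "vabs (y t - y s) \<le> (\<Sum>i<n. vabs (y (p (Suc i)) - y (p i)))" by (simp only: vabs_sum)
    also have "\<dots> \<le> (\<Sum>i<n. 2 * \<phi>0 * ((t - s) / n) powr \<alpha>)"
    proof (rule sum_mono)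
      fix i assume i: "i \<in> {..<n}"
      have "p i \<le> p (Suc i)" "p (Suc i) - p i \<le> l" using d[of i] dl by linarith+
      moreover have "s \<le> p i" "p (Suc i) \<le> t" using pr[of i] pr[of "Suc i"] i by auto
      ultimately have "vabs (y (p (Suc i)) - y (p i)) \<le> 2 * \<phi>0 * (p (Suc i) - p i) powr \<alpha>"
        using st by (metis loc order_trans)
      then show "vabs (y (p (Suc i)) - y (p i)) \<le> 2 * \<phi>0 * ((t - s) / n) powr \<alpha>" unfolding d .
    qed
    also have "\<dots> = 2 * \<phi>0 * (real n * ((t - s) / n) powr \<alpha>)" by simp
    also have "real n * ((t - s) / n) powr \<alpha> = real n powr (1 - \<alpha>) * (t - s) powr \<alpha>"
      using n(2) st by (simp add: powr_divide powr_diff)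
    finally show ?thesis by (simp add: n mult_ac)
  qed
  then show "holder_on y {0..1} (2 * \<phi>0 * real_of_int N powr (1 - \<alpha>))" by (simp add: holder_on_def)
qed

lemma holder_on_subset: "holder_on y S c \<Longrightarrow> T \<subseteq> S \<Longrightarrow> holder_on y T c"
  unfolding holder_on_def by blast

lemma finite_holder:
  fixes y :: "real \<Rightarrow> real^'d"
  assumes "finite T" shows "\<exists>c\<ge>0. holder_on y T c"
proof -
  define c where "c = (\<Sum>(s, t)\<in>T \<times> T. vabs (y t - y s) / (t - s) powr \<alpha>)"
  have "vabs (y t - y s) \<le> c * (t - s) powr \<alpha>" if st: "s \<in> T" "t \<in> T" "s \<le> t" for s t
  proof (cases "s = t")
    case False
    have "(\<lambda>(s, t). vabs (y t - y s) / (t - s) powr \<alpha>) (s, t) \<le> c"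
      unfolding c_def using assms st by (intro member_le_sum) auto
    then show ?thesis using False st by (simp add: pos_divide_le_eq)
  qed simp
  moreover have "c \<ge> 0" unfolding c_def by (intro sum_nonneg) auto
  ultimately show ?thesis unfolding holder_on_def by blast
qed

lemma grid_subset: "l \<le> 2 ^ n \<Longrightarrow> grid n k l \<subseteq> {0..1}"
proof
  fix t assume l: "l \<le> 2 ^ n" and "t \<in> grid n k l"
  then obtain i where i: "t = real i / 2 ^ n" "i \<le> 2 ^ n" unfolding grid_def by auto
  then have "real i \<le> 2 ^ n" by (metis of_nat_le_iff of_nat_numeral of_nat_power)
  then show "t \<in> {0..1}" by (simp add: i pos_divide_le_eq)
qed

lemma grid_pair:
  assumes "s \<in> grid n k l" "t \<in> grid n k l" "s \<le> t"
  obtains i j where "s = real i / 2 ^ n" "t = real j / 2 ^ n" "k \<le> i" "i \<le> j" "j \<le> l"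
  using assms by (auto simp: grid_def divide_le_cancel)

lemma grid_points:
  assumes "k \<le> i" "i \<le> j" "j \<le> l"
  shows "(\<lambda>m. real (i + m) / 2 ^ n) ` {..j - i} \<subseteq> grid n k l"
  unfolding grid_def using assms by (auto simp del: of_nat_add)

text \<open>Increments of the scheme between grid points are exactly Riemann sums along the grid, so
  the Young estimate applies with \<open>T\<close> the grid and asks for Hoelder control at grid
  points only. The a priori constant comes from finiteness of the grid.\<close>

lemma euler_young_solution:
  assumes l: "l \<le> 2 ^ n"
  shows "young_solution (euler f x y0 n) (grid n k l)"
  unfolding young_solution_def
proof (intro conjI ballI allI impI grid_subset[OF l] finite_holder)
  show "finite (grid n k l)" by (simp add: grid_def)
  let ?Y = "euler f x y0 n" and ?T = "grid n k l"
  fix s t c assume st: "s \<in> ?T" "t \<in> ?T" "0 \<le> c" "s \<le> t" and H: "holder_on ?Y (?T \<inter> {s..t}) c"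
  obtain i j where ij: "s = real i / 2 ^ n" "t = real j / 2 ^ n" "k \<le> i" "i \<le> j" "j \<le> l"
    using grid_pair[OF st(1,2,4)] .
  show "vabs (?Y t - ?Y s - f (?Y s) *v (x t - x s)) \<le> z2 * a * c * (t - s) powr (2 * \<alpha>)"
    unfolding young_constant_eq[symmetric] ij(1,2) euler_increment[OF ij(4)]
  proof (rule young_sum_bound[where T = ?T, OF grid_subset[OF l] _ _ _ grid_partition[OF ij(4)] grid_points[OF ij(3-5)]])
    fix s' t' i' j' assume *: "s' \<in> ?T" "t' \<in> ?T" "real i / 2 ^ n \<le> s'" "s' \<le> t'" "t' \<le> real j / 2 ^ n"
    then have "vabs (?Y t' - ?Y s') \<le> c * (t' - s') powr \<alpha>" using H ij by (auto simp: holder_on_def)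
    then have "CARD('d) * (F1 * vabs (?Y t' - ?Y s')) \<le> CARD('d) * (F1 * (c * (t' - s') powr \<alpha>))"
      using F by (intro mult_left_mono) auto
    with f1[of "?Y t'" i' j' "?Y s'"] show "\<bar>f (?Y t') $ i' $ j' - f (?Y s') $ i' $ j'\<bar> \<le> CARD('d) * F1 * c * (t' - s') powr \<alpha>"
      by (simp add: mult_ac)
  qed (use st F ij in \<open>auto simp: divide_right_mono\<close>)
qed

section \<open>The error at grid points\<close>

lemma error_increment:
  assumes "i \<le> j"
  shows "(euler f x y0 n (real j / 2 ^ n) - y (real j / 2 ^ n)) - (euler f x y0 n (real i / 2 ^ n) - y (real i / 2 ^ n))
    = young_sum (\<lambda>t. f (euler f x y0 n t) - f (y t)) x (\<lambda>m. real (i + m) / 2 ^ n) (j - i)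
      - (\<Sum>m<j - i. y (real (i + Suc m) / 2 ^ n) - y (real (i + m) / 2 ^ n)
          - f (y (real (i + m) / 2 ^ n)) *v (x (real (i + Suc m) / 2 ^ n) - x (real (i + m) / 2 ^ n)))"
proof -
  have "(\<Sum>m<j - i. y (real (i + Suc m) / 2 ^ n) - y (real (i + m) / 2 ^ n)) = y (real j / 2 ^ n) - y (real i / 2 ^ n)"
    using sum_increments[of "\<lambda>m. y (real (i + m) / 2 ^ n)" "j - i"] assms by simp
  moreover have "euler f x y0 n (real j / 2 ^ n) - euler f x y0 n (real i / 2 ^ n)
    = young_sum (\<lambda>t. f (euler f x y0 n t)) x (\<lambda>m. real (i + m) / 2 ^ n) (j - i)"
    by (rule euler_increment[OF assms])
  ultimately show ?thesis
    unfolding young_sum_def matrix_vector_mult_diff_rdistrib sum_subtractf by (simp add: algebra_simps)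
qed

lemma error_block:
  assumes y: "\<And>l r. 0 \<le> l \<Longrightarrow> r \<le> 1 \<Longrightarrow> young_solution y {l..r}"
    and kl: "k < l" "l \<le> 2 ^ n" and len: "len = real (l - k) / 2 ^ n" and u: "u = len powr \<alpha>"
    and D: "D = 1 - z2 * a * u" "D > 0" and Y: "Y = euler f x y0 n"
    and S: "\<And>i. k \<le> i \<Longrightarrow> i \<le> l \<Longrightarrow> vabs (Y (real i / 2 ^ n) - y (real i / 2 ^ n)) \<le> S"
    and j: "k \<le> j" "j \<le> l"
  shows "vabs (Y (real j / 2 ^ n) - y (real j / 2 ^ n)) \<le> vabs (Y (real k / 2 ^ n) - y (real k / 2 ^ n))
    + (u * (a + z2 * (Q / D) * u) * S + z2 * a * \<phi>0 / D * (1 / 2 ^ n) powr (2 * \<alpha> - 1) * len) / D"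
proof -
  define T where "T = grid n k l"
  define w where "w = \<phi>0 / D"
  define E where "E t = Y t - y t" for t
  define \<Delta> where "\<Delta> = (1 / 2 ^ n :: real)"
  have \<Delta>: "\<Delta> > 0" "real i / 2 ^ n = real i * \<Delta>" for i by (auto simp: \<Delta>_def)
  have T01: "T \<subseteq> {0..1}" unfolding T_def by (rule grid_subset[OF kl(2)])
  have w: "w \<ge> 0" unfolding w_def using \<phi>0_nonneg D by simp
  have S0: "S \<ge> 0" using S[of k] kl vabs_nonneg order_trans by (metis less_imp_le order_refl)
  have SE: "vabs (E t) \<le> S" if "t \<in> T" for t using that S unfolding T_def grid_def E_def by auto
  have diam: "t - s \<le> len" if sT: "s \<in> T" and tT: "t \<in> T" for s t
  proof -
    obtain i where i: "s = real i / 2 ^ n" "k \<le> i" using sT by (auto simp: T_def grid_def)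
    obtain j where j: "t = real j / 2 ^ n" "j \<le> l" using tT by (auto simp: T_def grid_def)
    note ij = i j
    then have "t - s = (real j - real i) / 2 ^ n" by (simp add: diff_divide_distrib)
    also have "\<dots> \<le> len" unfolding len using ij kl by (intro divide_right_mono) auto
    finally show ?thesis .
  qed
  have len0: "len > 0" unfolding len using kl by simp
  have D1: "z2 * a * len powr \<alpha> < 1" "1 - z2 * a * len powr \<alpha> = D" using D u by auto
  have Ys: "young_solution Y T" unfolding Y T_def by (rule euler_young_solution[OF kl(2)])
  have Yh: "holder_on Y T w"
    using local_holder[OF Ys, of len] diam D1 unfolding w_def by simp
  have ends: "real k / 2 ^ n \<in> T" "real l / 2 ^ n \<in> T" using kl by (auto simp: T_def grid_def)
  then have ends01: "0 \<le> real k / 2 ^ n" "real l / 2 ^ n \<le> 1" using T01 by auto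
  have "real l / 2 ^ n - real k / 2 ^ n \<le> len" using diam ends by blast
  then have yh: "holder_on y {real k / 2 ^ n..real l / 2 ^ n} w"
    using local_holder[OF y[OF ends01], of len] D1 unfolding w_def by simp
  have Tkl: "T \<subseteq> {real k / 2 ^ n..real l / 2 ^ n}" by (auto simp: T_def grid_def divide_right_mono)
  have rho: "vabs (y (real (Suc i) / 2 ^ n) - y (real i / 2 ^ n) - f (y (real i / 2 ^ n)) *v (x (real (Suc i) / 2 ^ n) - x (real i / 2 ^ n)))
     \<le> z2 * a * w * \<Delta> powr (2 * \<alpha>)" if i: "k \<le> i" "i < l" for i
  proof -
    let ?s = "real i / 2 ^ n" and ?t = "real (Suc i) / 2 ^ n"
    have "?s \<in> T" "?t \<in> T" using i unfolding T_def grid_def by (auto simp del: of_nat_Suc)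
    then have st: "?s \<in> {real k / 2 ^ n..real l / 2 ^ n}" "?t \<in> {real k / 2 ^ n..real l / 2 ^ n}" using Tkl by auto
    have "holder_on y ({real k / 2 ^ n..real l / 2 ^ n} \<inter> {?s..?t}) w" using yh by (auto simp: holder_on_def)
    then have "vabs (y ?t - y ?s - f (y ?s) *v (x ?t - x ?s)) \<le> z2 * a * w * (?t - ?s) powr (2 * \<alpha>)"
      using y[OF ends01] st w unfolding young_solution_def by (auto simp: divide_right_mono)
    also have "?t - ?s = \<Delta>" by (simp add: \<Delta>_def add_divide_distrib)
    finally show ?thesis .
  qed
  define A where "A = a * S + z2 * (Q / D) * S * u + z2 * a * w * \<Delta> powr (2 * \<alpha> - 1) * len powr (1 - \<alpha>)"
  have Q0: "Q \<ge> 0" unfolding Q_def using C F \<phi>0_nonneg by simp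
  have z20: "z2 \<ge> 0" using z2_ge by simp
  have A0: "A \<ge> 0" unfolding A_def using a_pos S0 z20 Q0 D w by (intro add_nonneg_nonneg mult_nonneg_nonneg divide_nonneg_nonneg) (auto simp: u)
  define I where "I = {(s, t). s \<in> T \<and> t \<in> T \<and> s \<le> t}"
  obtain b where b: "b \<ge> 0" "holder_on E T b" using finite_holder[of T E] by (auto simp: T_def grid_def)
  have EE: "vabs (E t - E s) \<le> A / (1 - z2 * a * u) * (t - s) powr \<alpha>" if st: "s \<in> T" "t \<in> T" "s \<le> t" for s t
  proof -
    have "(\<lambda>(s, t). vabs (E t - E s)) (s, t) \<le> A / (1 - z2 * a * u) * (\<lambda>(s, t). (t - s) powr \<alpha>) (s, t)"
    proof (rule absorb_holder[where I = I, OF _ _ A0 b(1)])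
      show "0 \<le> z2 * a * u" "z2 * a * u < 1" using z20 a_pos u D by auto
      show "(s, t) \<in> I" using st by (simp add: I_def)
      fix c :: real and st
      assume c: "c \<ge> 0" and H: "\<And>i. i \<in> I \<Longrightarrow> (case i of (s, t) \<Rightarrow> vabs (E t - E s)) \<le> c * (case i of (s, t) \<Rightarrow> (t - s) powr \<alpha>)"
        and "st \<in> I"
      then obtain s t where st: "st = (s, t)" "s \<in> T" "t \<in> T" "s \<le> t" by (auto simp: I_def)
      obtain i j where ij: "s = real i / 2 ^ n" "t = real j / 2 ^ n" "k \<le> i" "i \<le> j" "j \<le> l"
        using grid_pair[OF st(2,3)[unfolded T_def] st(4)] .
      define V where "V t = f (Y t) - f (y t)" for t
      define cV where "cV = CARD('d) * (F1 * c) + CARD('d) * (CARD('d) * (F2 * w) * S)"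
      have cV: "cV \<ge> 0" unfolding cV_def using F c w S0 by simp
      let ?p = "\<lambda>m. real (i + m) / 2 ^ n"
      have part: "is_partition ?p (j - i) s t" unfolding ij by (rule grid_partition[OF ij(4)])
      have "vabs (young_sum V x ?p (j - i) - V s *v (x t - x s)) \<le> CARD('h) * (z2 * cV * C * (t - s) powr (2 * \<alpha>))"
      proof (rule young_sum_bound[OF T01 cV st(4) _ part])
        show "?p ` {..j - i} \<subseteq> T" unfolding T_def by (rule grid_points[OF ij(3-5)])
        fix s' t' i' j' assume *: "s' \<in> T" "t' \<in> T" "s \<le> s'" "s' \<le> t'" "t' \<le> t"
        let ?r = "(t' - s') powr \<alpha>"
        have "vabs (y t' - y s') \<le> w * ?r" "vabs (Y t' - Y s') \<le> w * ?r"
          using holder_on_subset[OF yh Tkl] Yh * unfolding holder_on_def by auto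
        from f2[OF this, of i' j']
        have "\<bar>V t' $ i' $ j' - V s' $ i' $ j'\<bar> \<le> CARD('d) * (F1 * vabs (E t' - E s')) + CARD('d) * (CARD('d) * (F2 * (w * ?r)) * vabs (E s'))"
          by (simp add: V_def E_def)
        also have "\<dots> \<le> CARD('d) * (F1 * (c * ?r)) + CARD('d) * (CARD('d) * (F2 * (w * ?r)) * S)"
          using H[of "(s', t')"] SE[OF *(1)] * F w by (intro add_mono mult_left_mono) (auto simp: I_def)
        also have "\<dots> = cV * ?r" by (simp add: cV_def algebra_simps)
        finally show "\<bar>V t' $ i' $ j' - V s' $ i' $ j'\<bar> \<le> cV * ?r" .
      qed
      also have "CARD('h) * (z2 * cV * C * (t - s) powr (2 * \<alpha>)) = z2 * (a * c + Q / D * S) * (t - s) powr (2 * \<alpha>)"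
        by (simp add: cV_def a_def Q_def w_def algebra_simps)
      also have "\<dots> \<le> z2 * (a * c + Q / D * S) * (u * (t - s) powr \<alpha>)"
        using powr_double_le[of "t - s" len] diam[OF st(2,3)] st z20 a_pos c Q0 D S0 unfolding u
        by (intro mult_left_mono mult_nonneg_nonneg add_nonneg_nonneg divide_nonneg_nonneg) auto
      finally have 1: "vabs (young_sum V x ?p (j - i) - V s *v (x t - x s)) \<le> z2 * (a * c + Q / D * S) * (u * (t - s) powr \<alpha>)" .
      have 2: "vabs (V s *v (x t - x s)) \<le> a * S * (t - s) powr \<alpha>"
      proof -
        have "\<bar>V s $ i' $ j'\<bar> \<le> CARD('d) * (F1 * S)" for i' j'
        proof -
          have "\<bar>V s $ i' $ j'\<bar> \<le> CARD('d) * (F1 * vabs (E s))" using f1[of "Y s" i' j' "y s"] by (simp add: V_def E_def)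
          also have "\<dots> \<le> CARD('d) * (F1 * S)" using SE[OF st(2)] F by (intro mult_left_mono) auto
          finally show ?thesis .
        qed
        from matrix_increment[OF _ _ st(4), of "V s", OF _ _ this] show ?thesis
          using st T01 by (auto simp: a_def mult_ac subset_iff)
      qed
      let ?R = "\<lambda>m. y (?p (Suc m)) - y (?p m) - f (y (?p m)) *v (x (?p (Suc m)) - x (?p m))"
      \<comment> \<open>There are \<open>(t - s) / \<Delta>\<close> local errors of order
        \<open>\<Delta> powr (2 * \<alpha>)\<close>. The bound linear in \<open>t - s\<close> is
        weakened to a Hoelder bound at the price \<open>len powr (1 - \<alpha>)\<close>, which
        recombines to \<open>len\<close> at the end.\<close>
      have 3: "vabs (\<Sum>m<j - i. ?R m) \<le> z2 * a * w * \<Delta> powr (2 * \<alpha> - 1) * len powr (1 - \<alpha>) * (t - s) powr \<alpha>"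
      proof -
        have "vabs (\<Sum>m<j - i. ?R m) \<le> (\<Sum>m<j - i. z2 * a * w * \<Delta> powr (2 * \<alpha>))"
        proof (intro order_trans[OF vabs_sum] sum_mono)
          fix m assume "m \<in> {..<j - i}"
          then show "vabs (?R m) \<le> z2 * a * w * \<Delta> powr (2 * \<alpha>)" using rho[of "i + m"] ij by simp
        qed
        also have "\<dots> = z2 * a * w * (real (j - i) * \<Delta> powr (2 * \<alpha>))" by simp
        also have "real (j - i) * \<Delta> powr (2 * \<alpha>) = \<Delta> powr (2 * \<alpha> - 1) * (t - s)"
        proof -
          have "t - s = real (j - i) * \<Delta>" using ij by (simp add: \<Delta>_def of_nat_diff diff_divide_distrib)
          then show ?thesis using \<Delta> by (simp add: powr_diff)
        qed
        also have "t - s \<le> len powr (1 - \<alpha>) * (t - s) powr \<alpha>"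
        proof -
          have "t - s = (t - s) powr (1 - \<alpha>) * (t - s) powr \<alpha>" using st al by (cases "s = t") (auto simp: powr_add[symmetric])
          also have "\<dots> \<le> len powr (1 - \<alpha>) * (t - s) powr \<alpha>"
            using st diam[OF st(2,3)] al by (intro mult_right_mono powr_mono2) auto
          finally show ?thesis .
        qed
        finally show ?thesis using z20 a_pos w by (simp add: mult.assoc mult_left_mono)
      qed
      have "E t - E s = young_sum V x ?p (j - i) - (\<Sum>m<j - i. ?R m)"
        unfolding E_def V_def[abs_def] ij(1,2) Y by (rule error_increment[OF ij(4)])
      then have "E t - E s = (young_sum V x ?p (j - i) - V s *v (x t - x s)) + V s *v (x t - x s) - (\<Sum>m<j - i. ?R m)" by simp
      then have "vabs (E t - E s) \<le> vabs (young_sum V x ?p (j - i) - V s *v (x t - x s)) + vabs (V s *v (x t - x s)) + vabs (\<Sum>m<j - i. ?R m)"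
        by (rule vabs_three)
      also have "\<dots> \<le> z2 * (a * c + Q / D * S) * (u * (t - s) powr \<alpha>) + a * S * (t - s) powr \<alpha>
         + z2 * a * w * \<Delta> powr (2 * \<alpha> - 1) * len powr (1 - \<alpha>) * (t - s) powr \<alpha>"
        using 1 2 3 by linarith
      also have "\<dots> = (A + z2 * a * u * c) * (t - s) powr \<alpha>" by (simp add: A_def algebra_simps)
      finally show "(case st of (s, t) \<Rightarrow> vabs (E t - E s)) \<le> (A + z2 * a * u * c) * (case st of (s, t) \<Rightarrow> (t - s) powr \<alpha>)"
        by (simp add: st)
    qed (use b(2) in \<open>auto simp: I_def holder_on_def\<close>)
    then show ?thesis by simp
  qed
  have jT: "real j / 2 ^ n \<in> T" using j by (auto simp: T_def grid_def)
  have "vabs (E (real j / 2 ^ n) - E (real k / 2 ^ n)) \<le> A / D * (real j / 2 ^ n - real k / 2 ^ n) powr \<alpha>"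
    using EE[OF ends(1) jT] j D by (simp add: divide_right_mono)
  also have "\<dots> \<le> A / D * u" unfolding u using diam[OF ends(1) jT] j al A0 D
    by (intro mult_left_mono powr_mono2) (auto simp: divide_right_mono)
  also have "\<dots> = (A * u) / D" by simp
  also have "A * u = u * (a + z2 * (Q / D) * u) * S + z2 * a * w * \<Delta> powr (2 * \<alpha> - 1) * (len powr (1 - \<alpha>) * len powr \<alpha>)"
    by (simp add: A_def u algebra_simps)
  also have "len powr (1 - \<alpha>) * len powr \<alpha> = len" using len0 by (simp add: powr_add[symmetric])
  finally have "vabs (E (real j / 2 ^ n) - E (real k / 2 ^ n)) \<le> (u * (a + z2 * (Q / D) * u) * S + z2 * a * \<phi>0 / D * \<Delta> powr (2 * \<alpha> - 1) * len) / D"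
    by (simp add: w_def)
  moreover have "vabs (E (real j / 2 ^ n)) \<le> vabs (E (real k / 2 ^ n)) + vabs (E (real j / 2 ^ n) - E (real k / 2 ^ n))"
    using vabs_triangle[of "E (real k / 2 ^ n)" "E (real j / 2 ^ n) - E (real k / 2 ^ n)"] by simp
  ultimately show ?thesis unfolding E_def \<Delta>_def by linarith
qed

lemma error_step:
  assumes y: "young_solution y {0..1}" "holder_on y {0..1} c" "c \<ge> 0"
    and Y: "Y = euler f x y0 n" and k: "k < 2 ^ n"
  shows "vabs (Y (real (Suc k) / 2 ^ n) - y (real (Suc k) / 2 ^ n))
    \<le> (1 + a * real (2 ^ n) powr (-\<alpha>)) * vabs (Y (real k / 2 ^ n) - y (real k / 2 ^ n))
      + z2 * a * c * (1 / 2 ^ n) powr (2 * \<alpha> - 1) / 2 ^ n"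
proof -
  let ?s = "real k / 2 ^ n" and ?t = "real (Suc k) / 2 ^ n"
  let ?r = "y ?t - y ?s - f (y ?s) *v (x ?t - x ?s)" and ?V = "f (Y ?s) - f (y ?s)"
  have "real (Suc k) \<le> 2 ^ n" using k by (metis Suc_leI of_nat_le_iff of_nat_numeral of_nat_power)
  then have "?t \<le> 1" by (subst divide_le_eq_1_pos) auto
  moreover have "?s \<le> ?t" by (simp add: divide_right_mono)
  moreover from calculation have "?s \<le> 1" by linarith
  ultimately have st: "?s \<in> {0..1}" "?t \<in> {0..1}" "?s \<le> ?t" by auto
  have d: "?t - ?s = 1 / 2 ^ n" by (simp add: add_divide_distrib)
  have "holder_on y ({0..1} \<inter> {?s..?t}) c" using y(2) by (rule holder_on_subset) auto
  then have 1: "vabs ?r \<le> z2 * a * c * (1 / 2 ^ n) powr (2 * \<alpha>)"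
    using y st unfolding young_solution_def d[symmetric] by blast
  have 2: "vabs (?V *v (x ?t - x ?s)) \<le> a * real (2 ^ n) powr (-\<alpha>) * vabs (Y ?s - y ?s)"
  proof -
    have "\<bar>?V $ i $ j\<bar> \<le> CARD('d) * (F1 * vabs (Y ?s - y ?s))" for i j using f1[of "Y ?s" i j "y ?s"] by simp
    from matrix_increment[OF st, of ?V, OF this] 
    have "vabs (?V *v (x ?t - x ?s)) \<le> CARD('h) * C * (CARD('d) * (F1 * vabs (Y ?s - y ?s))) * (1 / 2 ^ n) powr \<alpha>"
      unfolding d .
    also have "(1 / 2 ^ n :: real) powr \<alpha> = real (2 ^ n) powr (-\<alpha>)" by (simp add: powr_divide powr_minus_divide)
    finally show ?thesis by (simp add: a_def mult_ac)
  qed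
  have "Y ?t - y ?t = (Y ?s - y ?s) + ?V *v (x ?t - x ?s) - ?r"
    unfolding Y euler_at_grid by (simp add: matrix_vector_mult_diff_rdistrib algebra_simps)
  then have "vabs (Y ?t - y ?t) \<le> vabs (Y ?s - y ?s) + vabs (?V *v (x ?t - x ?s)) + vabs ?r"
    by (rule vabs_three)
  also have "\<dots> \<le> vabs (Y ?s - y ?s) + a * real (2 ^ n) powr (-\<alpha>) * vabs (Y ?s - y ?s) + z2 * a * c * (1 / 2 ^ n) powr (2 * \<alpha>)"
    using 1 2 by linarith
  also have "(1 / 2 ^ n :: real) powr (2 * \<alpha>) = (1 / 2 ^ n) powr (2 * \<alpha> - 1) / 2 ^ n"
    by (simp add: powr_diff)
  finally show ?thesis by (simp add: algebra_simps)
qed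

end

section \<open>The error estimate with the explicit constants\<close>

theorem theorem9:
  fixes f :: "real^'d::finite \<Rightarrow> real^'h::finite^'d"
    and x :: "real \<Rightarrow> real^'h"
    and y :: "real \<Rightarrow> real^'d"
    and y0 :: "real^'d"
    and \<alpha> C :: real
  assumes alpha: "1/2 < \<alpha>" "\<alpha> \<le> 1"
    and C_pos: "0 < C"
    and hoelder: "\<forall>s\<in>{0..1}. \<forall>t\<in>{0..1}. vabs (x t - x s) \<le> C * \<bar>t - s\<bar> powr \<alpha>"
    and smooth: "\<forall>i j. C2 (\<lambda>z. f z $ i $ j)"
    and bnd0: "bounded (range f)"
    and bnd1: "\<forall>i j k. bounded (range (pd (\<lambda>z. f z $ i $ j) k))"
    and bnd2: "\<forall>i j k l. bounded (range (pd (pd (\<lambda>z. f z $ i $ j) k) l))"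
    and nondeg: "norm1 f > 0"
    and y_cont: "continuous_on {0..1} y"
    and y_pvar: "\<exists>q\<ge>1. 1 / q + \<alpha> > 1 \<and> finite_pvar q y 0 1"
    and y_sol: "\<forall>t\<in>{0..1}. has_young_integral (\<lambda>s. f (y s)) x 0 t (y t - y0)"
  shows "\<forall>n::nat. \<forall>t\<in>{0..1}.
    (let D = real CARD('d); H = real CARD('h);
         F0 = norm0 f; F1 = norm1 f; F2 = norm2 f; K = Kc (2 * \<alpha>);
         G1s = 2 * H * real_of_int \<lceil>(2 * D * H * C * K * F1) powr (1 / \<alpha>)\<rceil> powr (1 - \<alpha>) * F0 * C;
         G2s = D * H * K * F1 * C * G1s;
         L = 4 / (1 - 2 powr (1 - 2 * \<alpha>)) * (H * C)\<^sup>2 * F1 * F0;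
         \<omega> = (H * F0 * C / L) powr (1 / \<alpha>);
         G1 = (L + H * F0 * C) * (1 + 1 / \<omega>);
         \<zeta> = H * K * C * (D * F1 + D\<^sup>2 * F2 * (G1s + G1));
         \<upsilon> = C * (D\<^sup>2 * H * K * F2 * (G1s + G1) + D * F1);
         G = Ups G2s \<upsilon> \<zeta> (nat \<lceil>(4 * \<zeta>) powr (1 / \<alpha>)\<rceil>) + G1s
     in vabs (euler f x y0 n t - y t) \<le> G * (1 / 2 ^ n) powr (2 * \<alpha> - 1))"
proof (intro allI ballI)
  fix n :: nat and t :: real assume t: "t \<in> {0..1}"
  define D where "D = real CARD('d)"
  define H where "H = real CARD('h)"
  define F0 where "F0 = norm0 f"
  define F1 where "F1 = norm1 f"
  define F2 where "F2 = norm2 f"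
  have f0: "\<bar>f z $ i $ j\<bar> \<le> F0" for z i j unfolding F0_def by (rule abs_le_norm0[OF bnd0])
  have p1: "\<bar>pd (\<lambda>z. f z $ i $ j) k z\<bar> \<le> F1" for z i j k
    unfolding F1_def using bnd1 by (intro abs_le_norm1) auto
  have p2: "\<bar>pd (pd (\<lambda>z. f z $ i $ j) k) l z\<bar> \<le> F2" for z i j k l
    unfolding F2_def using bnd2 by (intro abs_le_norm2) auto
  have sm: "has_pd (\<lambda>z. f z $ i $ j) k z" "continuous_on UNIV (pd (\<lambda>z. f z $ i $ j) k)"
    "has_pd (pd (\<lambda>z. f z $ i $ j) k) l z" "continuous_on UNIV (pd (pd (\<lambda>z. f z $ i $ j) k) l)" for i j k l z
    using smooth by (auto simp: C2_def)
  have F: "F0 \<ge> 0" "F1 > 0" "F2 \<ge> 0"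
    using f0[of undefined undefined undefined] p2[of undefined undefined undefined undefined undefined] nondeg
    by (auto simp: F1_def intro: order_trans[OF abs_ge_zero])
  have landau: "F1\<^sup>2 \<le> 2 * (F0 * F2)"
    unfolding F0_def F1_def F2_def using smooth bnd0 bnd1 bnd2 nondeg by (intro norm1_square_le) auto
  interpret young_ode f x \<alpha> C F0 F1 F2
  proof
    show "vabs (x t - x s) \<le> C * (t - s) powr \<alpha>" if "s \<in> {0..1}" "t \<in> {0..1}" "s \<le> t" for s t
      using hoelder that by fastforce
  qed (use alpha C_pos F f0 lipschitz_of_partials[OF sm(1,2) p1] second_difference_bound[OF sm(1,2) p1 sm(3,4) p2] in auto)
  obtain q' where q': "q' \<ge> 1" "1 / q' + \<alpha> > 1" "finite_pvar q' y 0 1" using y_pvar by blast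
  have ys: "young_solution y {l..r}" if "0 \<le> l" "r \<le> 1" for l r
    using y_sol by (intro exact_young_solution[OF _ q' that]) auto
  have DH: "D \<ge> 1" "H \<ge> 1" by (auto simp: D_def H_def Suc_le_eq)
  define N where "N = \<lceil>(2 * D * H * C * Kc (2 * \<alpha>) * F1) powr (1 / \<alpha>)\<rceil>"
  have Kc: "Kc (2 * \<alpha>) = K" by (simp add: Kc_eq z2_def)
  have aK: "a = H * C * D * F1" by (simp add: a_def H_def D_def)
  have N: "N = \<lceil>(2 * (K * a)) powr (1/\<alpha>)\<rceil>" unfolding N_def Kc aK by (simp add: mult_ac)
  define G1s where "G1s = 2 * H * real_of_int N powr (1 - \<alpha>) * F0 * C"
  have G1s: "G1s = 2 * \<phi>0 * real_of_int N powr (1 - \<alpha>)" by (simp add: G1s_def \<phi>0_def H_def)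
  note gh = global_holder[OF ys N, folded G1s]
  \<comment> \<open>Source of the factor 2 by which \<open>G1s\<close> exceeds
    \<open>\<phi>0\<close>, and thus of the gain \<open>1 / (2 * D)\<close> on blocks.\<close>
  have "real_of_int N powr (1 - \<alpha>) \<ge> 1" using gh(2) alpha by (intro ge_one_powr_ge_zero) auto
  then have G1s2: "G1s \<ge> 2 * \<phi>0" unfolding G1s using \<phi>0_nonneg by (simp add: mult_le_cancel_left1)
  then have G1s0: "G1s \<ge> 0" using \<phi>0_nonneg by linarith
  define G2s where "G2s = D * H * Kc (2 * \<alpha>) * F1 * C * G1s"
  have G2s: "G2s = K * a * G1s" unfolding G2s_def Kc aK by (simp add: mult_ac)
  define L where "L = 4 / (1 - 2 powr (1 - 2 * \<alpha>)) * (H * C)\<^sup>2 * F1 * F0"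
  define \<omega> where "\<omega> = (H * F0 * C / L) powr (1 / \<alpha>)"
  define G1 where "G1 = (L + H * F0 * C) * (1 + 1 / \<omega>)"
  have "2 powr (1 - 2 * \<alpha>) \<le> (2::real) powr 0" using alpha by (intro powr_mono) auto
  then have L0: "L \<ge> 0" unfolding L_def using F by (intro mult_nonneg_nonneg divide_nonneg_nonneg) auto
  \<comment> \<open>If \<open>F0 = 0\<close>, then \<open>L\<close>, \<open>\<omega>\<close> and
    \<open>1 / \<omega>\<close> are all 0 by the convention for division, and both sides
    vanish.\<close>
  have "\<phi>0 * 1 \<le> (L + \<phi>0) * (1 + 1 / \<omega>)" using L0 \<phi>0_nonneg by (intro mult_mono) (auto simp: \<omega>_def)
  then have G1: "G1 \<ge> \<phi>0" by (simp add: G1_def \<phi>0_def H_def)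
  define \<zeta> where "\<zeta> = H * Kc (2 * \<alpha>) * C * (D * F1 + D\<^sup>2 * F2 * (G1s + G1))"
  define \<upsilon> where "\<upsilon> = C * (D\<^sup>2 * H * Kc (2 * \<alpha>) * F2 * (G1s + G1) + D * F1)"
  define q where "q = H * C * D\<^sup>2 * F2 * (G1s + G1)"
  define M where "M = nat \<lceil>(4 * \<zeta>) powr (1 / \<alpha>)\<rceil>"
  define \<epsilon> where "\<epsilon> k = vabs (euler f x y0 n (real k / 2 ^ n) - y (real k / 2 ^ n))" for k
  define D' where "D' = (1 / 2 ^ n :: real) powr (2 * \<alpha> - 1)"
  have QH: "Q = H * C * D\<^sup>2 * F2 * \<phi>0" by (simp add: Q_def H_def D_def power2_eq_square mult_ac)
  have K0: "K \<ge> 1" using z2_ge by simp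
  have G2s0: "G2s \<ge> 0" unfolding G2s using K0 a_pos G1s0 by simp
  interpret error_recursion \<alpha> a Q q z2 K \<upsilon> \<zeta> G2s D' n M \<epsilon>
  proof
    show "Q \<ge> 0" unfolding QH using DH C_pos F \<phi>0_nonneg by simp
    have "a\<^sup>2 = (H * C * D)\<^sup>2 * F1\<^sup>2" by (simp add: aK power2_eq_square mult_ac)
    also have "\<dots> \<le> (H * C * D)\<^sup>2 * (2 * (F0 * F2))" using landau by (intro mult_left_mono) auto
    also have "\<dots> = 2 * Q" by (simp add: QH \<phi>0_def H_def power2_eq_square mult_ac)
    finally show "a\<^sup>2 \<le> 2 * Q" .
    have "H * C * D\<^sup>2 * F2 * (3 * \<phi>0) \<le> q" unfolding q_def using G1s2 G1 DH C_pos F by (intro mult_left_mono) auto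
    then show "3 * Q \<le> q" by (simp add: QH mult_ac)
    show "\<zeta> = K * (a + q)" unfolding \<zeta>_def Kc aK q_def by (simp add: algebra_simps)
    have "0 \<le> C * (D * F1)" using C_pos DH F by simp
    then show "K * q \<le> \<upsilon>" unfolding \<upsilon>_def q_def Kc by (simp add: algebra_simps)
    \<comment> \<open>At time 0 the equation is an integral over a point: the partition without
      steps has Riemann sum 0, hence \<open>y 0 = y0\<close>.\<close>
    show "\<epsilon> 0 \<le> 0"
    proof -
      have "has_young_integral (\<lambda>s. f (y s)) x 0 0 (y 0 - y0)" using y_sol by auto
      have "vabs (y 0 - y0) \<le> 0 + e" if e0: "e > 0" for e :: real
      proof -
        obtain \<delta> where d: "\<delta> > 0" "\<And>p m. is_partition p m 0 0 \<Longrightarrow> mesh p m < \<delta> \<Longrightarrow> vabs (young_sum (\<lambda>s. f (y s)) x p m - (y 0 - y0)) < e"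
          using \<open>has_young_integral _ _ _ _ _\<close>[unfolded has_young_integral_def, THEN spec, THEN mp, OF e0] by auto
        have "vabs (young_sum (\<lambda>s. f (y s)) x (\<lambda>_. 0) 0 - (y 0 - y0)) < e"
          using d(1) by (intro d(2)) (auto simp: is_partition_def mesh_def)
        also have "young_sum (\<lambda>s. f (y s)) x (\<lambda>_. 0) 0 - (y 0 - y0) = - (y 0 - y0)"
          by (simp add: young_sum_def)
        finally show ?thesis unfolding vabs_minus by simp
      qed
      then have "vabs (y 0 - y0) \<le> 0" by (rule field_le_epsilon)
      then show ?thesis using euler_at_grid[of f x y0 n 0] vabs_minus_commute[of "y 0" y0] by (simp add: \<epsilon>_def)
    qed
    \<comment> \<open>\<open>G2s\<close> has the factor \<open>K\<close> where the local error has
      \<open>z2\<close>.\<close>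
    have kG: "z2 / K * G2s = z2 * a * G1s" unfolding G2s using K0 by simp
    show "\<epsilon> (Suc k) \<le> (1 + a * real (2 ^ n) powr - \<alpha>) * \<epsilon> k + z2 / K * G2s * D' / 2 ^ n" if "k < 2 ^ n" for k
      unfolding \<epsilon>_def D'_def kG
      by (rule error_step[OF ys gh(1) G1s0 refl that]) auto
    fix j r k :: nat and S B u :: real
    assume j: "j \<le> n" and u: "u = real (2 ^ j) powr - \<alpha>" and B: "B = 1 - z2 * a * u" "1/2 \<le> B" and r: "r < 2 ^ j"
      and S: "\<And>k. r * 2 ^ (n - j) \<le> k \<Longrightarrow> k \<le> (r + 1) * 2 ^ (n - j) \<Longrightarrow> \<epsilon> k \<le> S"
      and k: "r * 2 ^ (n - j) \<le> k" "k \<le> (r + 1) * 2 ^ (n - j)"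
    define l0 where "l0 = r * 2 ^ (n - j)"
    define l1 where "l1 = (r + 1) * 2 ^ (n - j)"
    have e: "(2::nat) ^ j * 2 ^ (n - j) = 2 ^ n" using j by (simp add: power_add[symmetric])
    have "l1 \<le> 2 ^ j * 2 ^ (n - j)" unfolding l1_def using r by (intro mult_right_mono) auto
    then have l: "l0 < l1" "l1 \<le> 2 ^ n" "l1 - l0 = 2 ^ (n - j)" unfolding e by (auto simp: l0_def l1_def)
    have "real (2 ^ j * 2 ^ (n - j)) = real (2 ^ n)" by (simp only: e)
    then have len: "1 / 2 ^ j = real (l1 - l0) / 2 ^ n" unfolding l(3) by (simp add: field_simps)
    have u': "u = (1 / 2 ^ j) powr \<alpha>" unfolding u by (simp add: powr_divide powr_minus_divide)
    have "\<epsilon> k \<le> \<epsilon> l0 + (u * (a + z2 * (Q / B) * u) * S + z2 * a * \<phi>0 / B * D' * (1 / 2 ^ j)) / B"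
      using S k B(2) unfolding \<epsilon>_def D'_def l0_def[symmetric] l1_def[symmetric]
      by (intro error_block[OF ys l(1,2) len u' B(1) _ refl]) auto
    also have "\<dots> \<le> \<epsilon> l0 + (u * (a + z2 * (Q / B) * u) * S + z2 / K * G2s / (2 * B) * D' * (1 / 2 ^ j)) / B"
    proof -
      have "z2 * a * (2 * \<phi>0) / (2 * B) \<le> z2 / K * G2s / (2 * B)"
        unfolding kG using G1s2 B(2) a_pos z2_ge(1) by (intro divide_right_mono mult_left_mono) auto
      then have "z2 * a * \<phi>0 / B * D' * (1 / 2 ^ j) \<le> z2 / K * G2s / (2 * B) * D' * (1 / 2 ^ j)"
        by (intro mult_right_mono) (auto simp: D'_def)
      then show ?thesis using B(2) by (intro add_left_mono divide_right_mono) auto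
    qed
    finally show "\<epsilon> k \<le> \<epsilon> (r * 2 ^ (n - j)) + (u * (a + z2 * (Q / B) * u) * S + z2 / K * G2s / (2 * B) * D' / 2 ^ j) / B"
      by (simp add: l0_def)
  qed (use alpha a_pos z2_ge G2s0 in \<open>auto simp: M_def D'_def\<close>)
  define k where "k = nat \<lfloor>t * 2 ^ n\<rfloor>"
  have k: "real k \<le> t * 2 ^ n" "t * 2 ^ n < real k + 1"
    using t by (auto simp: k_def)
  have "t * 2 ^ n \<le> 1 * 2 ^ n" using t by (intro mult_right_mono) auto
  with k have "real k \<le> 2 ^ n" by linarith
  then have k2: "k \<le> 2 ^ n" by (metis of_nat_le_iff of_nat_numeral of_nat_power)
  have "t \<le> (real k + 1) / 2 ^ n" using k(2) by (simp add: pos_le_divide_eq)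
  then have kt: "0 \<le> real k / 2 ^ n" "real k / 2 ^ n \<le> t" "t - real k / 2 ^ n \<le> 1 / 2 ^ n"
    using k(1) by (auto simp: add_divide_distrib pos_divide_le_eq)
  have "real k / 2 ^ n \<in> {0..1}" using kt t by (meson atLeastAtMost_iff order_trans)
  then have "vabs (y t - y (real k / 2 ^ n)) \<le> G1s * (t - real k / 2 ^ n) powr \<alpha>"
    using gh(1) kt(2) t unfolding holder_on_def by blast
  also have "\<dots> \<le> G1s * (1 / 2 ^ n) powr \<alpha>" using kt G1s0 alpha by (intro mult_left_mono powr_mono2) auto
  \<comment> \<open>\<open>2 * \<alpha> - 1 \<le> \<alpha>\<close> since
    \<open>\<alpha> \<le> 1\<close>, and the base is at most 1. This oscillation of the solution
    within a grid interval accounts for the summand \<open>G1s\<close> of \<open>G\<close>.\<close>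
  also have "\<dots> \<le> G1s * D'" unfolding D'_def using G1s0 alpha by (intro mult_left_mono powr_mono') auto
  finally have yt: "vabs (y t - y (real k / 2 ^ n)) \<le> G1s * D'" .
  have "euler f x y0 n t - y t = (euler f x y0 n (real k / 2 ^ n) - y (real k / 2 ^ n)) - (y t - y (real k / 2 ^ n))"
    unfolding euler_at_grid by (simp add: euler_def k_def)
  then have "vabs (euler f x y0 n t - y t) \<le> \<epsilon> k + vabs (y t - y (real k / 2 ^ n))"
    unfolding \<epsilon>_def by (metis vabs_triangle_sub)
  also have "\<dots> \<le> Ups G2s \<upsilon> \<zeta> M * D' + G1s * D'" by (intro add_mono error_bound[OF k2] yt)
  also have "\<dots> = (Ups G2s \<upsilon> \<zeta> M + G1s) * D'" by (simp add: distrib_right)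
  finally have "vabs (euler f x y0 n t - y t) \<le> (Ups G2s \<upsilon> \<zeta> M + G1s) * (1 / 2 ^ n) powr (2 * \<alpha> - 1)"
    unfolding D'_def .
  then show "let D = real CARD('d); H = real CARD('h);
         F0 = norm0 f; F1 = norm1 f; F2 = norm2 f; K = Kc (2 * \<alpha>);
         G1s = 2 * H * real_of_int \<lceil>(2 * D * H * C * K * F1) powr (1 / \<alpha>)\<rceil> powr (1 - \<alpha>) * F0 * C;
         G2s = D * H * K * F1 * C * G1s;
         L = 4 / (1 - 2 powr (1 - 2 * \<alpha>)) * (H * C)\<^sup>2 * F1 * F0;
         \<omega> = (H * F0 * C / L) powr (1 / \<alpha>);
         G1 = (L + H * F0 * C) * (1 + 1 / \<omega>);
         \<zeta> = H * K * C * (D * F1 + D\<^sup>2 * F2 * (G1s + G1));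
         \<upsilon> = C * (D\<^sup>2 * H * K * F2 * (G1s + G1) + D * F1);
         G = Ups G2s \<upsilon> \<zeta> (nat \<lceil>(4 * \<zeta>) powr (1 / \<alpha>)\<rceil>) + G1s
     in vabs (euler f x y0 n t - y t) \<le> G * (1 / 2 ^ n) powr (2 * \<alpha> - 1)"
    unfolding Let_def D_def H_def F0_def F1_def F2_def N_def G1s_def G2s_def L_def \<omega>_def G1_def \<zeta>_def \<upsilon>_def M_def .
qed

end
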